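(* Let $X$ be an $n$-dimensional $\mathbb{Q}$-factorial complete toric variety of rank $r$ presented as a geometric quotient $X=(\mathbb{C}^{n+r}\setminus Z)/G$ with $G\cong(\mathbb{C}^* )^r\oplus\bigoplus_{k=1}^s\mu_{\tau_k}$, $1<\tau_1\,|\,\cdots\,|\,\tau_s$, where the action of $G$ is described by a reduced $W$-matrix $Q=(q_{ij})\in\mathbf{M}(r,n+r;\mathbb{Z})$ and a torsion matrix $\Gamma=(\gamma_{kj})$, $\gamma_{kj}\in\mathbb{Z}/\tau_k\mathbb{Z}$ ($1\le k\le s$, $1\le j\le n+r$). Let $\widehat V=\mathcal{G}(Q)$. Then a matrix $\beta\in\mathrm{GL}_n(\mathbb{Q})\cap\mathbf{M}_n(\mathbb{Z})$ such that $V=\beta\cdot\widehat V$ is a fan matrix of $X$ can be reconstructed as follows: 1. define a matrix $C=(c_{kj})\in\mathbf{M}(s,n+r;\mathbb{Z})$ by choosing a representative $c_{kj}\in\mathbb{Z}$ of every entry $\gamma_{kj}$ of $\Gamma$; 2. consider the matrix $K:=\begin{pmatrix}\widehat V\cdot C^T\\ \mathrm{diag}(\tau_1,\dots,\tau_s)\end{pmatrix}\in\mathbf{M}(n+s,s;\mathbb{Z})$; 3. let $U\in\mathrm{GL}_{n+s}(\mathbb{Z})$ be such that $\mathrm{HNF}(K)=U\cdot K$. Then $\beta=({}_nU)_{\{1,\dots,n\}}$, i.e. $\beta$ is the submatrix of $U$ formed by the last $n$ rows and the first $n$ columns.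
   Context: A $\mathbb{Q}$-factorial complete toric variety of dimension $n$ and rank $r$ is the complex toric variety of a simplicial complete rational fan in $N_{\mathbb{R}}$, $N\cong\mathbb{Z}^n$, with $n+r$ rays. A fan matrix of it is an $n\times(n+r)$ integer matrix whose columns, with respect to some basis of $N$, generate the rays of the fan. $F$-matrix: an $n\times(n+r)$ integer matrix of rank $n$ whose columns are nonzero, generate $\mathbb{R}^n$ as a cone, and are such that no column is a positive multiple of another; reduced if each column has coprime entries. Gale dual: for an integer matrix $A$ with $m$ columns, $\mathcal{G}(A)$ is a matrix whose rows form a $\mathbb{Z}$-basis of $\{q\in\mathbb{Z}^m:Aq^T=0\}$, defined up to left multiplication by a unimodular matrix. $W$-matrix: an $r\times(n+r)$ integer matrix $Q$ such that (a) $\mathrm{rk}\,Q=r$; (b) the lattice $\mathcal{L}_r(Q)$ spanned by the rows has torsion-free quotient in $\mathbb{Z}^{n+r}$; (c) $\mathcal{L}_r(Q)$ has a basis of vectors with nonnegative entries; (d) all columns of $Q$ are nonzero; (e) $\mathcal{L}_r(Q)$ contains no standard basis vector; (f) $\mathcal{L}_r(Q)$ contains no vector with exactly two nonzero entries $a,b$ with $ab<0$. It is reduced if $\mathcal{G}(Q)$ is a reduced $F$-matrix. Presentation of $X$: $Z\subseteq\mathbb{C}^{n+r}$ is an algebraic subset defined by a monomial ideal $B\subseteq\mathbb{C}[x_1,\dots,x_{n+r}]$ (the irrelevant ideal of a simplicial fan $\widehat\Sigma$ whose rays are those generated by the columns of $\widehat V$ and whose support is $\mathbb{R}^n$). $G=\mathrm{Hom}(A,\mathbb{C}^*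 )\subseteq(\mathbb{C}^* )^{n+r}$ for a finitely generated abelian group $A$ of rank $r$, $\mu_{\tau}$ is the group of $\tau$-th roots of unity, and $(\mathbf t,\boldsymbol\varepsilon)\in G$ with $\mathbf t\in(\mathbb{C}^* )^r$, $\boldsymbol\varepsilon\in\bigoplus_k\mu_{\tau_k}$ acts on $\mathbb{C}^{n+r}$ by $$(\mathbf t,\boldsymbol\varepsilon)\cdot\mathbf x=\Big(\prod_{i=1}^rt_i^{q_{ij}}\cdot\prod_{k=1}^s\varepsilon_k^{c_{kj}}\cdot x_j\Big)_{1\le j\le n+r},$$ where $c_{kj}\in\mathbb{Z}$ is any representative of $\gamma_{kj}$. It is assumed that this action gives a geometric quotient $(\mathbb{C}^{n+r}\setminus Z)/G$ which is precisely the toric variety $X$. Matrix notation: ${}_nU$ is the submatrix of the lower $n$ rows of $U$, and $A_{\{1,\dots,n\}}$ is the submatrix of the first $n$ columns. $\mathrm{HNF}(K)$ is the (row-style) Hermite normal form: the unique matrix $UK$ with $U$ unimodular that is in row echelon form with zero rows at the bottom, positive pivots, and entries above each pivot nonnegative and smaller than the pivot. *)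

theory Defs
  imports
    "Jordan_Normal_Form.DL_Rank"
    "HOL-Algebra.IntRing"
    "HOL-Analysis.Abstract_Topology"
begin

text \<open>
  Throughout, \<open>N = \<int>\<^sup>n\<close> is \<^term>\<open>carrier_vec n :: int vec set\<close>, \<open>N\<^sub>\<real> = \<real>\<^sup>n\<close> is
  \<^term>\<open>carrier_vec n :: real vec set\<close>, and the dual lattice \<open>M\<close> is identified with \<open>\<int>\<^sup>n\<close> by the
  dot product.
\<close>

abbreviation rvec :: "int vec \<Rightarrow> real vec" where
  "rvec \<equiv> map_vec real_of_int"

section \<open>Cones and fans\<close>

definition pos_cone :: "real mat \<Rightarrow> real vec set" where
  "pos_cone A = {A *\<^sub>v x |x. x \<in> carrier_vec (dim_col A) \<and> (\<forall>j<dim_col A. 0 \<le> x $ j)}"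

definition ray_of :: "real vec \<Rightarrow> real vec set" where
  "ray_of v = {c \<cdot>\<^sub>v v |c. 0 \<le> c}"

definition rational_cone :: "nat \<Rightarrow> real vec set \<Rightarrow> bool" where
  "rational_cone n \<sigma> \<longleftrightarrow>
     (\<exists>A :: int mat. dim_row A = n \<and> \<sigma> = pos_cone (map_mat real_of_int A))"

definition strongly_convex :: "nat \<Rightarrow> real vec set \<Rightarrow> bool" where
  "strongly_convex n \<sigma> \<longleftrightarrow> (\<forall>x\<in>\<sigma>. - x \<in> \<sigma> \<longrightarrow> x = 0\<^sub>v n)"

definition simplicial_cone :: "nat \<Rightarrow> real vec set \<Rightarrow> bool" where
  "simplicial_cone n \<sigma> \<longleftrightarrow>
     (\<exists>A. dim_row A = n \<and> \<sigma> = pos_cone A \<and>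
          (\<forall>x\<in>carrier_vec (dim_col A). A *\<^sub>v x = 0\<^sub>v n \<longrightarrow> x = 0\<^sub>v (dim_col A)))"

definition face :: "nat \<Rightarrow> real vec set \<Rightarrow> real vec set \<Rightarrow> bool" where
  "face n \<rho> \<sigma> \<longleftrightarrow>
     (\<exists>u\<in>carrier_vec n. (\<forall>x\<in>\<sigma>. 0 \<le> u \<bullet> x) \<and> \<rho> = {x \<in> \<sigma>. u \<bullet> x = 0})"

definition rational_fan :: "nat \<Rightarrow> real vec set set \<Rightarrow> bool" where
  "rational_fan n \<Delta> \<longleftrightarrow>
     finite \<Delta> \<and> \<Delta> \<noteq> {} \<and>
     (\<forall>\<sigma>\<in>\<Delta>. rational_cone n \<sigma> \<and> strongly_convex n \<sigma>) \<and>
     (\<forall>\<sigma>\<in>\<Delta>. \<forall>\<rho>. face n \<rho> \<sigma> \<longrightarrow> \<rho> \<in> \<Delta>) \<and>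
     (\<forall>\<sigma>\<in>\<Delta>. \<forall>\<sigma>'\<in>\<Delta>. face n (\<sigma> \<inter> \<sigma>') \<sigma> \<and> face n (\<sigma> \<inter> \<sigma>') \<sigma>')"

definition simplicial_fan :: "nat \<Rightarrow> real vec set set \<Rightarrow> bool" where
  "simplicial_fan n \<Delta> \<longleftrightarrow> (\<forall>\<sigma>\<in>\<Delta>. simplicial_cone n \<sigma>)"

definition complete_fan :: "nat \<Rightarrow> real vec set set \<Rightarrow> bool" where
  "complete_fan n \<Delta> \<longleftrightarrow> \<Union>\<Delta> = carrier_vec n"

definition rays :: "nat \<Rightarrow> real vec set set \<Rightarrow> real vec set set" where
  "rays n \<Delta> = {\<rho> \<in> \<Delta>. \<exists>v\<in>carrier_vec n. v \<noteq> 0\<^sub>v n \<and> \<rho> = ray_of v}"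

text \<open>
  The columns of \<open>B\<close> are the basis of \<open>N\<close> with respect to which the columns of \<open>V\<close> are read.
  A column of \<open>V\<close> need not be a primitive lattice vector.
\<close>

definition fan_matrix :: "nat \<Rightarrow> real vec set set \<Rightarrow> int mat \<Rightarrow> bool" where
  "fan_matrix n \<Delta> V \<longleftrightarrow>
     V \<in> carrier_mat n (card (rays n \<Delta>)) \<and>
     (\<exists>B\<in>carrier_mat n n. invertible_mat B \<and>
        bij_betw (\<lambda>j. ray_of (rvec (col (B * V) j))) {..<dim_col V} (rays n \<Delta>))"

section \<open>F-matrices, Gale duality and W-matrices\<close>

definition row_lattice :: "int mat \<Rightarrow> int vec set" where
  "row_lattice Q = {transpose_mat Q *\<^sub>v a |a. a \<in> carrier_vec (dim_row Q)}"

definition rows_form_basis :: "int mat \<Rightarrow> int vec set \<Rightarrow> bool" where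
  "rows_form_basis B L \<longleftrightarrow>
     row_lattice B = L \<and>
     (\<forall>a\<in>carrier_vec (dim_row B).
        transpose_mat B *\<^sub>v a = 0\<^sub>v (dim_col B) \<longrightarrow> a = 0\<^sub>v (dim_row B))"

definition gale_dual :: "int mat \<Rightarrow> int mat \<Rightarrow> bool" where
  "gale_dual A V \<longleftrightarrow>
     rows_form_basis V {q \<in> carrier_vec (dim_col A). A *\<^sub>v q = 0\<^sub>v (dim_row A)}"

definition F_matrix :: "nat \<Rightarrow> nat \<Rightarrow> int mat \<Rightarrow> bool" where
  "F_matrix n r V \<longleftrightarrow>
     V \<in> carrier_mat n (n + r) \<and>
     vec_space.rank n (map_mat rat_of_int V) = n \<and>
     (\<forall>j<n + r. col V j \<noteq> 0\<^sub>v n) \<and>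
     pos_cone (map_mat real_of_int V) = carrier_vec n \<and>
     (\<forall>i<n + r. \<forall>j<n + r. i \<noteq> j \<longrightarrow>
        \<not> (\<exists>c>0. rvec (col V i) = c \<cdot>\<^sub>v rvec (col V j)))"

definition reduced_F_matrix :: "nat \<Rightarrow> nat \<Rightarrow> int mat \<Rightarrow> bool" where
  "reduced_F_matrix n r V \<longleftrightarrow>
     F_matrix n r V \<and> (\<forall>j<n + r. Gcd {V $$ (i, j) |i. i < n} = 1)"

definition W_matrix :: "nat \<Rightarrow> nat \<Rightarrow> int mat \<Rightarrow> bool" where
  "W_matrix n r Q \<longleftrightarrow>
     Q \<in> carrier_mat r (n + r) \<and>
     vec_space.rank r (map_mat rat_of_int Q) = r \<and>
     (\<forall>x\<in>carrier_vec (n + r). \<forall>k. k \<noteq> 0 \<and> k \<cdot>\<^sub>v x \<in> row_lattice Q \<longrightarrow> x \<in> row_lattice Q) \<and>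
     (\<exists>B. rows_form_basis B (row_lattice Q) \<and>
          (\<forall>i<dim_row B. \<forall>j<dim_col B. 0 \<le> B $$ (i, j))) \<and>
     (\<forall>j<n + r. col Q j \<noteq> 0\<^sub>v r) \<and>
     (\<forall>j<n + r. unit_vec (n + r) j \<notin> row_lattice Q) \<and>
     \<not> (\<exists>x\<in>row_lattice Q. \<exists>i<n + r. \<exists>j<n + r. i \<noteq> j \<and> x $ i * x $ j < 0 \<and>
          (\<forall>k<n + r. k \<noteq> i \<and> k \<noteq> j \<longrightarrow> x $ k = 0))"

definition reduced_W_matrix :: "nat \<Rightarrow> nat \<Rightarrow> int mat \<Rightarrow> bool" where
  "reduced_W_matrix n r Q \<longleftrightarrow>
     W_matrix n r Q \<and> (\<forall>V. gale_dual Q V \<longrightarrow> reduced_F_matrix n r V)"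

section \<open>Hermite normal form\<close>

text \<open>\<open>f i\<close> is the pivot column of row \<open>i\<close>, and \<open>f i = dim_col H\<close> means that row \<open>i\<close> is zero.\<close>

definition hermite_form :: "int mat \<Rightarrow> bool" where
  "hermite_form H \<longleftrightarrow>
     (\<exists>f :: nat \<Rightarrow> nat. \<forall>i<dim_row H.
        f i \<le> dim_col H \<and>
        (\<forall>j<f i. H $$ (i, j) = 0) \<and>
        (f i < dim_col H \<longrightarrow>
           0 < H $$ (i, f i) \<and>
           (\<forall>i'<i. 0 \<le> H $$ (i', f i) \<and> H $$ (i', f i) < H $$ (i, f i))) \<and>
        (Suc i < dim_row H \<longrightarrow> f i < f (Suc i) \<or> f (Suc i) = dim_col H))"

definition HNF :: "int mat \<Rightarrow> int mat" where
  "HNF K = (THE H. hermite_form H \<and>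
     (\<exists>U\<in>carrier_mat (dim_row K) (dim_row K). invertible_mat U \<and> H = U * K))"

section \<open>Varieties as topological spaces with regular functions\<close>

text \<open>
  An affine variety is given by its set \<open>P\<close> of complex points and its coordinate ring \<open>A\<close>,
  viewed as a ring of functions on \<open>P\<close>. A function belongs to \<open>regular_on A W\<close> if it is locally on
  \<open>W\<close> a quotient of elements of \<open>A\<close>; its values outside \<open>W\<close> are irrelevant.
\<close>

definition zariski :: "'a set \<Rightarrow> ('a \<Rightarrow> complex) set \<Rightarrow> 'a topology" where
  "zariski P A = topology_generated_by {{p \<in> P. f p \<noteq> 0} |f. f \<in> A}"

definition regular_on :: "('a \<Rightarrow> complex) set \<Rightarrow> 'a set \<Rightarrow> ('a \<Rightarrow> complex) set" where
  "regular_on A W = {f. \<forall>p\<in>W. \<exists>g\<in>A. \<exists>h\<in>A. h p \<noteq> 0 \<and> (\<forall>q\<in>W. h q \<noteq> 0 \<longrightarrow> f q = g q / h q)}"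

text \<open>
  Geometric quotient of the space \<open>(TY, OY)\<close> by a group of transformations \<open>H\<close>: \<open>\<pi>\<close> is surjective
  and induces the quotient topology, its fibres are the orbits, and the pullback of functions
  identifies the structure sheaf of the target with the invariant regular functions.
\<close>

definition geometric_quotient ::
  "'a topology \<Rightarrow> ('a set \<Rightarrow> ('a \<Rightarrow> complex) set) \<Rightarrow> 'b topology \<Rightarrow> ('b set \<Rightarrow> ('b \<Rightarrow> complex) set) \<Rightarrow>
   ('a \<Rightarrow> 'a) set \<Rightarrow> ('a \<Rightarrow> 'b) \<Rightarrow> bool" where
  "geometric_quotient TY OY TX OX H \<pi> \<longleftrightarrow>
     quotient_map TY TX \<pi> \<and>
     (\<forall>y\<in>topspace TY. {y' \<in> topspace TY. \<pi> y' = \<pi> y} = {h y |h. h \<in> H}) \<and>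
     (\<forall>W. openin TX W \<longrightarrow>
        (let W' = {y \<in> topspace TY. \<pi> y \<in> W} in
         \<forall>g. (g \<in> OY W' \<and> (\<forall>h\<in>H. \<forall>y\<in>W'. g (h y) = g y)) \<longleftrightarrow>
             (\<exists>f\<in>OX W. \<forall>y\<in>W'. g y = f (\<pi> y))))"

section \<open>The toric variety of a fan\<close>

definition dual_monoid :: "nat \<Rightarrow> real vec set \<Rightarrow> int vec set" where
  "dual_monoid n \<sigma> = {m \<in> carrier_vec n. \<forall>u\<in>\<sigma>. 0 \<le> rvec m \<bullet> u}"

definition perp_lattice :: "nat \<Rightarrow> real vec set \<Rightarrow> int vec set" where
  "perp_lattice n \<sigma> = {m \<in> carrier_vec n. \<forall>u\<in>\<sigma>. rvec m \<bullet> u = 0}"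

text \<open>
  \<open>orbit n \<rho>\<close> consists of the homomorphisms \<open>\<phi>\<close> from \<open>\<rho>\<^sup>\<bottom> \<inter> M\<close> to the nonzero complex numbers,
  extended by zero to a function on \<open>M\<close>. A point of the toric variety of a fan is a pair
  \<open>(\<rho>, \<phi>)\<close> with \<open>\<rho>\<close> a cone of the fan and \<open>\<phi> \<in> orbit n \<rho>\<close>: the toric variety is the disjoint union
  of its torus orbits, which are indexed by the cones.

  The affine chart of a cone \<open>\<sigma>\<close>, i.e. the set of monoid homomorphisms \<open>\<sigma>\<^sup>\<or> \<inter> M \<rightarrow> \<complex>\<close>, is the union
  of the orbits of the faces of \<open>\<sigma>\<close>: for such a homomorphism \<open>\<psi>\<close> there is a unique face \<open>\<rho>\<close> of \<open>\<sigma>\<close>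
  such that \<open>\<psi>\<close> is nonzero exactly on \<open>\<rho>\<^sup>\<bottom> \<inter> \<sigma>\<^sup>\<or> \<inter> M\<close>, and there it extends uniquely to a
  homomorphism on the group \<open>\<rho>\<^sup>\<bottom> \<inter> M\<close>. Conversely \<open>(\<rho>, \<phi>)\<close> restricts to the monoid homomorphism
  sending \<open>m\<close> to \<open>\<phi> m\<close>. So the monomial function \<open>\<chi>\<^sup>m\<close> has value \<open>\<phi> m\<close> at \<open>(\<rho>, \<phi>)\<close>, and the
  coordinate ring of the chart is spanned by the \<open>\<chi>\<^sup>m\<close> with \<open>m \<in> \<sigma>\<^sup>\<or> \<inter> M\<close>. Charts are glued along
  the charts of common faces, whose points are the same pairs.
\<close>

type_synonym toric_point = "real vec set \<times> (int vec \<Rightarrow> complex)"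

definition orbit :: "nat \<Rightarrow> real vec set \<Rightarrow> (int vec \<Rightarrow> complex) set" where
  "orbit n \<rho> = {\<phi>. (\<forall>m. \<phi> m \<noteq> 0 \<longleftrightarrow> m \<in> perp_lattice n \<rho>) \<and>
     (\<forall>m\<in>perp_lattice n \<rho>. \<forall>m'\<in>perp_lattice n \<rho>. \<phi> (m + m') = \<phi> m * \<phi> m')}"

definition chart :: "nat \<Rightarrow> real vec set \<Rightarrow> toric_point set" where
  "chart n \<sigma> = {(\<rho>, \<phi>). face n \<rho> \<sigma> \<and> \<phi> \<in> orbit n \<rho>}"

definition chart_ring :: "nat \<Rightarrow> real vec set \<Rightarrow> (toric_point \<Rightarrow> complex) set" where
  "chart_ring n \<sigma> =
     {(\<lambda>p. \<Sum>m\<in>S. a m * snd p m) |S a. finite S \<and> S \<subseteq> dual_monoid n \<sigma>}"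

definition toric_topology :: "nat \<Rightarrow> real vec set set \<Rightarrow> toric_point topology" where
  "toric_topology n \<Delta> = topology (\<lambda>W. W \<subseteq> (\<Union>\<sigma>\<in>\<Delta>. chart n \<sigma>) \<and>
     (\<forall>\<sigma>\<in>\<Delta>. openin (zariski (chart n \<sigma>) (chart_ring n \<sigma>)) (W \<inter> chart n \<sigma>)))"

definition toric_regular ::
  "nat \<Rightarrow> real vec set set \<Rightarrow> toric_point set \<Rightarrow> (toric_point \<Rightarrow> complex) set" where
  "toric_regular n \<Delta> W = {f. \<forall>\<sigma>\<in>\<Delta>. f \<in> regular_on (chart_ring n \<sigma>) (W \<inter> chart n \<sigma>)}"

section \<open>The quotient presentation\<close>

text \<open>The ring of polynomial functions on \<open>\<complex>\<^sup>m\<close>.\<close>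

inductive_set poly_functions :: "nat \<Rightarrow> (complex vec \<Rightarrow> complex) set" for m :: nat where
  const: "(\<lambda>_. c) \<in> poly_functions m"
| coord: "j < m \<Longrightarrow> (\<lambda>x. x $ j) \<in> poly_functions m"
| add: "f \<in> poly_functions m \<Longrightarrow> g \<in> poly_functions m \<Longrightarrow> (\<lambda>x. f x + g x) \<in> poly_functions m"
| mult: "f \<in> poly_functions m \<Longrightarrow> g \<in> poly_functions m \<Longrightarrow> (\<lambda>x. f x * g x) \<in> poly_functions m"

text \<open>
  The zero set of the irrelevant ideal of a fan whose rays are generated by the columns of \<open>V\<close>:
  the ideal is generated by the monomials \<open>\<Prod>x\<^sub>j\<close>, one for each cone \<open>\<sigma>\<close>, taken over the \<open>j\<close>
  for which the \<open>j\<close>-th ray is not contained in \<open>\<sigma>\<close>.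
\<close>

definition irrelevant_zeros :: "int mat \<Rightarrow> real vec set set \<Rightarrow> complex vec set" where
  "irrelevant_zeros V \<Delta> = {x \<in> carrier_vec (dim_col V).
     \<forall>\<sigma>\<in>\<Delta>. (\<Prod>j\<in>{j. j < dim_col V \<and> \<not> ray_of (rvec (col V j)) \<subseteq> \<sigma>}. x $ j) = 0}"

text \<open>Entries of a torsion matrix are residue classes, as elements of \<open>\<int>/\<tau>\<^sub>k\<int>\<close>.\<close>

definition torsion_matrix :: "nat \<Rightarrow> nat \<Rightarrow> (nat \<Rightarrow> nat) \<Rightarrow> int set mat \<Rightarrow> bool" where
  "torsion_matrix s m \<tau> \<Gamma> \<longleftrightarrow>
     \<Gamma> \<in> carrier_mat s m \<and> (\<forall>k<s. \<forall>j<m. \<Gamma> $$ (k, j) \<in> carrier (ZFact (int (\<tau> k))))"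

definition represents :: "int mat \<Rightarrow> int set mat \<Rightarrow> bool" where
  "represents C \<Gamma> \<longleftrightarrow>
     C \<in> carrier_mat (dim_row \<Gamma>) (dim_col \<Gamma>) \<and>
     (\<forall>k<dim_row \<Gamma>. \<forall>j<dim_col \<Gamma>. C $$ (k, j) \<in> \<Gamma> $$ (k, j))"

definition quot_group :: "nat \<Rightarrow> nat \<Rightarrow> (nat \<Rightarrow> nat) \<Rightarrow> (complex vec \<times> complex vec) set" where
  "quot_group r s \<tau> = {(t, \<epsilon>). t \<in> carrier_vec r \<and> (\<forall>i<r. t $ i \<noteq> 0) \<and>
     \<epsilon> \<in> carrier_vec s \<and> (\<forall>k<s. (\<epsilon> $ k) ^ \<tau> k = 1)}"

text \<open>
  The map \<open>G \<rightarrow> (\<complex>\<^sup>*)\<^sup>m\<close> through which \<open>G\<close> acts. The chosen representative of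
  \<open>\<Gamma> $$ (k, j)\<close> does not matter since \<open>\<epsilon> $ k\<close> is a \<open>\<tau>\<^sub>k\<close>-th root of unity.
\<close>

definition weight_vec :: "int mat \<Rightarrow> int set mat \<Rightarrow> complex vec \<times> complex vec \<Rightarrow> complex vec" where
  "weight_vec Q \<Gamma> = (\<lambda>(t, \<epsilon>). vec (dim_col Q) (\<lambda>j.
     (\<Prod>i<dim_row Q. (t $ i) powi (Q $$ (i, j))) *
     (\<Prod>k<dim_row \<Gamma>. (\<epsilon> $ k) powi (SOME c. c \<in> \<Gamma> $$ (k, j)))))"

definition cw_mult :: "complex vec \<Rightarrow> complex vec \<Rightarrow> complex vec" where
  "cw_mult x y = vec (dim_vec x) (\<lambda>j. x $ j * y $ j)"

definition big_torus :: "nat \<Rightarrow> complex vec set" where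
  "big_torus m = {x \<in> carrier_vec m. \<forall>j<m. x $ j \<noteq> 0}"

text \<open>
  \<open>\<pi>\<close> exhibits the toric variety of \<open>\<Delta>\<close> as geometric quotient of \<open>\<complex>\<^sup>m - Z\<close> by \<open>G\<close>. The quotient is
  one of toric varieties: \<open>\<pi>\<close> restricts to a group homomorphism from \<open>(\<complex>\<^sup>*)\<^sup>m\<close> to the torus of the
  toric variety, which is the orbit of the zero cone with pointwise multiplication. The group \<open>G\<close>
  is a subgroup of \<open>(\<complex>\<^sup>*)\<^sup>m\<close>, i.e. it acts faithfully.
\<close>

definition toric_quotient_presentation ::
  "nat \<Rightarrow> real vec set set \<Rightarrow> complex vec set \<Rightarrow> (nat \<Rightarrow> nat) \<Rightarrow> int mat \<Rightarrow> int set mat \<Rightarrow>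
   (complex vec \<Rightarrow> toric_point) \<Rightarrow> bool" where
  "toric_quotient_presentation n \<Delta> Z \<tau> Q \<Gamma> \<pi> \<longleftrightarrow>
     (let m = dim_col Q; G = quot_group (dim_row Q) (dim_row \<Gamma>) \<tau>; A = poly_functions m in
      inj_on (weight_vec Q \<Gamma>) G \<and>
      geometric_quotient
        (subtopology (zariski (carrier_vec m) A) (carrier_vec m - Z)) (regular_on A)
        (toric_topology n \<Delta>) (toric_regular n \<Delta>)
        {cw_mult (weight_vec Q \<Gamma> g) |g. g \<in> G} \<pi> \<and>
      (\<forall>x\<in>big_torus m. fst (\<pi> x) = {0\<^sub>v n}) \<and>
      (\<forall>x\<in>big_torus m. \<forall>y\<in>big_torus m. \<forall>a.
         snd (\<pi> (cw_mult x y)) a = snd (\<pi> x) a * snd (\<pi> y) a))"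

end

theory Submission
  imports Defs "HOL-Computational_Algebra.Fundamental_Theorem_Algebra"
begin

text \<open>
  Put \<open>m = n + r\<close>. On the torus \<open>(\<complex>\<^sup>*)\<^sup>m\<close> the quotient map \<open>\<pi>\<close> is a homomorphism to the torus of
  the toric variety whose components are regular functions. A regular homomorphism to \<open>\<complex>\<^sup>*\<close> is a
  monomial (\<open>regular_torus_character_is_monomial\<close>), so \<open>\<pi>\<close> is described there by an integer
  \<open>n \<times> m\<close> matrix \<open>V\<close> of exponents. The fibres of \<open>\<pi>\<close> are the orbits, so the kernel of this
  homomorphism is the acting group \<open>G\<close>. Points of the torus separate a lattice of characters
  from any character outside it (\<open>torus_point_separates_lattice\<close>, divisibility of \<open>\<complex>\<^sup>*\<close>), hence
  the row lattice of \<open>V\<close> is the lattice \<open>L\<close> of all characters that are trivial on \<open>G\<close>.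
  Evaluating characters on \<open>G\<close> gives \<open>L = {v. Q v = 0 and C v = 0 modulo \<tau>\<^sub>k in row k}\<close>
  (\<open>weight_annihilator\<close>).

  The same lattice comes out of the Hermite normal form. By Gale duality the solutions of
  \<open>Q v = 0\<close> are the combinations of the rows of \<open>Vhat\<close> with integral coefficient vectors \<open>a\<close>.
  The torsion condition then says that \<open>a\<close> can be completed by a vector \<open>b\<close> to a row vector
  \<open>(a, b)\<close> in the left kernel of \<open>K\<close>; the part \<open>b\<close> is determined by \<open>a\<close> because the diagonal
  block of \<open>K\<close> is nonsingular. That block also makes the \<open>s\<close> columns of \<open>K\<close> independent, so
  exactly the last \<open>n\<close> rows of \<open>U K\<close> vanish and the last \<open>n\<close> rows of \<open>U\<close> are a basis of the left
  kernel. Truncating them to the first \<open>n\<close> entries gives \<open>\<beta>\<close> (\<open>hermite_transform_block_basis\<close>),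
  and the rows of \<open>\<beta> Vhat\<close> are a basis of \<open>L\<close>. Since the rows of \<open>V\<close> generate the same lattice,
  \<open>V = P (\<beta> Vhat)\<close> with \<open>P\<close> unimodular, and \<open>P\<close> is the change of basis of \<open>N\<close> that the notion of
  a fan matrix asks for.

  It remains to see that the columns of \<open>V\<close> generate the rays of the fan. Let \<open>y\<close> be a generic
  point of the hyperplane \<open>x\<^sub>j = 0\<close> and let \<open>\<pi> y\<close> lie in the orbit of the cone \<open>\<rho>\<close>. A monomial
  \<open>\<chi>\<^sup>a\<close> that is regular on the chart of \<open>\<rho>\<close> pulls back to a function that grows like \<open>x\<^sub>j\<close> to
  the power \<open>a \<bullet> v\<^sub>j\<close> near \<open>y\<close>, where \<open>v\<^sub>j\<close> is column \<open>j\<close> of \<open>V\<close>; so this exponent is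
  nonnegative, and it is zero exactly if \<open>\<chi>\<^sup>a\<close> does not vanish at \<open>\<pi> y\<close> (\<open>boundary_character\<close>).
  If \<open>\<rho>\<close> contained a direction \<open>c\<close> independent of \<open>v\<^sub>j\<close>, moving \<open>y\<close> along a one-parameter
  subgroup that lies over \<open>c\<close> would not change \<open>\<pi> y\<close>, although no element of \<open>G\<close> produces this
  motion (\<open>one_parameter_in_stabilizer\<close>). Hence \<open>\<rho>\<close> is the ray through \<open>v\<^sub>j\<close>. No two columns of
  \<open>Vhat\<close>, and therefore of \<open>V\<close>, are positive multiples of each other, so this produces \<open>m\<close>
  different rays of a fan that has exactly \<open>m\<close> rays.
\<close>

section \<open>Unimodular row operations\<close>

definition row_equivalent :: "int mat \<Rightarrow> int mat \<Rightarrow> bool" where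
  "row_equivalent A B \<longleftrightarrow>
     (\<exists>U\<in>carrier_mat (dim_row A) (dim_row A). invertible_mat U \<and> B = U * A)"

lemma invertible_mat_inverseE:
  fixes U :: "'a::comm_ring_1 mat"
  assumes "invertible_mat U" "U \<in> carrier_mat N N"
  obtains U' where "U' \<in> carrier_mat N N" "U * U' = 1\<^sub>m N" "U' * U = 1\<^sub>m N"
proof -
  from assms obtain U' where *: "U * U' = 1\<^sub>m N" "U' * U = 1\<^sub>m (dim_row U')"
    unfolding invertible_mat_def inverts_mat_def by auto
  have "dim_col U' = N" using arg_cong[OF *(1), of dim_col] by simp
  moreover have "dim_row U' = N" using arg_cong[OF *(2), of dim_col] assms by simp
  ultimately show ?thesis using * that by auto
qed

lemma invertible_matI:
  fixes U :: "'a::comm_ring_1 mat"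
  assumes "U \<in> carrier_mat N N" "U' \<in> carrier_mat N N" "U * U' = 1\<^sub>m N" "U' * U = 1\<^sub>m N"
  shows "invertible_mat U"
  using assms unfolding invertible_mat_def inverts_mat_def by auto

lemma invertible_mat_if_det_unit:
  fixes U :: "'a::comm_ring_1 mat"
  assumes U: "U \<in> carrier_mat N N" and "det U * d = 1"
  shows "invertible_mat U"
proof (rule invertible_matI[OF U])
  have 1: "adj_mat U \<in> carrier_mat N N" "U * adj_mat U = det U \<cdot>\<^sub>m 1\<^sub>m N"
    "adj_mat U * U = det U \<cdot>\<^sub>m 1\<^sub>m N" using adj_mat[OF U] by auto
  show "d \<cdot>\<^sub>m adj_mat U \<in> carrier_mat N N" using 1 by auto
  have *: "d \<cdot>\<^sub>m (det U \<cdot>\<^sub>m 1\<^sub>m N) = 1\<^sub>m N"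
    using assms(2) by (intro eq_matI) (auto simp: mult.assoc mult.commute)
  show "U * (d \<cdot>\<^sub>m adj_mat U) = 1\<^sub>m N"
    using mult_smult_distrib[OF U 1(1), of d] 1 * by simp
  show "d \<cdot>\<^sub>m adj_mat U * U = 1\<^sub>m N"
    using mult_smult_assoc_mat[OF 1(1) U, of d] 1 * by simp
qed

lemma row_equivalent_refl: "row_equivalent A A"
  unfolding row_equivalent_def
  using invertible_mat_if_det_unit[of "1\<^sub>m (dim_row A) :: int mat" "dim_row A" 1]
  by (intro bexI[of _ "1\<^sub>m (dim_row A)"]) auto

lemma invertible_mat_mult:
  fixes U W :: "'a::comm_ring_1 mat"
  assumes "invertible_mat U" "invertible_mat W" "U \<in> carrier_mat N N" "W \<in> carrier_mat N N"
  shows "invertible_mat (U * W)"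
proof -
  obtain U' W' where U': "U' \<in> carrier_mat N N" "U * U' = 1\<^sub>m N"
    and W': "W' \<in> carrier_mat N N" "W * W' = 1\<^sub>m N"
    using invertible_mat_inverseE assms by metis
  have "det U * det U' = 1" "det W * det W' = 1"
    using det_mult[OF assms(3) U'(1)] det_mult[OF assms(4) W'(1)] U'(2) W'(2) by simp_all
  then have "det (U * W) * (det W' * det U') = 1"
    unfolding det_mult[OF assms(3,4)] by (metis mult.assoc mult.left_commute mult_1_right)
  then show ?thesis using assms by (intro invertible_mat_if_det_unit) auto
qed

lemma row_equivalent_trans:
  assumes "row_equivalent A B" "row_equivalent B C"
  shows "row_equivalent A C"
proof -
  let ?N = "dim_row A"
  obtain U where U: "U \<in> carrier_mat ?N ?N" "invertible_mat U" "B = U * A"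
    using assms(1) unfolding row_equivalent_def by auto
  then have "dim_row B = ?N" by auto
  then obtain W where W: "W \<in> carrier_mat ?N ?N" "invertible_mat W" "C = W * B"
    using assms(2) unfolding row_equivalent_def by auto
  show ?thesis unfolding row_equivalent_def
    using U W by (intro bexI[of _ "W * U"])
      (auto intro: invertible_mat_mult simp: assoc_mult_mat[of _ ?N ?N _ ?N _ "dim_col A"])
qed

lemma row_equivalent_sym:
  assumes "row_equivalent A B"
  shows "row_equivalent B A"
proof -
  let ?N = "dim_row A"
  obtain U where U: "U \<in> carrier_mat ?N ?N" "invertible_mat U" "B = U * A"
    using assms(1) unfolding row_equivalent_def by auto
  obtain U' where U': "U' \<in> carrier_mat ?N ?N" "U * U' = 1\<^sub>m ?N" "U' * U = 1\<^sub>m ?N"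
    using invertible_mat_inverseE U by blast
  have "U' * B = (U' * U) * A"
    unfolding U(3) using U(1) U'(1) by (simp add: assoc_mult_mat[of U' ?N ?N U ?N A "dim_col A"])
  then have "A = U' * B" unfolding U'(3) by simp
  then show ?thesis unfolding row_equivalent_def
    using U U' by (intro bexI[of _ U']) (auto intro: invertible_matI)
qed

lemma row_equivalent_dim:
  "row_equivalent A B \<Longrightarrow> dim_row B = dim_row A \<and> dim_col B = dim_col A"
  unfolding row_equivalent_def by auto

lemma row_equivalent_addrow:
  assumes "k < dim_row A" "l < dim_row A" "k \<noteq> l"
  shows "row_equivalent A (addrow a k l A)"
  unfolding row_equivalent_def
  using assms addrow_mat[of A "dim_row A" "dim_col A" l a k]
  by (intro bexI[of _ "addrow_mat (dim_row A) a k l"])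
     (auto intro!: invertible_mat_if_det_unit[where d = 1] simp: det_addrow_mat)

lemma row_equivalent_swaprows:
  assumes "k < dim_row A" "l < dim_row A"
  shows "row_equivalent A (swaprows k l A)"
proof (cases "k = l")
  case True
  then have "swaprows k l A = A" using assms by (intro eq_matI) auto
  then show ?thesis by (simp add: row_equivalent_refl)
next
  case False
  then show ?thesis unfolding row_equivalent_def
    using assms swaprows_mat[of A "dim_row A" "dim_col A" k l]
    by (intro bexI[of _ "swaprows_mat (dim_row A) k l"])
     (auto intro!: invertible_mat_if_det_unit[where d = "-1"] simp: det_swaprows_mat)
qed

lemma row_equivalent_negate_row:
  assumes "k < dim_row A"
  shows "row_equivalent A (multrow k (-1) A)"
  unfolding row_equivalent_def
  using assms multrow_mat[of A "dim_row A" "dim_col A" k "-1"]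
  by (intro bexI[of _ "multrow_mat (dim_row A) k (-1)"])
     (auto intro!: invertible_mat_if_det_unit[where d = "-1"] simp: det_multrow_mat)

section \<open>Existence of the Hermite normal form\<close>

text \<open>
  The Euclidean algorithm on column \<open>k\<close> in the rows from \<open>p\<close> on. The third conjunct records that
  columns which are already zero in these rows stay so, because only these rows are combined
  with each other.
\<close>

lemma clear_column:
  fixes A :: "int mat"
  assumes "p < dim_row A" "k < dim_col A"
  shows "\<exists>B. row_equivalent A B \<and>
    (\<forall>i<p. \<forall>j<dim_col A. B $$ (i, j) = A $$ (i, j)) \<and>
    (\<forall>j<dim_col A. (\<forall>i<dim_row A. p \<le> i \<longrightarrow> A $$ (i, j) = 0) \<longrightarrow>
       (\<forall>i<dim_row A. p \<le> i \<longrightarrow> B $$ (i, j) = 0)) \<and>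
    (\<forall>i<dim_row A. p < i \<longrightarrow> B $$ (i, k) = 0) \<and> 0 \<le> B $$ (p, k)"
  using assms
proof (induction "\<Sum>i\<in>{p..<dim_row A}. nat \<bar>A $$ (i, k)\<bar>" arbitrary: A rule: less_induct)
  case less
  let ?N = "dim_row A"
  show ?case
  proof (cases "\<exists>i l. p \<le> i \<and> i < ?N \<and> p \<le> l \<and> l < ?N \<and> i \<noteq> l \<and>
      \<bar>A $$ (l, k)\<bar> \<le> \<bar>A $$ (i, k)\<bar> \<and> A $$ (l, k) \<noteq> 0")
    case True
    then obtain i l where il: "p \<le> i" "i < ?N" "p \<le> l" "l < ?N" "i \<noteq> l"
      "\<bar>A $$ (l, k)\<bar> \<le> \<bar>A $$ (i, k)\<bar>" "A $$ (l, k) \<noteq> 0" by blast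
    define A' where "A' = addrow (- (A $$ (i, k) div A $$ (l, k))) i l A"
    have dims: "dim_row A' = ?N" "dim_col A' = dim_col A" unfolding A'_def by auto
    have re: "row_equivalent A A'" unfolding A'_def using il by (intro row_equivalent_addrow) auto
    have ent: "A' $$ (x, y) = (if x = i then A $$ (i, y) - A $$ (i, k) div A $$ (l, k) * A $$ (l, y)
        else A $$ (x, y))" if "x < ?N" "y < dim_col A" for x y
      unfolding A'_def using that il by auto
    have small: "\<bar>A' $$ (i, k)\<bar> < \<bar>A $$ (i, k)\<bar>"
    proof -
      have "A' $$ (i, k) = A $$ (i, k) mod A $$ (l, k)"
        using ent[of i k] il less.prems by (simp add: minus_div_mult_eq_mod)
      then show ?thesis using il abs_mod_less[of "A $$ (l, k)" "A $$ (i, k)"] by simp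
    qed
    have "(\<Sum>x\<in>{p..<?N}. nat \<bar>A' $$ (x, k)\<bar>) < (\<Sum>x\<in>{p..<?N}. nat \<bar>A $$ (x, k)\<bar>)"
    proof (rule sum_strict_mono_ex1)
      show "\<forall>x\<in>{p..<?N}. nat \<bar>A' $$ (x, k)\<bar> \<le> nat \<bar>A $$ (x, k)\<bar>"
        using ent small less.prems by (auto simp: less_imp_le)
      show "\<exists>x\<in>{p..<?N}. nat \<bar>A' $$ (x, k)\<bar> < nat \<bar>A $$ (x, k)\<bar>"
        using small il by (intro bexI[of _ i]) auto
    qed auto
    then obtain B where B: "row_equivalent A' B"
      "\<forall>i<p. \<forall>j<dim_col A. B $$ (i, j) = A' $$ (i, j)"
      "\<forall>j<dim_col A. (\<forall>i<?N. p \<le> i \<longrightarrow> A' $$ (i, j) = 0) \<longrightarrow>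
         (\<forall>i<?N. p \<le> i \<longrightarrow> B $$ (i, j) = 0)"
      "\<forall>i<?N. p < i \<longrightarrow> B $$ (i, k) = 0" "0 \<le> B $$ (p, k)"
      using less.hyps[of A'] less.prems dims by auto
    show ?thesis
    proof (intro exI[of _ B] conjI)
      show "row_equivalent A B" using re B(1) row_equivalent_trans by blast
      show "\<forall>i<p. \<forall>j<dim_col A. B $$ (i, j) = A $$ (i, j)" using B(2) ent il by auto
      show "\<forall>j<dim_col A. (\<forall>i<?N. p \<le> i \<longrightarrow> A $$ (i, j) = 0) \<longrightarrow>
         (\<forall>i<?N. p \<le> i \<longrightarrow> B $$ (i, j) = 0)" using B(3) ent il by auto
    qed (use B in auto)
  next
    case False
    have *: "A $$ (l, k) = 0 \<or> A $$ (i, k) = 0"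
      if "p \<le> i" "i < ?N" "p \<le> l" "l < ?N" "i \<noteq> l" for i l
      using False that by (metis linear)
    obtain q where q: "p \<le> q" "q < ?N" "\<And>i. p \<le> i \<Longrightarrow> i < ?N \<Longrightarrow> i \<noteq> q \<Longrightarrow> A $$ (i, k) = 0"
    proof (cases "\<exists>q. p \<le> q \<and> q < ?N \<and> A $$ (q, k) \<noteq> 0")
      case True
      then show ?thesis using that * by metis
    next
      case False
      then show ?thesis using that[of p] less.prems by auto
    qed
    define S where "S = swaprows p q A"
    have dS: "dim_row S = ?N" "dim_col S = dim_col A" unfolding S_def by auto
    have eS: "S $$ (x, y) = (if x = p then A $$ (q, y) else
        if x = q then A $$ (p, y) else A $$ (x, y))"
      if "x < ?N" "y < dim_col A" for x y unfolding S_def using that q by auto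
    have rS: "row_equivalent A S" unfolding S_def
      using q less.prems by (intro row_equivalent_swaprows) auto
    define B where "B = (if S $$ (p, k) < 0 then multrow p (-1) S else S)"
    have eB: "B $$ (x, y) = (if x = p \<and> S $$ (p, k) < 0 then - (S $$ (x, y)) else S $$ (x, y))"
      if "x < ?N" "y < dim_col A" for x y unfolding B_def using that dS by auto
    have rB: "row_equivalent S B" unfolding B_def
      using row_equivalent_negate_row[of p S] row_equivalent_refl less.prems dS by auto
    show ?thesis
    proof (intro exI[of _ B] conjI)
      show "row_equivalent A B" using rS rB row_equivalent_trans by blast
      show "\<forall>i<p. \<forall>j<dim_col A. B $$ (i, j) = A $$ (i, j)"
        using eB eS q less.prems by auto
      show "\<forall>j<dim_col A. (\<forall>i<?N. p \<le> i \<longrightarrow> A $$ (i, j) = 0) \<longrightarrow>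
         (\<forall>i<?N. p \<le> i \<longrightarrow> B $$ (i, j) = 0)"
        using eB eS q less.prems by auto
      show "\<forall>i<?N. p < i \<longrightarrow> B $$ (i, k) = 0" using eB eS q less.prems by (auto simp: q(3))
      show "0 \<le> B $$ (p, k)" using eB[of p k] less.prems by auto
    qed
  qed
qed

text \<open>
  Only multiples of the pivot row are added, so columns in which the pivot row is zero do not
  change. In the reduction these are the columns that have already been processed.
\<close>

lemma reduce_above_pivot:
  fixes A :: "int mat"
  assumes "p < dim_row A" "k < dim_col A" "0 < A $$ (p, k)" "t \<le> p"
  shows "\<exists>B. row_equivalent A B \<and>
    (\<forall>i<dim_row A. \<forall>j<dim_col A. t \<le> i \<or> A $$ (p, j) = 0 \<longrightarrow> B $$ (i, j) = A $$ (i, j)) \<and>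
    (\<forall>i<t. 0 \<le> B $$ (i, k) \<and> B $$ (i, k) < A $$ (p, k))"
  using assms(4)
proof (induction t)
  case 0
  then show ?case by (intro exI[of _ A]) (auto simp: row_equivalent_refl)
next
  case (Suc t)
  then obtain B where B: "row_equivalent A B"
    "\<forall>i<dim_row A. \<forall>j<dim_col A. t \<le> i \<or> A $$ (p, j) = 0 \<longrightarrow> B $$ (i, j) = A $$ (i, j)"
    "\<forall>i<t. 0 \<le> B $$ (i, k) \<and> B $$ (i, k) < A $$ (p, k)" by auto
  note dims = row_equivalent_dim[OF B(1)]
  define B' where "B' = addrow (- (B $$ (t, k) div A $$ (p, k))) t p B"
  have e: "B' $$ (x, y) = (if x = t then B $$ (t, y) - B $$ (t, k) div A $$ (p, k) * A $$ (p, y)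
      else B $$ (x, y))" if "x < dim_row A" "y < dim_col A" for x y
    unfolding B'_def using that B(2) assms Suc.prems dims by auto
  have "row_equivalent B B'" unfolding B'_def
    using assms Suc.prems dims by (intro row_equivalent_addrow) auto
  moreover have "B' $$ (t, k) = B $$ (t, k) mod A $$ (p, k)"
    using e[of t k] assms Suc.prems by (simp add: minus_div_mult_eq_mod)
  ultimately show ?case using B e assms Suc.prems
    by (intro exI[of _ B'] conjI) (auto intro: row_equivalent_trans simp: less_Suc_eq)
qed

text \<open>
  The invariant of the column-by-column reduction: the first \<open>k\<close> columns are in Hermite form,
  with the pivots in the first \<open>p\<close> rows.
\<close>

definition hermite_upto :: "nat \<Rightarrow> nat \<Rightarrow> (nat \<Rightarrow> nat) \<Rightarrow> int mat \<Rightarrow> bool" where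
  "hermite_upto k p f A \<longleftrightarrow> k \<le> dim_col A \<and> p \<le> dim_row A \<and>
     (\<forall>i<p. f i < k \<and> (\<forall>i'<i. f i' < f i) \<and> (\<forall>j<f i. A $$ (i, j) = 0) \<and> 0 < A $$ (i, f i) \<and>
        (\<forall>i'<i. 0 \<le> A $$ (i', f i) \<and> A $$ (i', f i) < A $$ (i, f i))) \<and>
     (\<forall>i<dim_row A. p \<le> i \<longrightarrow> (\<forall>j<k. A $$ (i, j) = 0))"

lemma hermite_upto_step:
  assumes h: "hermite_upto k p f A" and k: "k < dim_col A"
  shows "\<exists>B p' f'. row_equivalent A B \<and> hermite_upto (Suc k) p' f' B"
proof (cases "p < dim_row A")
  case False
  then have "hermite_upto (Suc k) p f A" using h k unfolding hermite_upto_def by auto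
  then show ?thesis using row_equivalent_refl by blast
next
  case True
  let ?N = "dim_row A"
  obtain B where B: "row_equivalent A B"
    "\<forall>i<p. \<forall>j<dim_col A. B $$ (i, j) = A $$ (i, j)"
    "\<forall>j<dim_col A. (\<forall>i<?N. p \<le> i \<longrightarrow> A $$ (i, j) = 0) \<longrightarrow>
       (\<forall>i<?N. p \<le> i \<longrightarrow> B $$ (i, j) = 0)"
    "\<forall>i<?N. p < i \<longrightarrow> B $$ (i, k) = 0" "0 \<le> B $$ (p, k)"
    using clear_column[OF True k] by blast
  note dB = row_equivalent_dim[OF B(1)]
  have zB: "B $$ (i, j) = 0" if "i < ?N" "p \<le> i" "j < k" for i j
    using B(3) h k that unfolding hermite_upto_def by auto
  have hB: "hermite_upto k p f B"
    using h dB B(2) zB k unfolding hermite_upto_def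
    by (auto simp: Suc_le_eq)
  show ?thesis
  proof (cases "B $$ (p, k) = 0")
    case True
    then have "B $$ (i, k) = 0" if "i < ?N" "p \<le> i" for i
      using B(4) that by (cases "i = p") auto
    then have "hermite_upto (Suc k) p f B"
      using hB dB k unfolding hermite_upto_def by (auto simp: less_Suc_eq)
    then show ?thesis using B(1) by blast
  next
    case False
    then have pos: "0 < B $$ (p, k)" using B(5) by auto
    obtain D where D: "row_equivalent B D"
      "\<forall>i<?N. \<forall>j<dim_col A. p \<le> i \<or> B $$ (p, j) = 0 \<longrightarrow> D $$ (i, j) = B $$ (i, j)"
      "\<forall>i<p. 0 \<le> D $$ (i, k) \<and> D $$ (i, k) < B $$ (p, k)"
      using reduce_above_pivot[of p B k p] True k pos dB by auto
    note dD = row_equivalent_dim[OF D(1)]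
    have same: "D $$ (i, j) = B $$ (i, j)" if "i < ?N" "j < k" for i j
      using D(2) zB[of p j] that True k by auto
    have same': "D $$ (i, j) = B $$ (i, j)" if "i < ?N" "p \<le> i" "j < dim_col A" for i j
      using D(2) that by auto
    have "hermite_upto (Suc k) (Suc p) (f(p := k)) D"
      unfolding hermite_upto_def
    proof (intro conjI allI impI)
      show "Suc k \<le> dim_col D" "Suc p \<le> dim_row D" using k True dD dB by auto
      fix i assume "i < Suc p"
      then consider "i < p" | "i = p" by linarith
      then have "(f(p := k)) i < Suc k \<and> (\<forall>i'<i. (f(p := k)) i' < (f(p := k)) i) \<and>
        (\<forall>j<(f(p := k)) i. D $$ (i, j) = 0) \<and> 0 < D $$ (i, (f(p := k)) i) \<and>
        (\<forall>i'<i. 0 \<le> D $$ (i', (f(p := k)) i) \<and> D $$ (i', (f(p := k)) i) < D $$ (i, (f(p := k)) i))"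
      proof cases
        case 1
        then show ?thesis using hB same True unfolding hermite_upto_def by (auto simp: less_Suc_eq)
      next
        case 2
        have "\<forall>i'<p. f i' < k" using hB unfolding hermite_upto_def by auto
        then show ?thesis using 2 same zB True D(3) pos same'[of p k] k by auto
      qed
      then show "(f(p := k)) i < Suc k" "\<And>i'. i' < i \<Longrightarrow> (f(p := k)) i' < (f(p := k)) i"
        "\<And>j. j < (f(p := k)) i \<Longrightarrow> D $$ (i, j) = 0" "0 < D $$ (i, (f(p := k)) i)"
        "\<And>i'. i' < i \<Longrightarrow> 0 \<le> D $$ (i', (f(p := k)) i)"
        "\<And>i'. i' < i \<Longrightarrow> D $$ (i', (f(p := k)) i) < D $$ (i, (f(p := k)) i)" by auto
    next
      fix i j assume "i < dim_row D" "Suc p \<le> i" "j < Suc k"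
      then show "D $$ (i, j) = 0"
        using same'[of i j] zB[of i j] B(4) dD dB k by (cases "j = k") auto
    qed
    then show ?thesis using B(1) D(1) row_equivalent_trans by blast
  qed
qed

lemma hermite_upto_exists:
  assumes "k \<le> dim_col A"
  shows "\<exists>B p f. row_equivalent A B \<and> hermite_upto k p f B"
  using assms
proof (induction k)
  case 0
  have "hermite_upto 0 0 f A" for f unfolding hermite_upto_def by auto
  then show ?case using row_equivalent_refl by blast
next
  case (Suc k)
  then obtain B p f where "row_equivalent A B" "hermite_upto k p f B" by auto
  then show ?case using hermite_upto_step[of k p f B] row_equivalent_dim[of A B] Suc.prems
    by (metis Suc_le_lessD row_equivalent_trans)
qed

text \<open>
  When all columns have been processed, the remaining rows are zero, which the pivot function
  has to signal by the value \<open>dim_col A\<close>.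
\<close>

lemma hermite_form_exists:
  "\<exists>H. hermite_form H \<and> row_equivalent A H"
proof -
  obtain B p f where B: "row_equivalent A B" "hermite_upto (dim_col A) p f B"
    using hermite_upto_exists by blast
  note d = row_equivalent_dim[OF B(1)]
  have "hermite_form B" unfolding hermite_form_def
    by (rule exI[of _ "\<lambda>i. if i < p then f i else dim_col B"])
      (use B(2) d in \<open>auto simp: hermite_upto_def less_imp_le\<close>)
  then show ?thesis using B(1) by blast
qed

section \<open>Uniqueness of the Hermite normal form\<close>

definition full_column_rank :: "int mat \<Rightarrow> bool" where
  "full_column_rank A \<longleftrightarrow>
     (\<forall>x\<in>carrier_vec (dim_col A). A *\<^sub>v x = 0\<^sub>v (dim_row A) \<longrightarrow> x = 0\<^sub>v (dim_col A))"

lemma full_column_rank_row_equivalent: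
  assumes "row_equivalent A B" "full_column_rank A"
  shows "full_column_rank B"
  unfolding full_column_rank_def
proof (intro ballI impI)
  note d = row_equivalent_dim[OF assms(1)]
  fix x assume x: "x \<in> carrier_vec (dim_col B)" "B *\<^sub>v x = 0\<^sub>v (dim_row B)"
  obtain U where U: "U \<in> carrier_mat (dim_row B) (dim_row B)" "A = U * B"
    using row_equivalent_sym[OF assms(1)] unfolding row_equivalent_def by blast
  have "A *\<^sub>v x = U *\<^sub>v (B *\<^sub>v x)"
    unfolding U(2) using U(1) x(1) by (intro assoc_mult_mat_vec) auto
  then have "A *\<^sub>v x = 0\<^sub>v (dim_row A)" unfolding x(2) using U(1) d by auto
  then show "x = 0\<^sub>v (dim_col B)" using assms(2) x d unfolding full_column_rank_def by auto
qed

text \<open>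
  The pivot columns increase strictly until they reach the number of columns, so row \<open>i\<close> cannot
  have its pivot to the left of column \<open>i\<close>.
\<close>

lemma hermite_form_zero_below:
  assumes "hermite_form H" "i < dim_row H" "j < i" "j < dim_col H"
  shows "H $$ (i, j) = 0"
proof -
  obtain f where f: "\<forall>i<dim_row H. f i \<le> dim_col H \<and> (\<forall>j<f i. H $$ (i, j) = 0) \<and>
     (Suc i < dim_row H \<longrightarrow> f i < f (Suc i) \<or> f (Suc i) = dim_col H)"
    using assms(1) unfolding hermite_form_def by metis
  have "min i (dim_col H) \<le> f i" if "i < dim_row H" for i
    using that
  proof (induction i)
    case (Suc i)
    then have "f i < f (Suc i) \<or> f (Suc i) = dim_col H" using f by auto
    then show ?case using Suc by auto
  qed auto
  from this[OF assms(2)] have "j < f i" using assms by auto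
  then show ?thesis using f assms by auto
qed

lemma hermite_form_bottom_zero:
  assumes "hermite_form H" "dim_col H \<le> i" "i < dim_row H"
  shows "row H i = 0\<^sub>v (dim_col H)"
  using hermite_form_zero_below[OF assms(1,3)] assms by (intro eq_vecI) auto

lemma hermite_form_top_det:
  assumes H: "hermite_form H" "full_column_rank H" "dim_col H \<le> dim_row H"
  defines "T \<equiv> mat (dim_col H) (dim_col H) (\<lambda>(i, j). H $$ (i, j))"
  shows "det T \<noteq> 0"
proof
  let ?s = "dim_col H"
  have T: "T \<in> carrier_mat ?s ?s" unfolding T_def by auto
  assume "det T = 0"
  then obtain v where v: "v \<in> carrier_vec ?s" "v \<noteq> 0\<^sub>v ?s" "T *\<^sub>v v = 0\<^sub>v ?s"
    using det_0_iff_vec_prod_zero[OF T] by auto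
  have "H *\<^sub>v v = 0\<^sub>v (dim_row H)"
  proof (rule eq_vecI)
    fix i assume i: "i < dim_vec (0\<^sub>v (dim_row H) :: int vec)"
    show "(H *\<^sub>v v) $ i = 0\<^sub>v (dim_row H) $ i"
    proof (cases "i < ?s")
      case True
      have "row T i = row H i" using True i unfolding T_def by (intro eq_vecI) auto
      then have "(H *\<^sub>v v) $ i = (T *\<^sub>v v) $ i" using True i T by auto
      then show ?thesis using v True i by auto
    next
      case False
      then show ?thesis using hermite_form_bottom_zero[OF H(1)] i v by auto
    qed
  qed auto
  then show False using H(2) v unfolding full_column_rank_def by auto
qed

text \<open>
  If the columns are independent, the upper square block is triangular with nonzero determinant.
  So no diagonal entry vanishes, and the pivot of row \<open>i\<close> sits on the diagonal.
\<close>

lemma hermite_form_pivots: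
  assumes H: "hermite_form H" "full_column_rank H" "dim_col H \<le> dim_row H" and i: "i < dim_col H"
  shows "0 < H $$ (i, i)"
    and "i' < i \<Longrightarrow> 0 \<le> H $$ (i', i) \<and> H $$ (i', i) < H $$ (i, i)"
proof -
  let ?s = "dim_col H"
  define T where "T = mat ?s ?s (\<lambda>(i, j). H $$ (i, j))"
  have T: "T \<in> carrier_mat ?s ?s" unfolding T_def by auto
  have "upper_triangular T"
    using hermite_form_zero_below[OF H(1)] H(3) unfolding T_def upper_triangular_def by auto
  then have "det T = prod_list (diag_mat T)" using T by (rule det_upper_triangular)
  then have "0 \<notin> set (diag_mat T)"
    using hermite_form_top_det[OF H] unfolding T_def by (auto simp: prod_list_zero_iff)
  then have nz: "H $$ (i, i) \<noteq> 0" using i unfolding T_def diag_mat_def by force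
  obtain f where f: "\<forall>i<dim_row H. f i \<le> dim_col H \<and> (\<forall>j<f i. H $$ (i, j) = 0) \<and>
     (f i < dim_col H \<longrightarrow> 0 < H $$ (i, f i) \<and>
           (\<forall>i'<i. 0 \<le> H $$ (i', f i) \<and> H $$ (i', f i) < H $$ (i, f i)))"
    using H(1) unfolding hermite_form_def by metis
  have "f i \<le> i" using f nz i H(3) by (metis leI order_less_le_trans)
  moreover have "i \<le> f i"
  proof (rule ccontr)
    assume "\<not> i \<le> f i"
    then have "H $$ (i, f i) = 0" using hermite_form_zero_below[OF H(1), of i "f i"] i H(3) by auto
    moreover have "0 < H $$ (i, f i)" using f i H(3) \<open>f i \<le> i\<close> by auto
    ultimately show False by simp
  qed
  ultimately have "f i = i" by simp
  then show "0 < H $$ (i, i)" "i' < i \<Longrightarrow> 0 \<le> H $$ (i', i) \<and> H $$ (i', i) < H $$ (i, i)"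
    using f i H(3) by (metis order_less_le_trans)+
qed

lemma hermite_form_lattice_entry:
  assumes H: "hermite_form H" "dim_col H \<le> dim_row H"
    and z: "z \<in> carrier_vec (dim_row H)" and j: "j < dim_col H"
  shows "(H\<^sup>T *\<^sub>v z) $ j = (\<Sum>i<Suc j. H $$ (i, j) * z $ i)"
proof -
  have "(H\<^sup>T *\<^sub>v z) $ j = (\<Sum>i<dim_row H. H $$ (i, j) * z $ i)"
    using j z by (auto simp: scalar_prod_def lessThan_atLeast0)
  also have "\<dots> = (\<Sum>i<Suc j. H $$ (i, j) * z $ i)"
    using j H(2) hermite_form_zero_below[OF H(1)]
    by (intro sum.mono_neutral_right) auto
  finally show ?thesis .
qed

lemma hermite_form_lattice_leading_zeros:
  assumes H: "hermite_form H" "full_column_rank H" "dim_col H \<le> dim_row H"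
    and z: "z \<in> carrier_vec (dim_row H)" and k: "k \<le> dim_col H"
    and zero: "\<And>j. j < k \<Longrightarrow> (H\<^sup>T *\<^sub>v z) $ j = 0"
  shows "j < k \<Longrightarrow> z $ j = 0"
proof (induction j rule: less_induct)
  case (less j)
  then have "0 = H $$ (j, j) * z $ j"
    using hermite_form_lattice_entry[OF H(1,3) z, of j] zero[of j] k by simp
  then show ?case using hermite_form_pivots(1)[OF H, of j] less.prems k by auto
qed

text \<open>
  Vectors of the row lattice that start with \<open>k\<close> zeros do not involve the first \<open>k\<close> rows, by
  triangularity. Their next entry is therefore a multiple of the pivot. This is what makes the
  pivots and the reduced entries above them invariants of the lattice.
\<close>

lemma hermite_form_lattice_leading_entry:
  assumes H: "hermite_form H" "full_column_rank H" "dim_col H \<le> dim_row H"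
    and z: "z \<in> carrier_vec (dim_row H)" and k: "k < dim_col H"
    and zero: "\<And>j. j < k \<Longrightarrow> (H\<^sup>T *\<^sub>v z) $ j = 0"
  shows "H $$ (k, k) dvd (H\<^sup>T *\<^sub>v z) $ k"
proof -
  have "z $ j = 0" if "j < k" for j
    using hermite_form_lattice_leading_zeros[OF H z less_imp_le[OF k] zero that] .
  then have "(H\<^sup>T *\<^sub>v z) $ k = H $$ (k, k) * z $ k"
    using hermite_form_lattice_entry[OF H(1,3) z k] by simp
  then show ?thesis by simp
qed

lemma row_in_row_lattice:
  assumes "row_equivalent A B" "i < dim_row B"
  shows "\<exists>z\<in>carrier_vec (dim_row A). A\<^sup>T *\<^sub>v z = row B i"
proof -
  obtain U where U: "U \<in> carrier_mat (dim_row A) (dim_row A)" "B = U * A"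
    using assms(1) unfolding row_equivalent_def by auto
  have "A\<^sup>T *\<^sub>v row U i = row B i"
    using U assms(2)
    by (intro eq_vecI) (auto intro!: comm_scalar_prod[of _ "dim_row A"] simp: carrier_vecI)
  then show ?thesis using U assms(2) by (intro bexI[of _ "row U i"]) auto
qed

text \<open>
  Both matrices have the same row lattice. Comparing leading entries shows that the pivots
  divide each other. The difference of corresponding rows is then a lattice vector whose entries
  are divisible by the pivots and smaller than them in absolute value, so it vanishes column by
  column.
\<close>

lemma hermite_form_unique:
  assumes H: "hermite_form H" and H': "hermite_form H'" and eq: "row_equivalent H H'"
    and rank: "full_column_rank H" "dim_col H \<le> dim_row H"
  shows "H = H'"
proof -
  note d = row_equivalent_dim[OF eq]
  note HH = H rank
  have HH': "hermite_form H'" "full_column_rank H'" "dim_col H' \<le> dim_row H'"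
    using H' full_column_rank_row_equivalent[OF eq rank(1)] rank d by auto
  have diag: "H $$ (i, i) = H' $$ (i, i)" if i: "i < dim_col H" for i
  proof (rule zdvd_antisym_nonneg)
    show "0 \<le> H $$ (i, i)" "0 \<le> H' $$ (i, i)"
      using hermite_form_pivots(1)[OF HH] hermite_form_pivots(1)[OF HH'] i d
          by (auto simp: less_imp_le)
    obtain z where z: "z \<in> carrier_vec (dim_row H)" "H\<^sup>T *\<^sub>v z = row H' i"
      using row_in_row_lattice[OF eq, of i] i d rank by auto
    show "H $$ (i, i) dvd H' $$ (i, i)"
      using hermite_form_lattice_leading_entry[OF HH z(1) i] z(2) i d rank
        hermite_form_zero_below[OF H', of i] by auto
    obtain z where z: "z \<in> carrier_vec (dim_row H')" "transpose_mat H' *\<^sub>v z = row H i"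
      using row_in_row_lattice[OF row_equivalent_sym[OF eq], of i] i d rank by auto
    show "H' $$ (i, i) dvd H $$ (i, i)"
      using hermite_form_lattice_leading_entry[OF HH' z(1), of i] z(2) i d rank
        hermite_form_zero_below[OF H, of i] by auto
  qed
  show ?thesis
  proof (rule eq_matI)
    fix i j assume ij: "i < dim_row H'" "j < dim_col H'"
    obtain z where z: "z \<in> carrier_vec (dim_row H)" "H\<^sup>T *\<^sub>v z = row H' i"
      using row_in_row_lattice[OF eq, of i] ij by auto
    define w where "w = z - unit_vec (dim_row H) i"
    have "H\<^sup>T *\<^sub>v w = row H' i - row H i"
      unfolding w_def using z ij d by (subst mult_minus_distrib_mat_vec[where nr =
          "dim_col H"]) auto
    then have ent: "(H\<^sup>T *\<^sub>v w) $ j = H' $$ (i, j) - H $$ (i, j)" if "j < dim_col H" for j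
      using ij d that by simp
    have w: "w \<in> carrier_vec (dim_row H)" unfolding w_def using z by auto
    have "H' $$ (i, j) = H $$ (i, j)" if "j < dim_col H" for j
      using that
    proof (induction j rule: less_induct)
      case (less j)
      show ?case
      proof (cases "i < j")
        case True
        have "H $$ (j, j) dvd H' $$ (i, j) - H $$ (i, j)"
          using hermite_form_lattice_leading_entry[OF HH w less.prems] ent less by auto
        moreover have "\<bar>H' $$ (i, j) - H $$ (i, j)\<bar> < H $$ (j, j)"
          using hermite_form_pivots(2)[OF HH less.prems True]
            hermite_form_pivots(2)[OF HH', of j i] diag[OF less.prems] less.prems d True by auto
        ultimately show ?thesis by (smt (verit) zdvd_not_zless dvd_minus_iff)
      next
        case False
        then show ?thesis
          using hermite_form_zero_below[OF H, of i j] hermite_form_zero_below[OF H', of i j]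
            diag less.prems ij d by (cases "i = j") auto
      qed
    qed
    then show "H $$ (i, j) = H' $$ (i, j)" using ij d by auto
  qed (use d in auto)
qed

text \<open>
  \<^const>\<open>HNF\<close> is a definite description, so existence and uniqueness have to be known before anything
  can be said about it.
\<close>

lemma HNF_full_column_rank:
  assumes "full_column_rank K" "dim_col K \<le> dim_row K"
  shows "hermite_form (HNF K)" "row_equivalent K (HNF K)"
proof -
  have eq: "HNF K = (THE H. hermite_form H \<and> row_equivalent K H)"
    unfolding HNF_def row_equivalent_def by simp
  have "\<exists>!H. hermite_form H \<and> row_equivalent K H"
  proof (rule ex_ex1I[OF hermite_form_exists])
    fix H H' assume *: "hermite_form H \<and> row_equivalent K H" "hermite_form H' \<and> row_equivalent K H'"
    then have "row_equivalent H H'" using row_equivalent_sym row_equivalent_trans by blast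
    then show "H = H'" using * assms full_column_rank_row_equivalent[of K H] row_equivalent_dim[of
        K H]
      by (intro hermite_form_unique) auto
  qed
  from theI'[OF this] show "hermite_form (HNF K)" "row_equivalent K (HNF K)" unfolding eq by auto
qed

section \<open>Bases of row lattices\<close>

lemma sum_lessThan_add:
  fixes f :: "nat \<Rightarrow> 'a::comm_monoid_add"
  shows "(\<Sum>i<a + b. f i) = (\<Sum>i<a. f i) + (\<Sum>i<b. f (a + i))"
  by (induction b) (simp_all add: add.assoc)

definition rows_independent :: "int mat \<Rightarrow> bool" where
  "rows_independent B \<longleftrightarrow> (\<forall>a\<in>carrier_vec (dim_row B).
     B\<^sup>T *\<^sub>v a = 0\<^sub>v (dim_col B) \<longrightarrow> a = 0\<^sub>v (dim_row B))"

lemma rows_form_basis_iff: "rows_form_basis B L \<longleftrightarrow> row_lattice B = L \<and> rows_independent B"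
  unfolding rows_form_basis_def rows_independent_def by simp

lemma transpose_mult_vec:
  fixes A B :: "'a::comm_ring_1 mat"
  assumes "A \<in> carrier_mat k l" "B \<in> carrier_mat l m" "a \<in> carrier_vec k"
  shows "(A * B)\<^sup>T *\<^sub>v a = B\<^sup>T *\<^sub>v (A\<^sup>T *\<^sub>v a)"
  using assms by (simp add: transpose_mult[of A k l B m] assoc_mult_mat_vec[of _ m l _ k])

lemma transpose_mult_unit_vec:
  fixes V :: "int mat"
  assumes "V \<in> carrier_mat k m" "i < k"
  shows "V\<^sup>T *\<^sub>v unit_vec k i = row V i"
  using assms by (intro eq_vecI) auto

lemma row_lattice_subset_factor:
  assumes V: "V \<in> carrier_mat n m" and W: "W \<in> carrier_mat k m"
    and sub: "row_lattice V \<subseteq> row_lattice W"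
  shows "\<exists>P\<in>carrier_mat n k. V = P * W"
proof -
  have "\<exists>p\<in>carrier_vec k. row V i = W\<^sup>T *\<^sub>v p" if "i < n" for i
  proof -
    have "row V i \<in> row_lattice V" unfolding row_lattice_def
      using transpose_mult_unit_vec[OF V that] V
      by (intro CollectI exI[of _ "unit_vec n i"]) auto
    then show ?thesis using sub W unfolding row_lattice_def by auto
  qed
  then obtain p where p: "\<And>i. i < n \<Longrightarrow> p i \<in> carrier_vec k"
    "\<And>i. i < n \<Longrightarrow> row V i = W\<^sup>T *\<^sub>v p i" by metis
  define P where "P = mat n k (\<lambda>(i, j). p i $ j)"
  have P: "P \<in> carrier_mat n k" unfolding P_def by auto
  have rowP: "row P i = p i" if "i < n" for i
    using p(1)[OF that] that unfolding P_def by (intro eq_vecI) auto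
  have "V = P * W"
  proof (rule eq_matI)
    fix i j assume "i < dim_row (P * W)" "j < dim_col (P * W)"
    then have ij: "i < n" "j < m" using P W by auto
    have "V $$ (i, j) = row V i $ j" using V ij by simp
    also have "\<dots> = col W j \<bullet> p i" using p(2)[OF ij(1)] W ij by simp
    also have "\<dots> = row P i \<bullet> col W j"
      unfolding rowP[OF ij(1)] using W p(1)[OF ij(1)] by (intro comm_scalar_prod[of _ k]) auto
    also have "\<dots> = (P * W) $$ (i, j)" using P W ij by simp
    finally show "V $$ (i, j) = (P * W) $$ (i, j)" .
  qed (use V P W in auto)
  then show ?thesis using P by blast
qed

text \<open>
  Each matrix is an integral combination of the other. Independence of the rows of \<open>W\<close> turns
  \<open>W = (R P) W\<close> into \<open>R P = 1\<close>, and then \<open>det P\<close> is a unit.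
\<close>

lemma same_row_lattice_unimodular:
  assumes V: "V \<in> carrier_mat n m" and W: "W \<in> carrier_mat n m"
    and eq: "row_lattice V = row_lattice W" and ind: "rows_independent W"
  shows "\<exists>P\<in>carrier_mat n n. invertible_mat P \<and> V = P * W"
proof -
  obtain P where P: "P \<in> carrier_mat n n" "V = P * W"
      using row_lattice_subset_factor[OF V W] eq by auto
  obtain R where R: "R \<in> carrier_mat n n" "W = R * V"
      using row_lattice_subset_factor[OF W V] eq by auto
  have RP: "R * P \<in> carrier_mat n n" using R P by auto
  have "W = R * P * W" using R P W by (metis assoc_mult_mat)
  have "R * P = 1\<^sub>m n"
  proof (rule eq_matI)
    fix i j assume ij: "i < dim_row (1\<^sub>m n :: int mat)" "j < dim_col (1\<^sub>m n :: int mat)"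
    define a where "a = row (R * P) i - unit_vec n i"
    have rc: "row (R * P) i \<in> carrier_vec n" using RP ij by auto
    have "W\<^sup>T *\<^sub>v row (R * P) i = row (R * P * W) i"
      using RP W ij by (intro eq_vecI) (auto intro!: comm_scalar_prod[of _ n] simp: carrier_vecI)
    also have "\<dots> = row W i" using \<open>W = R * P * W\<close> by simp
    finally have "W\<^sup>T *\<^sub>v a = 0\<^sub>v m"
      unfolding a_def using transpose_mult_unit_vec[OF W, of i] ij W rc
      by (subst mult_minus_distrib_mat_vec[of _ m n]) auto
    moreover have "a \<in> carrier_vec n" unfolding a_def using RP ij by auto
    ultimately have "a = 0\<^sub>v n" using ind W unfolding rows_independent_def by auto
    then have "a $ j = 0" using ij by simp
    then show "(R * P) $$ (i, j) = 1\<^sub>m n $$ (i, j)" unfolding a_def using ij R(1) P(1) by auto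
  qed (use RP in auto)
  then have "det R * det P = 1" using det_mult[OF R(1) P(1)] by simp
  then have "invertible_mat P"
    using invertible_mat_if_det_unit[OF P(1), of "det R"] by (simp add: mult.commute)
  then show ?thesis using P by blast
qed

lemma int_scalar_prod_self_zero:
  fixes w :: "int vec"
  assumes "w \<in> carrier_vec m" "w \<bullet> w = 0" shows "w = 0\<^sub>v m"
proof -
  have "(\<Sum>i<m. w $ i * w $ i) = 0" using assms by (simp add: scalar_prod_def lessThan_atLeast0)
  then have "\<forall>i<m. w $ i * w $ i = 0" by (subst (asm) sum_nonneg_eq_0_iff) auto
  then show ?thesis using assms by (intro eq_vecI) auto
qed

text \<open>
  The Gram matrix \<open>V V\<^sup>T\<close> of independent rows is nonsingular, since \<open>V\<^sup>T a\<close> has length zero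
  whenever \<open>V V\<^sup>T a = 0\<close>. Its adjugate then clears denominators.
\<close>

lemma rational_right_inverse:
  assumes V: "V \<in> carrier_mat n m" and ind: "rows_independent V"
  shows "\<exists>R\<in>carrier_mat m n. \<exists>d. d \<noteq> 0 \<and> V * R = d \<cdot>\<^sub>m 1\<^sub>m n"
proof -
  let ?M = "V * V\<^sup>T"
  have M: "?M \<in> carrier_mat n n" using V by auto
  have "det ?M \<noteq> 0"
  proof
    assume "det ?M = 0"
    then obtain a where a: "a \<in> carrier_vec n" "a \<noteq> 0\<^sub>v n" "?M *\<^sub>v a = 0\<^sub>v n"
      using det_0_iff_vec_prod_zero[OF M] by auto
    let ?w = "V\<^sup>T *\<^sub>v a"
    have w: "?w \<in> carrier_vec m" using V a by auto
    have "V *\<^sub>v ?w = 0\<^sub>v n"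
      using a(3) assoc_mult_mat_vec[of V n m "V\<^sup>T" n a] V a(1) by simp
    then have "?w \<bullet> ?w = 0"
      using transpose_vec_mult_scalar[OF V w a(1)] a(1) by simp
    then have "?w = 0\<^sub>v m" using int_scalar_prod_self_zero[OF w] by simp
    then show False using a ind V unfolding rows_independent_def by auto
  qed
  moreover have "V * (V\<^sup>T * adj_mat ?M) = det ?M \<cdot>\<^sub>m 1\<^sub>m n"
    using assoc_mult_mat[of V n m "V\<^sup>T" n "adj_mat ?M" n] V adj_mat[OF M] by simp
  moreover have "V\<^sup>T * adj_mat ?M \<in> carrier_mat m n" using V adj_mat(1)[OF M] by auto
  ultimately show ?thesis by blast
qed

lemma det_nonzero_if_rows_independent:
  assumes B: "B \<in> carrier_mat n n" and ind: "rows_independent B"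
  shows "det B \<noteq> 0"
proof
  assume "det B = 0"
  then have "det (B\<^sup>T) = 0" using det_transpose[OF B] by simp
  then obtain a where "a \<in> carrier_vec n" "a \<noteq> 0\<^sub>v n" "B\<^sup>T *\<^sub>v a = 0\<^sub>v n"
    using det_0_iff_vec_prod_zero[of "B\<^sup>T" n] B by auto
  then show False using ind B unfolding rows_independent_def by auto
qed

section \<open>The left kernel read off from the Hermite transformation\<close>

text \<open>
  With \<open>w = U\<^sup>T y\<close> the condition \<open>w K = 0\<close> becomes \<open>y H = 0\<close> for the Hermite form \<open>H\<close>, and by
  triangularity this says that the first \<open>s\<close> entries of \<open>y\<close> vanish. So \<open>w\<close> is a combination of
  the last \<open>n\<close> rows of \<open>U\<close>.
\<close>

lemma left_kernel_basis:
  assumes K: "K \<in> carrier_mat (n + s) s" "full_column_rank K"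
    and U: "U \<in> carrier_mat (n + s) (n + s)" "invertible_mat U" and H: "hermite_form (U * K)"
  shows "rows_form_basis (mat n (n + s) (\<lambda>(i, j). U $$ (s + i, j)))
    {w \<in> carrier_vec (n + s). K\<^sup>T *\<^sub>v w = 0\<^sub>v s}"
proof -
  let ?N = "n + s"
  define B where "B = mat n ?N (\<lambda>(i, j). U $$ (s + i, j))"
  have B: "B \<in> carrier_mat n ?N" unfolding B_def by auto
  obtain U' where U': "U' \<in> carrier_mat ?N ?N" "U * U' = 1\<^sub>m ?N" "U' * U = 1\<^sub>m ?N"
    using invertible_mat_inverseE[OF U(2,1)] by blast
  have Hc: "U * K \<in> carrier_mat ?N s" using U K by auto
  have "row_equivalent K (U * K)" unfolding row_equivalent_def using U K(1) by auto
  then have full: "full_column_rank (U * K)" using K(2) full_column_rank_row_equivalent by blast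
  have KU: "K\<^sup>T *\<^sub>v (U\<^sup>T *\<^sub>v z) = (U * K)\<^sup>T *\<^sub>v z" if "z \<in> carrier_vec ?N" for z
    using transpose_mult_vec[OF U(1) K(1) that] by simp
  \<comment> \<open>The coefficient vector with respect to all rows of \<open>U\<close>.\<close>
  define pad where "pad z = vec ?N (\<lambda>i. if i < s then 0 else z $ (i - s))" for z :: "int vec"
  have pad: "U\<^sup>T *\<^sub>v pad z = B\<^sup>T *\<^sub>v z" if "z \<in> carrier_vec n" for z
  proof (rule eq_vecI)
    fix j assume "j < dim_vec (B\<^sup>T *\<^sub>v z)"
    then have j: "j < ?N" using B by auto
    have "(U\<^sup>T *\<^sub>v pad z) $ j = (\<Sum>i<s + n. U $$ (i, j) * pad z $ i)"
      using U j by (simp add: scalar_prod_def lessThan_atLeast0 add.commute pad_def)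
    also have "\<dots> = (\<Sum>i<s. U $$ (i, j) * pad z $ i) + (\<Sum>i<n. U $$ (s + i, j) * pad z $ (s + i))"
      by (rule sum_lessThan_add)
    also have "\<dots> = (\<Sum>i<n. U $$ (s + i, j) * z $ i)" unfolding pad_def by simp
    also have "\<dots> = (B\<^sup>T *\<^sub>v z) $ j"
      using B that j unfolding B_def by (simp add: scalar_prod_def lessThan_atLeast0)
    finally show "(U\<^sup>T *\<^sub>v pad z) $ j = (B\<^sup>T *\<^sub>v z) $ j" .
  qed (use U B in auto)
  have padc: "pad z \<in> carrier_vec ?N" for z unfolding pad_def by auto
  have padH: "(U * K)\<^sup>T *\<^sub>v pad z = 0\<^sub>v s" for z
  proof (rule eq_vecI)
    fix j assume "j < dim_vec (0\<^sub>v s :: int vec)"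
    then have j: "j < s" by simp
    have "((U * K)\<^sup>T *\<^sub>v pad z) $ j = (\<Sum>i<Suc j. (U * K) $$ (i, j) * pad z $ i)"
      using hermite_form_lattice_entry[OF H, of "pad z" j] Hc padc j U K by simp
    also have "\<dots> = 0" using j unfolding pad_def by (intro sum.neutral) auto
    finally show "((U * K)\<^sup>T *\<^sub>v pad z) $ j = 0\<^sub>v s $ j" using j by simp
  qed (use Hc in auto)
  have "row_lattice B = {w \<in> carrier_vec ?N. K\<^sup>T *\<^sub>v w = 0\<^sub>v s}"
  proof (intro equalityI subsetI)
    fix w assume "w \<in> row_lattice B"
    then obtain z where z: "z \<in> carrier_vec n" "w = B\<^sup>T *\<^sub>v z"
      using B unfolding row_lattice_def by auto
    then have "w = U\<^sup>T *\<^sub>v pad z" using pad by simp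
    then have "K\<^sup>T *\<^sub>v w = 0\<^sub>v s" using KU[OF padc] padH by simp
    then show "w \<in> {w \<in> carrier_vec ?N. K\<^sup>T *\<^sub>v w = 0\<^sub>v s}" using z B by auto
  next
    fix w assume "w \<in> {w \<in> carrier_vec ?N. K\<^sup>T *\<^sub>v w = 0\<^sub>v s}"
    then have w: "w \<in> carrier_vec ?N" "K\<^sup>T *\<^sub>v w = 0\<^sub>v s" by auto
    define y where "y = transpose_mat U' *\<^sub>v w"
    have y: "y \<in> carrier_vec ?N" unfolding y_def using U' w by auto
    have wy: "U\<^sup>T *\<^sub>v y = w"
      unfolding y_def using transpose_mult_vec[OF U'(1) U(1) w(1)] U'(3) w(1) by simp
    then have Hy: "(U * K)\<^sup>T *\<^sub>v y = 0\<^sub>v s" using KU[OF y] w(2) by simp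
    have y0: "y $ j = 0" if "j < s" for j
      using hermite_form_lattice_leading_zeros[OF H full _ _ _ _ that, of y] Hc y U K Hy by simp
    define z where "z = vec n (\<lambda>i. y $ (s + i))"
    have "pad z = y" using y y0 unfolding pad_def z_def by (intro eq_vecI) auto
    then have "w = B\<^sup>T *\<^sub>v z" using pad[of z] wy unfolding z_def by simp
    then show "w \<in> row_lattice B" using B unfolding row_lattice_def z_def by auto
  qed
  moreover have "rows_independent B"
    unfolding rows_independent_def
  proof (intro ballI impI)
    fix z assume z: "z \<in> carrier_vec (dim_row B)" "B\<^sup>T *\<^sub>v z = 0\<^sub>v (dim_col B)"
    then have zn: "z \<in> carrier_vec n" using B by auto
    have "U\<^sup>T *\<^sub>v pad z = 0\<^sub>v ?N" using pad[OF zn] z(2) B by simp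
    then have "transpose_mat U' *\<^sub>v (U\<^sup>T *\<^sub>v pad z) = 0\<^sub>v ?N" using U'(1) by auto
    then have "pad z = 0\<^sub>v ?N"
      using transpose_mult_vec[OF U(1) U'(1) padc, of z] U'(2) padc[of z] by simp
    have "z $ i = 0" if "i < n" for i
    proof -
      have "pad z $ (s + i) = 0" using \<open>pad z = 0\<^sub>v ?N\<close> that by simp
      then show ?thesis using that unfolding pad_def by simp
    qed
    then show "z = 0\<^sub>v (dim_row B)" using zn B by (intro eq_vecI) auto
  qed
  ultimately show ?thesis unfolding rows_form_basis_iff B_def by blast
qed

text \<open>
  The diagonal block makes the columns independent. A row vector \<open>w = (a, b)\<close> lies in the left
  kernel if and only if \<open>b\<close> holds the negated quotients of the entries of \<open>a A\<close> by the numbers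
  \<open>\<tau> k\<close>.
\<close>

lemma torsion_left_kernel:
  fixes A :: "int mat"
  assumes A: "A \<in> carrier_mat n s" and \<tau>: "\<forall>k<s. 0 < \<tau> k"
  defines "K \<equiv> A @\<^sub>r mat_diag s (\<lambda>k. int (\<tau> k))"
  shows "K \<in> carrier_mat (n + s) s" "full_column_rank K"
    and "w \<in> carrier_vec (n + s) \<Longrightarrow> K\<^sup>T *\<^sub>v w = 0\<^sub>v s \<longleftrightarrow>
      (\<forall>k<s. (A\<^sup>T *\<^sub>v vec n (\<lambda>i. w $ i)) $ k + int (\<tau> k) * w $ (n + k) = 0)"
proof -
  let ?D = "mat_diag s (\<lambda>k. int (\<tau> k))"
  have D: "?D \<in> carrier_mat s s" unfolding mat_diag_def by auto
  show K: "K \<in> carrier_mat (n + s) s" unfolding K_def using A D by auto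
  have top: "K $$ (i, k) = A $$ (i, k)" if "i < n" "k < s" for i k
    unfolding K_def append_rows_def using A D that by simp
  have bot: "K $$ (n + l, k) = (if l = k then int (\<tau> k) else 0)" if "l < s" "k < s" for l k
    unfolding K_def append_rows_def using A D that by (simp add: mat_diag_def)
  show "full_column_rank K" unfolding full_column_rank_def
  proof (intro ballI impI)
    fix x assume x: "x \<in> carrier_vec (dim_col K)" "K *\<^sub>v x = 0\<^sub>v (dim_row K)"
    have "x $ l = 0" if l: "l < s" for l
    proof -
      have "0 = (K *\<^sub>v x) $ (n + l)" using x(2) K l by simp
      also have "\<dots> = (\<Sum>k<s. K $$ (n + l, k) * x $ k)"
        using K x(1) l by (simp add: scalar_prod_def lessThan_atLeast0)
      also have "\<dots> = (\<Sum>k<s. if k = l then int (\<tau> k) * x $ k else 0)"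
        using bot l by (intro sum.cong) auto
      also have "\<dots> = int (\<tau> l) * x $ l" using l by simp
      finally show ?thesis using \<tau> l by auto
    qed
    then show "x = 0\<^sub>v (dim_col K)" using x(1) K by (intro eq_vecI) auto
  qed
  assume w: "w \<in> carrier_vec (n + s)"
  have "(K\<^sup>T *\<^sub>v w) $ k = (A\<^sup>T *\<^sub>v vec n (\<lambda>i. w $ i)) $ k + int (\<tau> k) * w $ (n + k)"
    if k: "k < s" for k
  proof -
    have "(K\<^sup>T *\<^sub>v w) $ k = (\<Sum>i<n + s. K $$ (i, k) * w $ i)"
      using K w k by (simp add: scalar_prod_def lessThan_atLeast0)
    also have "\<dots> = (\<Sum>i<n. K $$ (i, k) * w $ i) + (\<Sum>l<s. K $$ (n + l, k) * w $ (n + l))"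
      by (rule sum_lessThan_add)
    also have "(\<Sum>i<n. K $$ (i, k) * w $ i) = (A\<^sup>T *\<^sub>v vec n (\<lambda>i. w $ i)) $ k"
      using A k top by (simp add: scalar_prod_def lessThan_atLeast0)
    also have "(\<Sum>l<s. K $$ (n + l, k) * w $ (n + l)) = (\<Sum>l<s.
        if l = k then int (\<tau> k) * w $ (n + l) else 0)"
      using bot k by (intro sum.cong) auto
    also have "\<dots> = int (\<tau> k) * w $ (n + k)" using k by simp
    finally show ?thesis .
  qed
  note ent = this
  show "K\<^sup>T *\<^sub>v w = 0\<^sub>v s \<longleftrightarrow>
      (\<forall>k<s. (A\<^sup>T *\<^sub>v vec n (\<lambda>i. w $ i)) $ k + int (\<tau> k) * w $ (n + k) = 0)"
  proof
    assume "K\<^sup>T *\<^sub>v w = 0\<^sub>v s"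
    then show "\<forall>k<s. (A\<^sup>T *\<^sub>v vec n (\<lambda>i. w $ i)) $ k + int (\<tau> k) * w $ (n + k) = 0"
      using ent by (metis index_zero_vec(1))
  next
    assume "\<forall>k<s. (A\<^sup>T *\<^sub>v vec n (\<lambda>i. w $ i)) $ k + int (\<tau> k) * w $ (n + k) = 0"
    then show "K\<^sup>T *\<^sub>v w = 0\<^sub>v s" using ent K by (intro eq_vecI) auto
  qed
qed

text \<open>
  Truncation to the first \<open>n\<close> entries is injective on the left kernel, because the other entries
  are quotients determined by the first ones, and its image consists of the vectors for which
  these quotients are integral. So it carries the basis of the left kernel to a basis of that
  lattice.
\<close>

lemma hermite_transform_block_basis:
  fixes A :: "int mat"
  assumes A: "A \<in> carrier_mat n s" and \<tau>: "\<forall>k<s. 0 < \<tau> k"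
    and K: "K = A @\<^sub>r mat_diag s (\<lambda>k. int (\<tau> k))"
    and U: "U \<in> carrier_mat (n + s) (n + s)" "invertible_mat U" and H: "hermite_form (U * K)"
  shows "rows_form_basis (mat n n (\<lambda>(i, j). U $$ (s + i, j)))
    {a \<in> carrier_vec n. \<forall>k<s. int (\<tau> k) dvd (A\<^sup>T *\<^sub>v a) $ k}"
proof -
  let ?\<beta> = "mat n n (\<lambda>(i, j). U $$ (s + i, j))"
  let ?B = "mat n (n + s) (\<lambda>(i, j). U $$ (s + i, j))"
  note tk = torsion_left_kernel[OF A \<tau>, folded K]
  have basis: "row_lattice ?B = {w \<in> carrier_vec (n + s). K\<^sup>T *\<^sub>v w = 0\<^sub>v s}"
    "rows_independent ?B"
    using left_kernel_basis[OF tk(1,2) U H] unfolding rows_form_basis_iff by auto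
  have trunc: "?\<beta>\<^sup>T *\<^sub>v z = vec n (\<lambda>i. (?B\<^sup>T *\<^sub>v z) $ i)" if "z \<in> carrier_vec n" for z
    using that by (intro eq_vecI) (auto simp: scalar_prod_def)
  have mem: "?B\<^sup>T *\<^sub>v z \<in> {w \<in> carrier_vec (n + s). K\<^sup>T *\<^sub>v w = 0\<^sub>v s}"
    if "z \<in> carrier_vec n" for z
    unfolding basis(1)[symmetric] row_lattice_def using that by auto
  have eqs: "\<forall>k<s. (A\<^sup>T *\<^sub>v (?\<beta>\<^sup>T *\<^sub>v z)) $ k
      + int (\<tau> k) * (?B\<^sup>T *\<^sub>v z) $ (n + k) = 0" if z: "z \<in> carrier_vec n" for z
    using tk(3)[of "?B\<^sup>T *\<^sub>v z"] mem[OF z] unfolding trunc[OF z] by blast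
  have "row_lattice ?\<beta> = {a \<in> carrier_vec n. \<forall>k<s. int (\<tau> k) dvd (A\<^sup>T *\<^sub>v a) $ k}"
  proof (intro equalityI subsetI)
    fix a assume "a \<in> row_lattice ?\<beta>"
    then obtain z where z: "z \<in> carrier_vec n" "a = ?\<beta>\<^sup>T *\<^sub>v z" unfolding row_lattice_def by auto
    have "int (\<tau> k) dvd (A\<^sup>T *\<^sub>v a) $ k" if "k < s" for k
    proof -
      have "(A\<^sup>T *\<^sub>v a) $ k = int (\<tau> k) * - (?B\<^sup>T *\<^sub>v z) $ (n + k)"
        using eqs[OF z(1)] that unfolding z(2) by (simp add: eq_neg_iff_add_eq_0)
      then show ?thesis by (rule dvdI)
    qed
    moreover have "a \<in> carrier_vec n" unfolding z(2) by (auto intro: carrier_vecI)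
    ultimately show "a \<in> {a \<in> carrier_vec n. \<forall>k<s. int (\<tau> k) dvd (A\<^sup>T *\<^sub>v a) $ k}" by blast
  next
    fix a assume "a \<in> {a \<in> carrier_vec n. \<forall>k<s. int (\<tau> k) dvd (A\<^sup>T *\<^sub>v a) $ k}"
    then have a: "a \<in> carrier_vec n" "\<And>k. k < s \<Longrightarrow> int (\<tau> k) dvd (A\<^sup>T *\<^sub>v a) $ k" by auto
    define w where "w = vec (n + s) (\<lambda>i. if i < n then a $ i
      else - ((A\<^sup>T *\<^sub>v a) $ (i - n) div int (\<tau> (i - n))))"
    have wa: "vec n (\<lambda>i. w $ i) = a" using a(1) unfolding w_def by (intro eq_vecI) auto
    have wc: "w \<in> carrier_vec (n + s)" unfolding w_def by auto
    have "K\<^sup>T *\<^sub>v w = 0\<^sub>v s"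
      unfolding tk(3)[OF wc] wa using a(2) unfolding w_def by simp
    then have "w \<in> row_lattice ?B" unfolding basis(1) using wc by blast
    then obtain z where z: "z \<in> carrier_vec n" "w = ?B\<^sup>T *\<^sub>v z" unfolding row_lattice_def by auto
    then have "a = ?\<beta>\<^sup>T *\<^sub>v z" using trunc wa by simp
    then show "a \<in> row_lattice ?\<beta>" unfolding row_lattice_def using z(1) by auto
  qed
  moreover have "rows_independent ?\<beta>"
    unfolding rows_independent_def
  proof (intro ballI impI)
    fix z assume z0: "z \<in> carrier_vec (dim_row ?\<beta>)" "?\<beta>\<^sup>T *\<^sub>v z = 0\<^sub>v (dim_col ?\<beta>)"
    then have z: "z \<in> carrier_vec n" by simp
    have A0: "A\<^sup>T *\<^sub>v 0\<^sub>v n = 0\<^sub>v s" using A by (intro eq_vecI) auto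
    have low: "(?B\<^sup>T *\<^sub>v z) $ (n + k) = 0" if "k < s" for k
    proof -
      have "0 < \<tau> k" using \<tau> that by blast
      moreover have "(A\<^sup>T *\<^sub>v (?\<beta>\<^sup>T *\<^sub>v z)) $ k = 0" using z0(2) A0 that by simp
      ultimately show ?thesis using eqs[OF z, rule_format, OF that] by auto
    qed
    have high: "(?B\<^sup>T *\<^sub>v z) $ i = 0" if "i < n" for i
    proof -
      have "(?\<beta>\<^sup>T *\<^sub>v z) $ i = 0" using z0(2) that by simp
      then show ?thesis unfolding trunc[OF z] using that by simp
    qed
    have *: "(?B\<^sup>T *\<^sub>v z) $ i = 0" if "i < n + s" for i
      using high[of i] low[of "i - n"] that by (cases "i < n") (auto simp del: index_mult_mat_vec)
    have "?B\<^sup>T *\<^sub>v z = 0\<^sub>v (n + s)"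
    proof (rule eq_vecI)
      fix i assume "i < dim_vec (0\<^sub>v (n + s) :: int vec)"
      then show "(?B\<^sup>T *\<^sub>v z) $ i = 0\<^sub>v (n + s) $ i" using * by simp
    qed simp
    then show "z = 0\<^sub>v (dim_row ?\<beta>)" using basis(2) z unfolding rows_independent_def by simp
  qed
  ultimately show ?thesis unfolding rows_form_basis_iff by blast
qed

section \<open>Integral functionals on rational cones\<close>

lemma abs_mult_le:
  fixes x y d :: real
  assumes "\<bar>y\<bar> < d" shows "\<bar>x * y\<bar> \<le> \<bar>x\<bar> * d"
  unfolding abs_mult using assms by (intro mult_left_mono) auto

text \<open>
  Finitely many reals can be approximated by rationals without losing any rational linear
  relation among them. In the induction a number that is independent of the previous ones over
  \<open>\<rat>\<close> may be approximated freely, since it occurs in no relation, while a dependent one has to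
  follow the approximations of the others.
\<close>

lemma rational_approximation_preserving_relations:
  fixes u :: "nat \<Rightarrow> real"
  assumes "0 < e"
  shows "\<exists>q :: nat \<Rightarrow> rat. (\<forall>i<n. \<bar>of_rat (q i) - u i\<bar> < e) \<and>
    (\<forall>a :: nat \<Rightarrow> rat. (\<Sum>i<n. of_rat (a i) * u i) = 0 \<longrightarrow> (\<Sum>i<n. a i * q i) = 0)"
  using assms
proof (induction n arbitrary: e)
  case 0
  then show ?case by auto
next
  case (Suc n)
  show ?case
  proof (cases "\<exists>c :: nat \<Rightarrow> rat. u n = (\<Sum>i<n. of_rat (c i) * u i)")
    case False
    obtain q :: "nat \<Rightarrow> rat" where q: "\<forall>i<n. \<bar>of_rat (q i) - u i\<bar> < e"
      "\<forall>a :: nat \<Rightarrow> rat. (\<Sum>i<n. of_rat (a i) * u i) = 0 \<longrightarrow> (\<Sum>i<n. a i * q i) = 0"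
      using Suc by blast
    obtain p :: rat where p: "u n - e < of_rat p" "of_rat p < u n + e"
      using of_rat_dense[of "u n - e" "u n + e"] Suc.prems by auto
    show ?thesis
    proof (intro exI[of _ "q(n := p)"] conjI allI impI)
      fix i assume "i < Suc n"
      then show "\<bar>of_rat ((q(n := p)) i) - u i\<bar> < e" using q(1) p by (auto simp: less_Suc_eq)
    next
      fix a :: "nat \<Rightarrow> rat" assume a: "(\<Sum>i<Suc n. of_rat (a i) * u i) = 0"
      have "a n = 0"
      proof (rule ccontr)
        assume "a n \<noteq> 0"
        then have "u n = (\<Sum>i<n. of_rat (- a i / a n) * u i)"
          using a by (simp add: of_rat_divide of_rat_minus sum_negf sum_divide_distrib[symmetric]
              field_simps)
        then show False using False by (metis (mono_tags))
      qed
      then show "(\<Sum>i<Suc n. a i * (q(n := p)) i) = 0" using a q(2) by auto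
    qed
  next
    case True
    then obtain c :: "nat \<Rightarrow> rat" where c: "u n = (\<Sum>i<n. of_rat (c i) * u i)" by blast
    \<comment> \<open>A combination with coefficients \<open>c\<close> of errors below \<open>e / M\<close> stays below \<open>e\<close>.\<close>
    define M where "M = 1 + (\<Sum>i<n. \<bar>of_rat (c i) :: real\<bar>)"
    have M: "M \<ge> 1" unfolding M_def by (simp add: sum_nonneg)
    then obtain q :: "nat \<Rightarrow> rat" where q: "\<forall>i<n. \<bar>of_rat (q i) - u i\<bar> < e / M"
      "\<forall>a :: nat \<Rightarrow> rat. (\<Sum>i<n. of_rat (a i) * u i) = 0 \<longrightarrow> (\<Sum>i<n. a i * q i) = 0"
      using Suc.IH[of "e / M"] Suc.prems by auto
    define p where "p = (\<Sum>i<n. c i * q i)"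
    have pn: "\<bar>of_rat p - u n\<bar> < e"
    proof -
      have "\<bar>of_rat p - u n\<bar> = \<bar>\<Sum>i<n. of_rat (c i) * (of_rat (q i) - u i)\<bar>"
        unfolding p_def c by (simp add: of_rat_sum of_rat_mult sum_subtractf right_diff_distrib)
      also have "\<dots> \<le> (\<Sum>i<n. \<bar>of_rat (c i)\<bar> * (e / M))"
        using q(1) by (intro order_trans[OF sum_abs] sum_mono abs_mult_le) auto
      also have "\<dots> = (M - 1) * (e / M)" unfolding M_def
          by (simp only: sum_distrib_right add_diff_cancel_left')
      also have "\<dots> < e" using M Suc.prems by (simp add: field_simps)
      finally show ?thesis .
    qed
    have eM: "e / M \<le> e" using M Suc.prems by (simp add: field_simps)
    show ?thesis
    proof (intro exI[of _ "q(n := p)"] conjI allI impI)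
      fix i assume "i < Suc n"
      then show "\<bar>of_rat ((q(n := p)) i) - u i\<bar> < e"
        using q(1) pn eM by (auto simp: less_Suc_eq intro: less_le_trans)
    next
      fix a :: "nat \<Rightarrow> rat" assume a: "(\<Sum>i<Suc n. of_rat (a i) * u i) = 0"
      have "(\<Sum>i<n. of_rat (a i + a n * c i) * u i) = 0"
        using a c by (simp add: of_rat_add of_rat_mult ring_distribs sum.distrib sum_distrib_left
            mult.assoc)
      then have "(\<Sum>i<n. (a i + a n * c i) * q i) = 0" by (rule q(2)[rule_format])
      then show "(\<Sum>i<Suc n. a i * (q(n := p)) i) = 0"
        by (simp add: p_def ring_distribs sum.distrib sum_distrib_left mult.assoc)
    qed
  qed
qed

lemma scalar_prod_mult_mat_vec:
  fixes A :: "'a::comm_ring_1 mat"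
  assumes "u \<in> carrier_vec (dim_row A)" "x \<in> carrier_vec (dim_col A)"
  shows "u \<bullet> (A *\<^sub>v x) = (\<Sum>j<dim_col A. (u \<bullet> col A j) * x $ j)"
proof -
  have "u \<bullet> (A *\<^sub>v x) = (\<Sum>i<dim_row A. \<Sum>j<dim_col A. u $ i * (A $$ (i, j) * x $ j))"
    using assms by (simp add: scalar_prod_def lessThan_atLeast0 sum_distrib_left)
  also have "\<dots> = (\<Sum>j<dim_col A. \<Sum>i<dim_row A. u $ i * (A $$ (i, j) * x $ j))"
    by (rule sum.swap)
  also have "\<dots> = (\<Sum>j<dim_col A. (u \<bullet> col A j) * x $ j)"
    using assms by (auto simp: scalar_prod_def lessThan_atLeast0 sum_distrib_right mult.assoc)
  finally show ?thesis .
qed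

lemma col_in_pos_cone:
  assumes "j < dim_col A" shows "col A j \<in> pos_cone A"
proof -
  have "A *\<^sub>v unit_vec (dim_col A) j = col A j"
    using assms by (intro eq_vecI) (auto simp: )
  then show ?thesis unfolding pos_cone_def using assms
    by (auto intro!: exI[of _ "unit_vec (dim_col A) j"])
qed

lemma rvec_scalar_prod:
  "dim_vec v = dim_vec w \<Longrightarrow> rvec v \<bullet> rvec w = real_of_int (v \<bullet> w)"
  by (simp add: scalar_prod_def)

lemma pos_cone_nonneg_iff:
  assumes "u \<in> carrier_vec (dim_row A)"
  shows "(\<forall>x\<in>pos_cone A. 0 \<le> u \<bullet> x) \<longleftrightarrow> (\<forall>j<dim_col A. 0 \<le> u \<bullet> col A j)"
proof
  show "\<forall>x\<in>pos_cone A. 0 \<le> u \<bullet> x \<Longrightarrow> \<forall>j<dim_col A. 0 \<le> u \<bullet> col A j"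
    using col_in_pos_cone by blast
  assume "\<forall>j<dim_col A. 0 \<le> u \<bullet> col A j"
  then show "\<forall>x\<in>pos_cone A. 0 \<le> u \<bullet> x"
    using assms unfolding pos_cone_def by (auto simp: scalar_prod_mult_mat_vec intro!: sum_nonneg)
qed

lemma pos_cone_perp_iff:
  assumes u: "u \<in> carrier_vec (dim_row A)" and nn: "\<forall>j<dim_col A. 0 \<le> u \<bullet> col A j"
    and x: "x \<in> carrier_vec (dim_col A)" "\<forall>j<dim_col A. 0 \<le> x $ j"
  shows "u \<bullet> (A *\<^sub>v x) = 0 \<longleftrightarrow> (\<forall>j<dim_col A. u \<bullet> col A j = 0 \<or> x $ j = (0::real))"
  unfolding scalar_prod_mult_mat_vec[OF u x(1)]
  using nn x(2) by (subst sum_nonneg_eq_0_iff) auto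

text \<open>
  A real functional \<open>w\<close> that cuts out a face vanishes on some integral generators and is
  positive on the others. The vanishing conditions are rational linear relations among the
  entries of \<open>w\<close> and survive a suitable rational approximation, the finitely many strict
  inequalities survive any sufficiently close one. Clearing denominators gives an integral
  functional with the same face.
\<close>

lemma integral_face_functional:
  assumes "rational_cone n \<sigma>" "face n \<rho> \<sigma>"
  shows "\<exists>u\<in>dual_monoid n \<sigma>. \<rho> = {x \<in> \<sigma>. rvec u \<bullet> x = 0}"
proof -
  obtain A :: "int mat" where A: "dim_row A = n" "\<sigma> = pos_cone (map_mat real_of_int A)"
    using assms(1) unfolding rational_cone_def by auto
  define R where "R = map_mat real_of_int A"
  have R: "dim_row R = n" "dim_col R = dim_col A" "\<sigma> = pos_cone R" using A unfolding R_def by auto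
  obtain w where w: "w \<in> carrier_vec n" "\<forall>x\<in>\<sigma>. 0 \<le> w \<bullet> x" "\<rho> = {x \<in> \<sigma>. w \<bullet> x = 0}"
    using assms(2) unfolding face_def by auto
  have wnn: "0 \<le> w \<bullet> col R j" if "j < dim_col A" for j
    using w(2) pos_cone_nonneg_iff[of w R] w(1) R that by auto
  define P where "P = {j. j < dim_col A \<and> w \<bullet> col R j > 0}"
  have finP: "finite P" unfolding P_def by auto
  \<comment> \<open>A positive lower bound for the nonzero values on the generators. Inserting 1 covers the case that there are none.\<close>
  define m where "m = Min (insert 1 ((\<lambda>j. w \<bullet> col R j) ` P))"
  have m: "0 < m" "\<And>j. j \<in> P \<Longrightarrow> m \<le> w \<bullet> col R j"
    unfolding m_def using finP by (auto simp: P_def)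
  \<comment> \<open>An error below \<open>m / M\<close> in each entry of \<open>w\<close> changes the value on a generator by less than \<open>m\<close>.\<close>
  define M where "M = 1 + (\<Sum>j<dim_col A. \<Sum>i<n. \<bar>R $$ (i, j)\<bar>)"
  have M: "M \<ge> 1" unfolding M_def by (simp add: sum_nonneg)
  obtain q :: "nat \<Rightarrow> rat" where q: "\<forall>i<n. \<bar>of_rat (q i) - w $ i\<bar> < m / M"
    "\<forall>a :: nat \<Rightarrow> rat. (\<Sum>i<n. of_rat (a i) * w $ i) = 0 \<longrightarrow> (\<Sum>i<n. a i * q i) = 0"
    using rational_approximation_preserving_relations[of "m / M" n "\<lambda>i. w $ i"] m M by auto
  define D where "D = (\<Prod>i<n. snd (quotient_of (q i)))"
  have D: "0 < D" unfolding D_def by (intro prod_pos) (auto simp: quotient_of_denom_pos')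
  have "\<exists>z :: int. rat_of_int z = of_int D * q i" if "i < n" for i
  proof -
    have "snd (quotient_of (q i)) dvd D" unfolding D_def using that by (intro dvd_prodI) auto
    then obtain k where k: "D = snd (quotient_of (q i)) * k" by auto
    have "q i = of_int (fst (quotient_of (q i))) / of_int (snd (quotient_of (q i)))"
      by (metis quotient_of_div prod.collapse)
    moreover have "snd (quotient_of (q i)) \<noteq> 0" by (metis quotient_of_denom_pos' less_irrefl)
    ultimately have "of_int D * q i = of_int (fst (quotient_of (q i)) * k)"
      unfolding k by (simp add: field_simps)
    then show ?thesis by metis
  qed
  then obtain z :: "nat \<Rightarrow> int" where z: "\<And>i. i < n \<Longrightarrow> rat_of_int (z i) = of_int D * q i" by metis
  have zr: "real_of_int (z i) = of_int D * of_rat (q i)" if "i < n" for i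
    using arg_cong[OF z[OF that], of "of_rat :: rat \<Rightarrow> real"] by (simp add: of_rat_mult)
  define u where "u = vec n z"
  have u: "u \<in> carrier_vec n" unfolding u_def by auto
  have val: "rvec u \<bullet> col R j = of_int D * (\<Sum>i<n. of_rat (q i) * R $$ (i, j))"
      if "j < dim_col A" for j
    using that R zr by (simp add: u_def scalar_prod_def lessThan_atLeast0 sum_distrib_left
        mult.assoc)
  have pos: "rvec u \<bullet> col R j > 0" if "j \<in> P" for j
  proof -
    have j: "j < dim_col A" using that P_def by auto
    have wj: "w \<bullet> col R j = (\<Sum>i<n. w $ i * R $$ (i, j))"
      using j R w by (simp add: scalar_prod_def lessThan_atLeast0)
    have "(\<Sum>i<n. \<bar>R $$ (i, j)\<bar>) \<le> M - 1"
      unfolding M_def using j by (simp, intro member_le_sum) (auto intro: sum_nonneg)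
    then have "(\<Sum>i<n. \<bar>R $$ (i, j)\<bar>) * (m / M) \<le> (M - 1) * (m / M)"
      using m M by (intro mult_right_mono) auto
    also have "\<dots> < m" using m M by (simp add: field_simps)
    finally have lt: "(\<Sum>i<n. \<bar>R $$ (i, j)\<bar>) * (m / M) < m" .
    have "\<bar>(\<Sum>i<n. of_rat (q i) * R $$ (i, j)) - w \<bullet> col R j\<bar> = \<bar>\<Sum>i<n. (of_rat (q i) - w $ i) *
        R $$ (i, j)\<bar>"
      unfolding wj by (simp add: sum_subtractf left_diff_distrib)
    also have "\<dots> \<le> (\<Sum>i<n. \<bar>R $$ (i, j)\<bar> * (m / M))"
      using q(1) by (subst mult.commute, intro order_trans[OF sum_abs] sum_mono abs_mult_le) auto
    also have "\<dots> < m" using lt unfolding sum_distrib_right .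
    finally have "(\<Sum>i<n. of_rat (q i) * R $$ (i, j)) > 0" using m(2)[OF that] by linarith
    then show ?thesis using val[OF j] D by simp
  qed
  have zero: "rvec u \<bullet> col R j = 0" if "j < dim_col A" "j \<notin> P" for j
  proof -
    have "w \<bullet> col R j = 0" using that wnn[of j] unfolding P_def by auto
    then have "(\<Sum>i<n. of_rat (of_int (A $$ (i, j))) * w $ i) = 0"
      using that A R w by (simp add: scalar_prod_def lessThan_atLeast0 mult.commute R_def)
    from q(2)[rule_format, OF this] have "(\<Sum>i<n. of_int (A $$ (i, j)) * q i) = 0" .
    from arg_cong[OF this, of "of_rat :: rat \<Rightarrow> real"]
    have "(\<Sum>i<n. of_rat (q i) * R $$ (i, j)) = 0"
      using that A by (simp add: of_rat_sum of_rat_mult R_def mult.commute)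
    then show ?thesis using val that by simp
  qed
  have nn: "\<forall>j<dim_col R. 0 \<le> rvec u \<bullet> col R j" using pos zero R by (metis less_imp_le order_refl)
  have ru: "rvec u \<in> carrier_vec (dim_row R)" "w \<in> carrier_vec (dim_row R)" using u w R by auto
  have "u \<in> dual_monoid n \<sigma>" unfolding dual_monoid_def
    using u pos_cone_nonneg_iff[OF ru(1)] nn R by auto
  moreover have "rvec u \<bullet> x = 0 \<longleftrightarrow> w \<bullet> x = 0" if "x \<in> \<sigma>" for x
  proof -
    obtain c where c: "x = R *\<^sub>v c" "c \<in> carrier_vec (dim_col R)" "\<forall>j<dim_col R. 0 \<le> c $ j"
      using \<open>x \<in> \<sigma>\<close> unfolding R(3) pos_cone_def by blast
    have "rvec u \<bullet> col R j = 0 \<longleftrightarrow> w \<bullet> col R j = 0" if "j < dim_col R" for j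
      using pos[of j] zero[of j] that R wnn[of j] unfolding P_def by fastforce
    then show ?thesis
      using pos_cone_perp_iff[OF ru(1) nn c(2,3)] pos_cone_perp_iff[OF ru(2) _ c(2,3)] wnn R c(1)
          by auto
  qed
  ultimately show ?thesis using w(3) by (intro bexI[of _ u]) auto
qed

text \<open>
  The functional \<open>a\<close> can be negative only on generators outside the face, and there \<open>u\<close> takes
  values at least 1. This expresses \<open>\<chi>\<^sup>a\<close> as a quotient of monomials regular on the chart of
  \<open>\<sigma>\<close>.
\<close>

lemma dual_monoid_extend_from_face:
  assumes cone: "rational_cone n \<sigma>" and u: "u \<in> dual_monoid n \<sigma>"
    and a: "a \<in> dual_monoid n {x \<in> \<sigma>. rvec u \<bullet> x = 0}"
  shows "\<exists>k :: nat. a + int k \<cdot>\<^sub>v u \<in> dual_monoid n \<sigma>"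
proof -
  obtain A :: "int mat" where A: "dim_row A = n" "\<sigma> = pos_cone (map_mat real_of_int A)"
    using cone unfolding rational_cone_def by auto
  define R where "R = map_mat real_of_int A"
  have R: "dim_row R = n" "dim_col R = dim_col A" "\<sigma> = pos_cone R" using A unfolding R_def by auto
  have uc: "u \<in> carrier_vec n" "a \<in> carrier_vec n" using u a unfolding dual_monoid_def by auto
  have colR: "col R j = rvec (col A j)" if "j < dim_col A" for j
    using that unfolding R_def by (intro eq_vecI) auto
  have rv: "rvec v \<bullet> col R j = real_of_int (v \<bullet> col A j)"
      if "j < dim_col A" "v \<in> carrier_vec n" for v j
    using that A by (simp add: colR rvec_scalar_prod)
  \<comment> \<open>Any number that is at least \<open>\<bar>a \<bullet> col A j\<bar>\<close> for every generator.\<close>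
  define k where "k = nat (\<Sum>j<dim_col A. \<bar>a \<bullet> col A j\<bar>)"
  have "0 \<le> (a + int k \<cdot>\<^sub>v u) \<bullet> col A j" if j: "j < dim_col A" for j
  proof -
    have e: "(a + int k \<cdot>\<^sub>v u) \<bullet> col A j = a \<bullet> col A j + int k * (u \<bullet> col A j)"
      using uc A by (subst add_scalar_prod_distrib[of _ n]) auto
    have mem: "col R j \<in> \<sigma>" using col_in_pos_cone[of j R] R j by auto
    then have u0: "0 \<le> u \<bullet> col A j" using u rv[OF j uc(1)] unfolding dual_monoid_def by auto
    have "\<bar>a \<bullet> col A j\<bar> \<le> int k" unfolding k_def
        using j by (simp add: sum_nonneg, intro member_le_sum) auto
    show ?thesis
    proof (cases "u \<bullet> col A j = 0")
      case True
      then have "0 \<le> rvec a \<bullet> col R j" using a mem rv[OF j uc(1)] unfolding dual_monoid_def by auto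
      then show ?thesis using True e rv[OF j uc(2)] by auto
    next
      case False
      then have "int k * 1 \<le> int k * (u \<bullet> col A j)" using u0 by (intro mult_left_mono) auto
      then show ?thesis using e \<open>\<bar>a \<bullet> col A j\<bar> \<le> int k\<close> by auto
    qed
  qed
  then have "\<forall>j<dim_col R. 0 \<le> rvec (a + int k \<cdot>\<^sub>v u) \<bullet> col R j"
    using R rv uc by auto
  then show ?thesis unfolding dual_monoid_def
    using pos_cone_nonneg_iff[of "rvec (a + int k \<cdot>\<^sub>v u)" R] R uc by (intro exI[of _ k]) auto
qed

section \<open>Zariski topologies\<close>

lemma openin_zariski_basic: "f \<in> A \<Longrightarrow> openin (zariski P A) {p \<in> P. f p \<noteq> 0}"
  unfolding zariski_def by (rule topology_generated_by_Basis) blast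

lemma topspace_zariski:
  assumes "(\<lambda>_. 1) \<in> A" shows "topspace (zariski P A) = P"
proof -
  have "P \<in> {{p \<in> P. f p \<noteq> 0} |f. f \<in> A}"
    using assms by (intro CollectI exI[of _ "\<lambda>_. 1"]) auto
  then have "P \<subseteq> \<Union>{{p \<in> P. f p \<noteq> 0} |f. f \<in> A}" by (rule Union_upper)
  then show ?thesis unfolding zariski_def by (auto simp: topology_generated_by_topspace)
qed

text \<open>
  Nonvanishing sets are closed under finite intersections as products of functions of \<open>A\<close> stay
  in \<open>A\<close>; so the generating sets of the topology already form a basis.
\<close>

lemma zariski_basis:
  assumes "openin (zariski P A) U" "x \<in> U"
    and one: "(\<lambda>_. 1) \<in> A" and mult: "\<And>f g. f \<in> A \<Longrightarrow> g \<in> A \<Longrightarrow> (\<lambda>p. f p * g p) \<in> A"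
  shows "\<exists>f\<in>A. f x \<noteq> 0 \<and> {p \<in> P. f p \<noteq> 0} \<subseteq> U"
proof -
  have "generate_topology_on {{p \<in> P. f p \<noteq> 0} |f. f \<in> A} U"
    using assms(1) unfolding zariski_def by (simp add: openin_topology_generated_by_iff)
  then have "\<forall>x\<in>U. \<exists>f\<in>A. f x \<noteq> 0 \<and> {p \<in> P. f p \<noteq> 0} \<subseteq> U"
  proof induction
    case Empty
    then show ?case by simp
  next
    case (Int a b)
    show ?case
    proof
      fix x assume "x \<in> a \<inter> b"
      then obtain f g where "f \<in> A" "f x \<noteq> 0" "{p \<in> P. f p \<noteq> 0} \<subseteq> a"
        "g \<in> A" "g x \<noteq> 0" "{p \<in> P. g p \<noteq> 0} \<subseteq> b" using Int by blast
      then show "\<exists>f\<in>A. f x \<noteq> 0 \<and> {p \<in> P. f p \<noteq> 0} \<subseteq> a \<inter> b"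
        using mult[of f g] by (intro bexI[of _ "\<lambda>p. f p * g p"]) auto
    qed
  next
    case (UN K)
    then show ?case by blast
  next
    case (Basis s)
    then show ?case by blast
  qed
  then show ?thesis using assms(2) by blast
qed

lemma openin_toric_topology:
  "openin (toric_topology n \<Delta>) W \<longleftrightarrow> W \<subseteq> (\<Union>\<sigma>\<in>\<Delta>. chart n \<sigma>) \<and>
     (\<forall>\<sigma>\<in>\<Delta>. openin (zariski (chart n \<sigma>) (chart_ring n \<sigma>)) (W \<inter> chart n \<sigma>))"
proof -
  define locally_open where "locally_open W \<sigma> \<longleftrightarrow>
    openin (zariski (chart n \<sigma>) (chart_ring n \<sigma>)) (W \<inter> chart n \<sigma>)" for W \<sigma>
  have int: "locally_open (S \<inter> T) \<sigma>" if "locally_open S \<sigma>" "locally_open T \<sigma>" for S T \<sigma>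
    using openin_Int[OF that[unfolded locally_open_def]] unfolding locally_open_def
    by (simp add: Int_ac)
  have un: "locally_open (\<Union>\<K>) \<sigma>" if "\<forall>K\<in>\<K>. locally_open K \<sigma>" for \<K> \<sigma>
  proof -
    have "openin (zariski (chart n \<sigma>) (chart_ring n \<sigma>)) (\<Union>((\<lambda>K. K \<inter> chart n \<sigma>) ` \<K>))"
      using that unfolding locally_open_def by (intro openin_Union) blast
    also have "\<Union>((\<lambda>K. K \<inter> chart n \<sigma>) ` \<K>) = \<Union>\<K> \<inter> chart n \<sigma>" by blast
    finally show ?thesis unfolding locally_open_def .
  qed
  have "istopology (\<lambda>W. W \<subseteq> (\<Union>\<sigma>\<in>\<Delta>. chart n \<sigma>) \<and> (\<forall>\<sigma>\<in>\<Delta>. locally_open W \<sigma>))"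
    unfolding istopology_def using int un by (auto simp: Ball_def)
  then show ?thesis unfolding toric_topology_def locally_open_def by (simp add: topology_inverse')
qed

section \<open>Charts of a toric variety\<close>

lemma face_subset: "face n \<rho> \<sigma> \<Longrightarrow> \<rho> \<subseteq> \<sigma>" unfolding face_def by blast

lemma fan_self_face: "rational_fan n \<Delta> \<Longrightarrow> \<sigma> \<in> \<Delta> \<Longrightarrow> face n \<sigma> \<sigma>"
  unfolding rational_fan_def by (metis Int_absorb)

lemma fan_face_iff:
  assumes "rational_fan n \<Delta>" "\<rho> \<in> \<Delta>" "\<sigma> \<in> \<Delta>" "face n \<gamma> \<sigma>"
  shows "face n \<gamma> \<rho> \<longleftrightarrow> \<gamma> \<subseteq> \<rho>"
proof
  show "face n \<gamma> \<rho> \<Longrightarrow> \<gamma> \<subseteq> \<rho>" by (rule face_subset)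
  assume "\<gamma> \<subseteq> \<rho>"
  then have "\<gamma> \<inter> \<rho> = \<gamma>" by blast
  moreover have "\<gamma> \<in> \<Delta>" using assms unfolding rational_fan_def by blast
  ultimately show "face n \<gamma> \<rho>" using assms(1,2) unfolding rational_fan_def by metis
qed

lemma cone_subset_carrier: "rational_cone n \<sigma> \<Longrightarrow> \<sigma> \<subseteq> carrier_vec n"
  unfolding rational_cone_def pos_cone_def by (auto intro: carrier_vecI)

lemma chart_character_zero_iff:
  "(\<gamma>, \<phi>) \<in> chart n \<sigma> \<Longrightarrow> \<phi> m \<noteq> 0 \<longleftrightarrow> m \<in> perp_lattice n \<gamma>"
  unfolding chart_def orbit_def by auto

text \<open>
  At a point of the chart a character has value zero outside the orthogonal lattice of its
  orbit. Adding a \<open>b\<close> from this lattice does not change whether that happens, so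
  multiplicativity extends to all \<open>a\<close>.
\<close>

lemma chart_character_add:
  assumes p: "(\<gamma>, \<phi>) \<in> chart n \<sigma>" and a: "a \<in> carrier_vec n" and b: "\<phi> b \<noteq> 0"
    and \<sigma>: "\<sigma> \<subseteq> carrier_vec n"
  shows "\<phi> (a + b) = \<phi> a * \<phi> b"
proof -
  have \<gamma>: "\<gamma> \<subseteq> carrier_vec n" using p face_subset \<sigma> unfolding chart_def by blast
  have bp: "b \<in> perp_lattice n \<gamma>" using b chart_character_zero_iff[OF p] by blast
  then have bc: "b \<in> carrier_vec n" unfolding perp_lattice_def by auto
  have eval: "rvec (a + b) \<bullet> u = rvec a \<bullet> u" if "u \<in> \<gamma>" for u
  proof -
    have "rvec (a + b) = rvec a + rvec b" using a bc by (intro eq_vecI) auto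
    then have "rvec (a + b) \<bullet> u = rvec a \<bullet> u + rvec b \<bullet> u"
      using a bc \<gamma> that by (simp add: add_scalar_prod_distrib[of _ n] subset_iff)
    then show ?thesis using bp that unfolding perp_lattice_def by auto
  qed
  show ?thesis
  proof (cases "a \<in> perp_lattice n \<gamma>")
    case True
    then show ?thesis using p bp unfolding chart_def orbit_def by auto
  next
    case False
    then have "a + b \<notin> perp_lattice n \<gamma>" using eval a unfolding perp_lattice_def by auto
    then show ?thesis using False chart_character_zero_iff[OF p] by (metis mult_zero_left)
  qed
qed

lemma monomial_in_chart_ring:
  assumes "a \<in> dual_monoid n \<sigma>" shows "(\<lambda>p. snd p a) \<in> chart_ring n \<sigma>"
  unfolding chart_ring_def using assms
  by (auto intro!: exI[of _ "{a}"] exI[of _ "\<lambda>_. 1 :: complex"])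

text \<open>
  Two charts meet in the principal open set where \<open>\<chi>\<^sup>u\<close> does not vanish, for an integral \<open>u\<close>
  that cuts out the common face. A point of the chart of \<open>\<sigma>\<close> whose orbit belongs to the face \<open>\<gamma>\<close>
  lies there exactly if \<open>\<gamma> \<subseteq> \<rho>\<close>, and in a fan this means that \<open>\<gamma>\<close> is a face of \<open>\<rho>\<close>.
\<close>

lemma chart_intersection_functional:
  assumes fan: "rational_fan n \<Delta>" and \<rho>: "\<rho> \<in> \<Delta>" and \<sigma>: "\<sigma> \<in> \<Delta>"
  obtains u where "u \<in> dual_monoid n \<sigma>" "\<sigma> \<inter> \<rho> = {x \<in> \<sigma>. rvec u \<bullet> x = 0}"
    "chart n \<rho> \<inter> chart n \<sigma> = {p \<in> chart n \<sigma>. snd p u \<noteq> 0}"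
proof -
  have "rational_cone n \<sigma>" "face n (\<sigma> \<inter> \<rho>) \<sigma>" using assms unfolding rational_fan_def by auto
  from integral_face_functional[OF this] obtain u where
    u: "u \<in> dual_monoid n \<sigma>" "\<sigma> \<inter> \<rho> = {x \<in> \<sigma>. rvec u \<bullet> x = 0}" by blast
  have "(\<gamma>, \<phi>) \<in> chart n \<rho> \<longleftrightarrow> \<phi> u \<noteq> 0" if p: "(\<gamma>, \<phi>) \<in> chart n \<sigma>" for \<gamma> \<phi>
  proof -
    have f: "face n \<gamma> \<sigma>" "\<phi> \<in> orbit n \<gamma>" using p unfolding chart_def by auto
    have "\<phi> u \<noteq> 0 \<longleftrightarrow> (\<forall>x\<in>\<gamma>. rvec u \<bullet> x = 0)"
      using chart_character_zero_iff[OF p] u(1) unfolding perp_lattice_def dual_monoid_def by auto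
    also have "\<dots> \<longleftrightarrow> \<gamma> \<subseteq> \<rho>" using face_subset[OF f(1)] u(2) by blast
    also have "\<dots> \<longleftrightarrow> face n \<gamma> \<rho>" using fan_face_iff[OF fan \<rho> \<sigma> f(1)] by blast
    finally show ?thesis using f(2) unfolding chart_def by auto
  qed
  then have "chart n \<rho> \<inter> chart n \<sigma> = {p \<in> chart n \<sigma>. snd p u \<noteq> 0}" by auto
  then show ?thesis using u that by blast
qed

lemma openin_chart:
  assumes fan: "rational_fan n \<Delta>" and \<rho>: "\<rho> \<in> \<Delta>"
  shows "openin (toric_topology n \<Delta>) (chart n \<rho>)"
  unfolding openin_toric_topology
proof (intro conjI ballI)
  show "chart n \<rho> \<subseteq> (\<Union>\<sigma>\<in>\<Delta>. chart n \<sigma>)" using \<rho> by blast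
  fix \<sigma> assume \<sigma>: "\<sigma> \<in> \<Delta>"
  obtain u where u: "u \<in> dual_monoid n \<sigma>" "\<sigma> \<inter> \<rho> = {x \<in> \<sigma>. rvec u \<bullet> x = 0}"
    "chart n \<rho> \<inter> chart n \<sigma> = {p \<in> chart n \<sigma>. snd p u \<noteq> 0}"
    by (rule chart_intersection_functional[OF fan \<rho> \<sigma>])
  show "openin (zariski (chart n \<sigma>) (chart_ring n \<sigma>)) (chart n \<rho> \<inter> chart n \<sigma>)"
    unfolding u(3) by (rule openin_zariski_basic[OF monomial_in_chart_ring[OF u(1)]])
qed

text \<open>
  Regularity has to be shown on every chart. On the chart of another cone \<open>\<sigma>\<close> the denominator is
  a power of the function \<open>\<chi>\<^sup>u\<close> whose nonvanishing set is the intersection of the two charts.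
\<close>

lemma character_toric_regular:
  assumes fan: "rational_fan n \<Delta>" and \<rho>: "\<rho> \<in> \<Delta>" and a: "a \<in> dual_monoid n \<rho>"
  shows "(\<lambda>p. snd p a) \<in> toric_regular n \<Delta> (chart n \<rho>)"
  unfolding toric_regular_def
proof (intro CollectI ballI)
  fix \<sigma> assume \<sigma>: "\<sigma> \<in> \<Delta>"
  obtain u where u: "u \<in> dual_monoid n \<sigma>" "\<sigma> \<inter> \<rho> = {x \<in> \<sigma>. rvec u \<bullet> x = 0}"
    "chart n \<rho> \<inter> chart n \<sigma> = {p \<in> chart n \<sigma>. snd p u \<noteq> 0}"
    by (rule chart_intersection_functional[OF fan \<rho> \<sigma>])
  have cone: "rational_cone n \<sigma>" using fan \<sigma> unfolding rational_fan_def by auto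
  note \<sigma>c = cone_subset_carrier[OF cone]
  have c: "a \<in> carrier_vec n" "u \<in> carrier_vec n" using a u unfolding dual_monoid_def by auto
  have "a \<in> dual_monoid n {x \<in> \<sigma>. rvec u \<bullet> x = 0}"
    using a unfolding u(2)[symmetric] dual_monoid_def by auto
  from dual_monoid_extend_from_face[OF cone u(1) this] obtain k :: nat
      where k: "a + int k \<cdot>\<^sub>v u \<in> dual_monoid n \<sigma>"
    by blast
  have ku: "int k \<cdot>\<^sub>v u \<in> dual_monoid n \<sigma>"
  proof -
    have "rvec (int k \<cdot>\<^sub>v u) \<bullet> x = real k * (rvec u \<bullet> x)" if "x \<in> \<sigma>" for x
    proof -
      have "rvec (int k \<cdot>\<^sub>v u) = real k \<cdot>\<^sub>v rvec u" by (intro eq_vecI) auto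
      then show ?thesis using that \<sigma>c c by (auto simp: subset_iff)
    qed
    then show ?thesis using u(1) unfolding dual_monoid_def by auto
  qed
  have nz: "snd p (int k \<cdot>\<^sub>v u) \<noteq> 0" if "p \<in> chart n \<rho> \<inter> chart n \<sigma>" for p
  proof -
    obtain \<gamma> \<phi> where p: "p = (\<gamma>, \<phi>)" by force
    have ch: "(\<gamma>, \<phi>) \<in> chart n \<sigma>" "\<phi> u \<noteq> 0" using that u(3) p by auto
    have \<gamma>c: "\<gamma> \<subseteq> carrier_vec n" using ch(1) face_subset \<sigma>c unfolding chart_def by blast
    have up: "u \<in> perp_lattice n \<gamma>" using chart_character_zero_iff[OF ch(1)] ch(2) by blast
    have "int k \<cdot>\<^sub>v u \<in> perp_lattice n \<gamma>"
    proof -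
      have "rvec (int k \<cdot>\<^sub>v u) = real k \<cdot>\<^sub>v rvec u" by (intro eq_vecI) auto
      then show ?thesis using up \<gamma>c c unfolding perp_lattice_def by (auto simp: subset_iff)
    qed
    then show ?thesis using chart_character_zero_iff[OF ch(1)] p by auto
  qed
  show "(\<lambda>p. snd p a) \<in> regular_on (chart_ring n \<sigma>) (chart n \<rho> \<inter> chart n \<sigma>)"
    unfolding regular_on_def
  proof (intro CollectI ballI)
    fix p assume p: "p \<in> chart n \<rho> \<inter> chart n \<sigma>"
    have "snd q a = snd q (a + int k \<cdot>\<^sub>v u) / snd q (int k \<cdot>\<^sub>v u)"
        if q: "q \<in> chart n \<rho> \<inter> chart n \<sigma>" for q
      using chart_character_add[of "fst q" "snd q" n \<sigma> a "int k \<cdot>\<^sub>v u"] q nz[OF q] c \<sigma>c by auto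
    then show "\<exists>g\<in>chart_ring n \<sigma>. \<exists>h\<in>chart_ring n \<sigma>. h p \<noteq> 0 \<and>
        (\<forall>q\<in>chart n \<rho> \<inter> chart n \<sigma>. h q \<noteq> 0 \<longrightarrow> snd q a = g q / h q)"
      using monomial_in_chart_ring[OF k] monomial_in_chart_ring[OF ku] nz[OF p]
      by (intro bexI[of _ "\<lambda>p. snd p (a + int k \<cdot>\<^sub>v u)"] bexI[of _ "\<lambda>p. snd p (int k \<cdot>\<^sub>v u)"]) auto
  qed
qed

section \<open>Monomials on the torus\<close>

definition monomial :: "complex vec \<Rightarrow> int vec \<Rightarrow> complex" where
  "monomial x v = (\<Prod>j<dim_vec v. (x $ j) powi (v $ j))"

lemma monomial_nonzero: "x \<in> big_torus m \<Longrightarrow> v \<in> carrier_vec m \<Longrightarrow> monomial x v \<noteq> 0"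
  unfolding monomial_def big_torus_def by auto

lemma monomial_cw_mult:
  assumes "x \<in> carrier_vec m" "y \<in> carrier_vec m" "v \<in> carrier_vec m"
  shows "monomial (cw_mult x y) v = monomial x v * monomial y v"
proof -
  have "monomial (cw_mult x y) v = (\<Prod>j<m. (x $ j) powi (v $ j) * (y $ j) powi (v $ j))"
    using assms unfolding monomial_def cw_mult_def
    by (auto intro!: prod.cong simp: power_int_mult_distrib)
  then show ?thesis using assms unfolding monomial_def by (simp add: prod.distrib)
qed

lemma monomial_one: "monomial (vec m (\<lambda>_. 1)) v = 1" if "v \<in> carrier_vec m"
  using that unfolding monomial_def by auto

lemma cw_mult_big_torus: "x \<in> big_torus m \<Longrightarrow> y \<in> big_torus m \<Longrightarrow> cw_mult x y \<in> big_torus m"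
  unfolding big_torus_def cw_mult_def by auto

section \<open>Polynomial functions along curves\<close>

lemma poly_function_polynomial_curve:
  assumes "f \<in> poly_functions m"
  shows "\<exists>p. \<forall>t. f (vec m (\<lambda>i. poly (c i) t)) = poly p t"
  using assms
proof induction
  case (const a)
  show ?case by (rule exI[of _ "[:a:]"]) simp
next
  case (coord j)
  then show ?case by (intro exI[of _ "c j"]) simp
next
  case (add f g)
  then obtain p q where "\<forall>t. f (vec m (\<lambda>i. poly (c i) t)) = poly p t"
    "\<forall>t. g (vec m (\<lambda>i. poly (c i) t)) = poly q t" by auto
  then show ?case by (intro exI[of _ "p + q"]) simp
next
  case (mult f g)
  then obtain p q where "\<forall>t. f (vec m (\<lambda>i. poly (c i) t)) = poly p t"
    "\<forall>t. g (vec m (\<lambda>i. poly (c i) t)) = poly q t" by auto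
  then show ?case by (intro exI[of _ "p * q"]) simp
qed

text \<open>
  The exponents may be negative, so that only the product with a power of \<open>t\<close> is a polynomial.
\<close>

lemma poly_function_monomial_curve:
  assumes "f \<in> poly_functions m"
  shows "\<exists>N p. \<forall>t. t \<noteq> 0 \<longrightarrow> f (vec m (\<lambda>i. t powi (u i) * y i)) * t ^ N = poly p t"
  using assms
proof induction
  case (const a)
  show ?case by (rule exI[of _ 0], rule exI[of _ "[:a:]"]) simp
next
  case (coord j)
  have "t powi u j * y j * t ^ nat \<bar>u j\<bar> = poly (monom (y j) (nat (u j + \<bar>u j\<bar>))) t"
      if "t \<noteq> 0" for t
  proof -
    have "t powi u j * t ^ nat \<bar>u j\<bar> = t powi (u j + \<bar>u j\<bar>)"
      using that power_int_add[of t "u j" "\<bar>u j\<bar>"] by (simp add: power_int_def[of t "\<bar>u j\<bar>"])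
    also have "\<dots> = t ^ nat (u j + \<bar>u j\<bar>)" by (simp add: power_int_def)
    finally show ?thesis by (simp add: poly_monom algebra_simps)
  qed
  then show ?case using coord
    by (intro exI[of _ "nat \<bar>u j\<bar>"] exI[of _ "monom (y j) (nat (u j + \<bar>u j\<bar>))"]) simp
next
  case (add f g)
  then obtain N p M q where
    "\<forall>t. t \<noteq> 0 \<longrightarrow> f (vec m (\<lambda>i. t powi (u i) * y i)) * t ^ N = poly p t"
    "\<forall>t. t \<noteq> 0 \<longrightarrow> g (vec m (\<lambda>i. t powi (u i) * y i)) * t ^ M = poly q t" by blast
  then show ?case
    by (intro exI[of _ "N + M"] exI[of _ "p * monom 1 M + q * monom 1 N"])
       (auto simp: poly_monom power_add algebra_simps)
next
  case (mult f g)
  then obtain N p M q where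
    "\<forall>t. t \<noteq> 0 \<longrightarrow> f (vec m (\<lambda>i. t powi (u i) * y i)) * t ^ N = poly p t"
    "\<forall>t. t \<noteq> 0 \<longrightarrow> g (vec m (\<lambda>i. t powi (u i) * y i)) * t ^ M = poly q t" by blast
  then have pq: "\<And>t. t \<noteq> 0 \<Longrightarrow> f (vec m (\<lambda>i. t powi (u i) * y i)) * t ^ N = poly p t"
    "\<And>t. t \<noteq> 0 \<Longrightarrow> g (vec m (\<lambda>i. t powi (u i) * y i)) * t ^ M = poly q t" by auto
  show ?case
  proof (intro exI[of _ "N + M"] exI[of _ "p * q"] allI impI)
    fix t :: complex assume "t \<noteq> 0"
    show "f (vec m (\<lambda>i. t powi (u i) * y i)) * g (vec m (\<lambda>i. t powi (u i) * y i)) * t ^ (N + M)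
        = poly (p * q) t"
      unfolding poly_mult pq[OF \<open>t \<noteq> 0\<close>, symmetric] power_add by (simp only: ac_simps)
  qed
qed

section \<open>Regular characters of a torus\<close>

lemma poly_without_nonzero_roots:
  fixes p :: "complex poly"
  assumes "p \<noteq> 0" "\<And>z. z \<noteq> 0 \<Longrightarrow> poly p z \<noteq> 0"
  shows "\<exists>c a. c \<noteq> 0 \<and> p = monom c a"
proof -
  obtain r where r: "p = [:- 0, 1:] ^ order 0 p * r" "\<not> [:- 0, 1:] dvd r"
    using order_decomp[OF assms(1), of 0] by blast
  have "poly r z \<noteq> 0" for z
  proof (cases "z = 0")
    case True
    then show ?thesis using r(2) by (simp add: poly_eq_0_iff_dvd)
  next
    case False
    then show ?thesis using assms(2)[OF False] r(1) by (metis mult_zero_right poly_mult)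
  qed
  then have "degree r = 0"
    using fundamental_theorem_of_algebra[of r] constant_degree[of r] by auto
  then obtain c where c: "r = [:c:]" by (metis degree_eq_zeroE)
  have "p = monom c (order 0 p)" using r(1) unfolding c
    by (simp add: monom_altdef)
  moreover have "c \<noteq> 0" using assms(1) calculation by auto
  ultimately show ?thesis by blast
qed

lemma poly_eq_if_cofinite:
  fixes p q :: "complex poly"
  assumes "finite F" "\<And>t. t \<notin> F \<Longrightarrow> poly p t = poly q t"
  shows "p = q"
proof -
  have "infinite (- F)" using assms(1) by (simp add: infinite_UNIV_char_0)
  moreover have "- F \<subseteq> {t. poly (p - q) t = 0}" using assms(2) by auto
  ultimately have "p - q = 0" using poly_roots_finite finite_subset by blast
  then show ?thesis by simp
qed

lemma cancel_common_roots:
  fixes p q :: "'a::idom poly"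
  assumes "q \<noteq> 0"
  shows "\<exists>d p' q'. p = p' * d \<and> q = q' * d \<and> d \<noteq> 0 \<and> (\<forall>z. \<not> (poly p' z = 0 \<and> poly q' z = 0))"
  using assms
proof (induction "degree q" arbitrary: p q rule: less_induct)
  case less
  show ?case
  proof (cases "\<exists>z. poly p z = 0 \<and> poly q z = 0")
    case False
    then show ?thesis by (intro exI[of _ 1] exI[of _ p] exI[of _ q]) auto
  next
    case True
    then obtain z p1 q1 where z: "p = [:- z, 1:] * p1" "q = [:- z, 1:] * q1"
      by (metis dvdE poly_eq_0_iff_dvd)
    have "q1 \<noteq> 0" using z(2) less.prems by auto
    moreover from this have "degree q = Suc (degree q1)"
        unfolding z(2) by (subst degree_mult_eq) auto
    ultimately obtain d p' q' where "p1 = p' * d" "q1 = q' * d" "d \<noteq> 0"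
      "\<forall>z. \<not> (poly p' z = 0 \<and> poly q' z = 0)"
      using less.hyps[of q1 p1] by auto
    then show ?thesis unfolding z
      by (intro exI[of _ "[:- z, 1:] * d"] exI[of _ p'] exI[of _ q']) (auto simp only: ac_simps
          mult_eq_0_iff pCons_eq_0_iff one_neq_zero simp_thms)
  qed
qed

text \<open>
  Write \<open>\<phi> = p / q\<close> without common roots. Multiplicativity gives
  \<open>p(b t) q(t) = \<phi>(b) p(t) q(b t)\<close>. If \<open>q\<close> had a root \<open>z \<noteq> 0\<close>, then \<open>p\<close> would not vanish there,
  and all \<open>b z\<close> would be roots of \<open>q\<close>; likewise for \<open>p\<close>. So zero is the only root of \<open>p\<close> and
  \<open>q\<close>, both are monomials, and \<open>\<phi>\<close> is a power up to a constant and up to finitely many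
  arguments. Multiplicativity removes both exceptions.
\<close>

lemma rational_multiplicative_function_is_power:
  fixes \<phi> :: "complex \<Rightarrow> complex"
  assumes mult: "\<And>s t. s \<noteq> 0 \<Longrightarrow> t \<noteq> 0 \<Longrightarrow> \<phi> (s * t) = \<phi> s * \<phi> t"
    and nz: "\<And>t. t \<noteq> 0 \<Longrightarrow> \<phi> t \<noteq> 0"
    and q: "q \<noteq> 0" and pq: "\<And>t. t \<noteq> 0 \<Longrightarrow> poly q t \<noteq> 0 \<Longrightarrow> \<phi> t = poly p t / poly q t"
  shows "\<exists>k :: int. \<forall>t. t \<noteq> 0 \<longrightarrow> \<phi> t = t powi k"
proof -
  obtain d p' q' where c: "p = p' * d" "q = q' * d" "d \<noteq> 0"
    and common: "\<And>z. \<not> (poly p' z = 0 \<and> poly q' z = 0)"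
    using cancel_common_roots[OF q] by blast
  have q'0: "q' \<noteq> 0" using c(2) q by auto
  define F where "F = insert 0 {t. poly q t = 0}"
  have F: "finite F" unfolding F_def using poly_roots_finite[OF q] by simp
  have rel: "\<phi> t * poly q' t = poly p' t" if "t \<notin> F" for t
  proof -
    have t: "t \<noteq> 0" "poly q t \<noteq> 0" using that unfolding F_def by auto
    have g: "poly d t \<noteq> 0" "poly q' t \<noteq> 0" using t(2) c(2)
        by (metis mult_zero_left mult_zero_right poly_mult)+
    have "\<phi> t = (poly p' t * poly d t) / (poly q' t * poly d t)"
      using pq[OF t] c(1,2) by (metis poly_mult)
    then show ?thesis using g by simp
  qed
  have p'0: "p' \<noteq> 0"
  proof
    assume "p' = 0"
    have "q' = 0"
    proof (rule poly_eq_if_cofinite[OF F])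
      fix t assume t: "t \<notin> F"
      then have "\<phi> t \<noteq> 0" using nz unfolding F_def by blast
      then show "poly q' t = poly 0 t" using rel[OF t] \<open>p' = 0\<close> by simp
    qed
    then show False using q'0 by simp
  qed
  have scale: "poly p' (b * t) * poly q' t = \<phi> b * poly p' t * poly q' (b * t)"
      if b: "b \<noteq> 0" for b t
  proof -
    have "p' \<circ>\<^sub>p [:0, b:] * q' = smult (\<phi> b) (p' * (q' \<circ>\<^sub>p [:0, b:]))"
    proof (rule poly_eq_if_cofinite)
      show "finite (F \<union> (\<lambda>t. t / b) ` F)" using F by simp
      fix t assume t: "t \<notin> F \<union> (\<lambda>t. t / b) ` F"
      have bt: "b * t \<notin> F"
      proof
        assume "b * t \<in> F"
        then have "(b * t) / b \<in> (\<lambda>t. t / b) ` F" by (rule imageI)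
        then show False using t b by simp
      qed
      have "t \<noteq> 0" using t unfolding F_def by auto
      then have "\<phi> (b * t) = \<phi> b * \<phi> t" using mult b by simp
      then show "poly (p' \<circ>\<^sub>p [:0, b:] * q') t = poly (smult (\<phi> b) (p' * (q' \<circ>\<^sub>p [:0, b:]))) t"
        using rel[OF bt, symmetric] rel[of t, symmetric] t by (simp add: poly_pcompose mult.commute)
    qed
    then have "poly (p' \<circ>\<^sub>p [:0, b:] * q') t = poly (smult (\<phi> b) (p' * (q' \<circ>\<^sub>p [:0, b:]))) t"
        by simp
    then show ?thesis by (simp add: poly_pcompose mult.assoc mult.commute)
  qed
  have allroots: "r = 0" if "a \<noteq> 0" "\<And>b. b \<noteq> 0 \<Longrightarrow> poly r (b * a) = 0" for r :: "complex poly" and a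
  proof (rule poly_eq_if_cofinite[of "{0}"])
    fix t :: complex assume "t \<notin> {0}"
    then show "poly r t = poly 0 t" using that(2)[of "t / a"] that(1) by simp
  qed simp
  have "poly q' z \<noteq> 0" if "z \<noteq> 0" for z
  proof
    assume z: "poly q' z = 0"
    then have "poly p' z \<noteq> 0" using common by blast
    then have "poly q' (b * z) = 0" if "b \<noteq> 0"
        for b using scale[OF that, of z] z nz[OF that] by simp
    then show False using allroots[OF that, of q'] q'0 by blast
  qed
  moreover have "poly p' z \<noteq> 0" if "z \<noteq> 0" for z
  proof
    assume z: "poly p' z = 0"
    then have "poly q' z \<noteq> 0" using common by blast
    then have "poly p' (b * z) = 0" if "b \<noteq> 0" for b using scale[OF that, of z] z by simp
    then show False using allroots[OF that, of p'] p'0 by blast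
  qed
  ultimately obtain c e a l where m: "e \<noteq> 0" "q' = monom e l" "p' = monom c a" "c \<noteq> 0"
    using poly_without_nonzero_roots[OF q'0] poly_without_nonzero_roots[OF p'0] by metis
  have cof: "\<phi> t = c / e * t powi (int a - int l)" if "t \<notin> F" for t
  proof -
    have "t \<noteq> 0" using that unfolding F_def by auto
    moreover have "\<phi> t * (e * t ^ l) = c * t ^ a" using rel[OF that] m by (simp add: poly_monom)
    ultimately show ?thesis using m(1) by (simp add: power_int_diff field_simps)
  qed
  have "\<phi> t = t powi (int a - int l)" if t: "t \<noteq> 0" for t
  proof -
    have "finite (F \<union> (\<lambda>s. s / t) ` F)" using F by simp
    then obtain s where s: "s \<notin> F \<union> (\<lambda>s. s / t) ` F"
      using ex_new_if_finite[OF infinite_UNIV_char_0] by blast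
    have ts: "t * s \<notin> F"
    proof
      assume "t * s \<in> F"
      then have "(t * s) / t \<in> (\<lambda>s. s / t) ` F" by (rule imageI)
      then show False using s t by simp
    qed
    have s0: "s \<notin> F" "s \<noteq> 0" using s unfolding F_def by auto
    have "c / e * (t * s) powi (int a - int l) = \<phi> t * (c / e * s powi (int a - int l))"
      using mult[OF t s0(2)] cof[OF ts] cof[OF s0(1)] by simp
    then show ?thesis using m s0(2) by (simp add: power_int_mult_distrib)
  qed
  then show ?thesis by blast
qed

text \<open>
  The torus is the product of its coordinate axes, so a character is determined by its
  restrictions to them. A quotient of polynomials that represents \<open>\<phi>\<close> near the unit element
  restricts to a rational function on each axis, whose denominator is not the zero polynomial.
\<close>

lemma regular_torus_character_is_monomial:
  assumes reg: "\<phi> \<in> regular_on (poly_functions m) W" and W: "big_torus m \<subseteq> W"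
    and mult: "\<And>x y. x \<in> big_torus m \<Longrightarrow> y \<in> big_torus m \<Longrightarrow> \<phi> (cw_mult x y) = \<phi> x * \<phi> y"
    and nz: "\<And>x. x \<in> big_torus m \<Longrightarrow> \<phi> x \<noteq> 0"
  shows "\<exists>v\<in>carrier_vec m. \<forall>x\<in>big_torus m. \<phi> x = monomial x v"
proof -
  define one where "one = vec m (\<lambda>_. 1 :: complex)"
  have one: "one \<in> big_torus m" unfolding one_def big_torus_def by auto
  have "one \<in> W" using one W by auto
  then obtain g h where gh: "g \<in> poly_functions m" "h \<in> poly_functions m" "h one \<noteq> 0"
    "\<And>x. x \<in> W \<Longrightarrow> h x \<noteq> 0 \<Longrightarrow> \<phi> x = g x / h x"
    using reg unfolding regular_on_def by blast
  define ax where "ax j t = vec m (\<lambda>i. if i = j then t else 1)" for j and t :: complex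
  have ax: "ax j t \<in> big_torus m" if "t \<noteq> 0" for j t
      using that unfolding ax_def big_torus_def by auto
  have "\<exists>k. \<forall>t. t \<noteq> 0 \<longrightarrow> \<phi> (ax j t) = t powi k" if j: "j < m" for j
  proof -
    define c where "c i = (if i = j then [:0, 1:] else [:1 :: complex:])" for i
    have axc: "ax j t = vec m (\<lambda>i. poly (c i) t)" for t
      unfolding ax_def c_def by (intro eq_vecI) auto
    obtain p q where p: "\<And>t. g (ax j t) = poly p t" and q: "\<And>t. h (ax j t) = poly q t"
      using poly_function_polynomial_curve[OF gh(1), of c] poly_function_polynomial_curve[OF
          gh(2), of c]
      unfolding axc by blast
    have "ax j 1 = one" unfolding ax_def one_def by (intro eq_vecI) auto
    then have "q \<noteq> 0" using q[of 1] gh(3) by auto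
    show ?thesis
    proof (rule rational_multiplicative_function_is_power[OF _ _ \<open>q \<noteq> 0\<close>])
      fix s t :: complex assume "s \<noteq> 0" "t \<noteq> 0"
      moreover have "ax j (s * t) = cw_mult (ax j s) (ax j t)"
        unfolding ax_def cw_mult_def by (intro eq_vecI) auto
      ultimately show "\<phi> (ax j (s * t)) = \<phi> (ax j s) * \<phi> (ax j t)" using mult ax by simp
    next
      fix t :: complex assume "t \<noteq> 0" "poly q t \<noteq> 0"
      then show "\<phi> (ax j t) = poly p t / poly q t"
        using gh(4)[of "ax j t"] p q ax[of t j] W by auto
    qed (use nz ax in auto)
  qed
  then obtain k where k: "\<And>j t. j < m \<Longrightarrow> t \<noteq> 0 \<Longrightarrow> \<phi> (ax j t) = t powi (k j)" by metis
  have one1: "\<phi> one = 1"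
  proof -
    have "cw_mult one one = one" unfolding one_def cw_mult_def by auto
    then show ?thesis using mult[OF one one] nz[OF one] by simp
  qed
  have "\<phi> x = monomial x (vec m k)" if x: "x \<in> big_torus m" for x
  proof -
    have x0: "x $ j \<noteq> 0" if "j < m" for j using x that unfolding big_torus_def by auto
    have "\<phi> (vec m (\<lambda>i. if i < l then x $ i else 1)) = (\<Prod>j<l. (x $ j) powi k j)" if "l \<le> m" for l
      using that
    proof (induction l)
      case 0
      then show ?case using one1 unfolding one_def by simp
    next
      case (Suc l)
      have "vec m (\<lambda>i. if i < Suc l then x $ i else 1) =
          cw_mult (vec m (\<lambda>i. if i < l then x $ i else 1)) (ax l (x $ l))"
        unfolding ax_def cw_mult_def by (intro eq_vecI) auto
      moreover have "vec m (\<lambda>i. if i < l then x $ i else 1) \<in> big_torus m"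
        using x0 unfolding big_torus_def by auto
      ultimately show ?case using Suc mult ax[OF x0[of l], of l] k x0 by simp
    qed
    from this[of m] have "\<phi> (vec m (\<lambda>i. if i < m then x $ i else 1)) = monomial x (vec m k)"
      unfolding monomial_def by simp
    moreover have "vec m (\<lambda>i. if i < m then x $ i else 1) = x"
      using x unfolding big_torus_def by (intro eq_vecI) auto
    ultimately show ?thesis by simp
  qed
  then show ?thesis by (intro bexI[of _ "vec m k"]) auto
qed

section \<open>Torus points separate lattices\<close>

definition subgroup_vec :: "nat \<Rightarrow> int vec set \<Rightarrow> bool" where
  "subgroup_vec m H \<longleftrightarrow> H \<subseteq> carrier_vec m \<and> 0\<^sub>v m \<in> H \<and> (\<forall>a\<in>H. \<forall>b\<in>H. a - b \<in> H)"

text \<open>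
  Only the values on \<open>H\<close> matter. Compatibility with differences encodes a homomorphism in one
  equation.
\<close>

definition character_on :: "int vec set \<Rightarrow> (int vec \<Rightarrow> complex) \<Rightarrow> bool" where
  "character_on H \<chi> \<longleftrightarrow> (\<forall>a\<in>H. \<chi> a \<noteq> 0) \<and> (\<forall>a\<in>H. \<forall>b\<in>H. \<chi> (a - b) = \<chi> a / \<chi> b)"

lemma subgroup_vec_add:
  assumes "subgroup_vec m H" "a \<in> H" "b \<in> H" shows "a + b \<in> H"
proof -
  have c: "a \<in> carrier_vec m" "b \<in> carrier_vec m" using assms unfolding subgroup_vec_def by auto
  have "a - (0\<^sub>v m - b) \<in> H" using assms unfolding subgroup_vec_def by auto
  also have "a - (0\<^sub>v m - b) = a + b" using c by (intro eq_vecI) auto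
  finally show ?thesis .
qed

lemma subgroup_vec_smult:
  assumes H: "subgroup_vec m H" and a: "a \<in> H" shows "k \<cdot>\<^sub>v a \<in> H"
proof -
  have c: "a \<in> carrier_vec m" using assms unfolding subgroup_vec_def by auto
  have nat: "int i \<cdot>\<^sub>v a \<in> H" for i
  proof (induction i)
    case 0
    have "int 0 \<cdot>\<^sub>v a = 0\<^sub>v m" using c by (intro eq_vecI) auto
    then show ?case using H unfolding subgroup_vec_def by simp
  next
    case (Suc i)
    have "int (Suc i) \<cdot>\<^sub>v a = int i \<cdot>\<^sub>v a + a" using c by (intro eq_vecI) (auto simp: algebra_simps)
    then show ?case using subgroup_vec_add[OF H Suc.IH a] by (simp only:)
  qed
  show ?thesis
  proof (cases "0 \<le> k")
    case True
    then show ?thesis using nat[of "nat k"] by simp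
  next
    case False
    have "k \<cdot>\<^sub>v a = 0\<^sub>v m - int (nat (- k)) \<cdot>\<^sub>v a" using c False by (intro eq_vecI) auto
    then show ?thesis using H nat[of "nat (- k)"] unfolding subgroup_vec_def by metis
  qed
qed

lemma character_on_zero:
  assumes "subgroup_vec m H" "character_on H \<chi>" shows "\<chi> (0\<^sub>v m) = 1"
proof -
  have 0: "0\<^sub>v m \<in> H" using assms unfolding subgroup_vec_def by auto
  have "\<chi> (0\<^sub>v m - 0\<^sub>v m) = \<chi> (0\<^sub>v m) / \<chi> (0\<^sub>v m)" using assms 0 unfolding character_on_def by blast
  then show ?thesis using assms 0 unfolding character_on_def by auto
qed

lemma character_on_add:
  assumes "subgroup_vec m H" "character_on H \<chi>" "a \<in> H" "b \<in> H"
  shows "\<chi> (a + b) = \<chi> a * \<chi> b"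
proof -
  have c: "a \<in> carrier_vec m" "b \<in> carrier_vec m" using assms unfolding subgroup_vec_def by auto
  have 0: "0\<^sub>v m \<in> H" "0\<^sub>v m - b \<in> H" using assms unfolding subgroup_vec_def by auto
  have "\<chi> (a - (0\<^sub>v m - b)) = \<chi> a / (\<chi> (0\<^sub>v m) / \<chi> b)"
    using assms 0 unfolding character_on_def by metis
  also have "a - (0\<^sub>v m - b) = a + b" using c by (intro eq_vecI) auto
  finally show ?thesis using character_on_zero[OF assms(1,2)] by simp
qed

lemma character_on_smult:
  assumes H: "subgroup_vec m H" and \<chi>: "character_on H \<chi>" and a: "a \<in> H"
  shows "\<chi> (k \<cdot>\<^sub>v a) = \<chi> a powi k"
proof -
  have c: "a \<in> carrier_vec m" using assms unfolding subgroup_vec_def by auto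
  have nat: "\<chi> (int i \<cdot>\<^sub>v a) = \<chi> a ^ i" for i
  proof (induction i)
    case 0
    have "int 0 \<cdot>\<^sub>v a = 0\<^sub>v m" using c by (intro eq_vecI) auto
    then show ?case using character_on_zero[OF H \<chi>] by simp
  next
    case (Suc i)
    have "int (Suc i) \<cdot>\<^sub>v a = int i \<cdot>\<^sub>v a + a" using c by (intro eq_vecI) (auto simp: algebra_simps)
    then show ?case using character_on_add[OF H \<chi> subgroup_vec_smult[OF H a] a] Suc.IH
        by (simp only: power_Suc2)
  qed
  show ?thesis
  proof (cases "0 \<le> k")
    case True
    then show ?thesis using nat[of "nat k"] by (simp add: power_int_def)
  next
    case False
    have "k \<cdot>\<^sub>v a = 0\<^sub>v m - int (nat (- k)) \<cdot>\<^sub>v a" using c False by (intro eq_vecI) auto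
    then have "\<chi> (k \<cdot>\<^sub>v a) = \<chi> (0\<^sub>v m) / \<chi> (int (nat (- k)) \<cdot>\<^sub>v a)"
      using \<chi> H subgroup_vec_smult[OF H a] unfolding character_on_def subgroup_vec_def by metis
    then show ?thesis using character_on_zero[OF H \<chi>] nat[of "nat (- k)"] False
      by (simp add: power_int_def inverse_eq_divide power_divide)
  qed
qed

text \<open>
  The hypothesis on \<open>\<zeta>\<close> says that \<open>k \<cdot> g \<mapsto> \<zeta>\<^sup>k\<close> agrees with \<open>\<chi>\<close> where both are defined. This is
  what makes \<open>h + k \<cdot> g \<mapsto> \<chi>(h) \<zeta>\<^sup>k\<close> well defined.
\<close>

lemma extend_character_with_value:
  assumes H: "subgroup_vec m H" and \<chi>: "character_on H \<chi>" and g: "g \<in> carrier_vec m"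
    and \<zeta>: "\<zeta> \<noteq> 0" "\<And>k. k \<cdot>\<^sub>v g \<in> H \<Longrightarrow> \<zeta> powi k = \<chi> (k \<cdot>\<^sub>v g)"
  shows "\<exists>H' \<chi>'. subgroup_vec m H' \<and> character_on H' \<chi>' \<and> H \<subseteq> H' \<and> g \<in> H' \<and>
    (\<forall>a\<in>H. \<chi>' a = \<chi> a) \<and> \<chi>' g = \<zeta>"
proof -
  define H' where "H' = {h + k \<cdot>\<^sub>v g |h k. h \<in> H}"
  define P where "P w z \<longleftrightarrow> (\<exists>h k. h \<in> H \<and> w = h + k \<cdot>\<^sub>v g \<and> z = \<chi> h * \<zeta> powi k)" for w z
  define \<chi>' where "\<chi>' w = (SOME z. P w z)" for w
  have Hc: "h \<in> carrier_vec m" if "h \<in> H" for h using H that unfolding subgroup_vec_def by auto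
  have H0: "0\<^sub>v m \<in> H" and Hm: "\<And>a b. a \<in> H \<Longrightarrow> b \<in> H \<Longrightarrow> a - b \<in> H"
    using H unfolding subgroup_vec_def by auto
  have val: "\<chi>' (h + k \<cdot>\<^sub>v g) = \<chi> h * \<zeta> powi k" if h: "h \<in> H" for h k
  proof -
    have "P (h + k \<cdot>\<^sub>v g) (\<chi> h * \<zeta> powi k)" unfolding P_def using h by blast
    then have "P (h + k \<cdot>\<^sub>v g) (\<chi>' (h + k \<cdot>\<^sub>v g))" unfolding \<chi>'_def by (rule someI)
    then obtain h' k' where h': "h' \<in> H" "h + k \<cdot>\<^sub>v g = h' + k' \<cdot>\<^sub>v g"
      "\<chi>' (h + k \<cdot>\<^sub>v g) = \<chi> h' * \<zeta> powi k'" unfolding P_def by blast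
    have "h - h' = (k' - k) \<cdot>\<^sub>v g"
    proof (rule eq_vecI)
      fix i assume "i < dim_vec ((k' - k) \<cdot>\<^sub>v g)"
      then have i: "i < m" using g by auto
      have "(h + k \<cdot>\<^sub>v g) $ i = (h' + k' \<cdot>\<^sub>v g) $ i" using h'(2) by simp
      then show "(h - h') $ i = ((k' - k) \<cdot>\<^sub>v g) $ i"
        using i g Hc[OF h] Hc[OF h'(1)] by (auto simp: algebra_simps)
    qed (use g Hc[OF h] Hc[OF h'(1)] in auto)
    then have "\<chi> h / \<chi> h' = \<zeta> powi (k' - k)"
      using \<zeta>(2)[of "k' - k"] Hm[OF h h'(1)] \<chi> h h'(1) unfolding character_on_def by metis
    moreover have "\<chi> h' \<noteq> 0" using \<chi> h'(1) unfolding character_on_def by auto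
    ultimately show ?thesis using h'(3) \<zeta>(1) by (simp add: power_int_diff field_simps)
  qed
  have sub: "(h + k \<cdot>\<^sub>v g) - (h' + k' \<cdot>\<^sub>v g) = (h - h') + (k - k') \<cdot>\<^sub>v g"
    if "h \<in> H" "h' \<in> H" for h h' k k'
    using Hc[OF that(1)] Hc[OF that(2)] g by (intro eq_vecI) (auto simp: algebra_simps)
  have embed: "a + 0 \<cdot>\<^sub>v g = a" if "a \<in> H" for a using Hc[OF that] g by (intro eq_vecI) auto
  have g': "0\<^sub>v m + 1 \<cdot>\<^sub>v g = g" using g by (intro eq_vecI) auto
  have mem: "h + k \<cdot>\<^sub>v g \<in> H'" if "h \<in> H" for h k using that unfolding H'_def by blast
  have HH': "H \<subseteq> H'"
  proof
    fix a assume a: "a \<in> H"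
    show "a \<in> H'" using mem[OF a, of 0] embed[OF a] by simp
  qed
  have "subgroup_vec m H'"
    unfolding subgroup_vec_def
  proof (intro conjI ballI)
    show "H' \<subseteq> carrier_vec m" unfolding H'_def using Hc g by auto
    show "0\<^sub>v m \<in> H'" using HH' H0 by blast
    fix a b assume "a \<in> H'" "b \<in> H'"
    then obtain h k h' k' where "a = h + k \<cdot>\<^sub>v g" "b = h' + k' \<cdot>\<^sub>v g" "h \<in> H" "h' \<in> H"
      unfolding H'_def by blast
    then show "a - b \<in> H'" unfolding H'_def using sub Hm by blast
  qed
  moreover have "character_on H' \<chi>'"
    unfolding character_on_def
  proof (intro conjI ballI)
    fix a assume "a \<in> H'"
    then obtain h k where a: "a = h + k \<cdot>\<^sub>v g" "h \<in> H" unfolding H'_def by blast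
    show "\<chi>' a \<noteq> 0" using val a \<chi> \<zeta>(1) unfolding character_on_def by auto
    fix b assume "b \<in> H'"
    then obtain h' k' where b: "b = h' + k' \<cdot>\<^sub>v g" "h' \<in> H" unfolding H'_def by blast
    have "\<chi> (h - h') = \<chi> h / \<chi> h'" using \<chi> a b unfolding character_on_def by auto
    then show "\<chi>' (a - b) = \<chi>' a / \<chi>' b"
      unfolding a(1) b(1) sub[OF a(2) b(2)] val[OF a(2)] val[OF b(2)] val[OF Hm[OF a(2) b(2)]]
      using \<zeta>(1) by (simp add: power_int_diff)
  qed
  moreover note HH'
  moreover have "g \<in> H'" using mem[OF H0, of 1] g' by simp
  moreover have "\<forall>a\<in>H. \<chi>' a = \<chi> a" using val[of _ 0] embed by auto
  moreover have "\<chi>' g = \<zeta>" using val[OF H0, of 1] g' character_on_zero[OF H \<chi>] by simp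
  ultimately show ?thesis by blast
qed

text \<open>
  The integers \<open>k\<close> with \<open>k \<cdot> g \<in> H\<close> form an ideal, which is zero or generated by some \<open>d > 0\<close>.
\<close>

lemma stabilizer_multiples:
  assumes H: "subgroup_vec m H" and g: "g \<in> carrier_vec m"
  obtains "\<And>k. k \<cdot>\<^sub>v g \<in> H \<Longrightarrow> k = 0"
  | d :: nat where "0 < d" "\<And>k. k \<cdot>\<^sub>v g \<in> H \<longleftrightarrow> int d dvd k"
proof (cases "\<exists>k. k \<noteq> 0 \<and> k \<cdot>\<^sub>v g \<in> H")
  case False
  then show ?thesis using that(1) by blast
next
  case True
  have neg: "(- k) \<cdot>\<^sub>v g \<in> H" if "k \<cdot>\<^sub>v g \<in> H" for k
    using subgroup_vec_smult[OF H that, of "-1"] by (simp add: smult_smult_assoc)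
  have "\<exists>i :: nat. 0 < i \<and> int i \<cdot>\<^sub>v g \<in> H"
  proof -
    obtain k where "k \<noteq> 0" "k \<cdot>\<^sub>v g \<in> H" using True by blast
    then show ?thesis using neg[of k] by (cases "0 < k") (auto intro!: exI[of _ "nat \<bar>k\<bar>"])
  qed
  then obtain d where d: "0 < d" "int d \<cdot>\<^sub>v g \<in> H"
    and least: "\<And>i. i < d \<Longrightarrow> \<not> (0 < i \<and> int i \<cdot>\<^sub>v g \<in> H)"
    using exists_least_iff[of "\<lambda>i. 0 < i \<and> int i \<cdot>\<^sub>v g \<in> H"] by blast
  have "int d dvd k" if k: "k \<cdot>\<^sub>v g \<in> H" for k
  proof (rule ccontr)
    assume "\<not> int d dvd k"
    then have "k mod int d \<noteq> 0" by (metis mod_0_imp_dvd)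
    moreover have "0 \<le> k mod int d" using d(1) by simp
    ultimately have pos: "0 < k mod int d" by linarith
    have "k \<cdot>\<^sub>v g - (k div int d) \<cdot>\<^sub>v (int d \<cdot>\<^sub>v g) \<in> H"
      using k subgroup_vec_smult[OF H d(2)] H unfolding subgroup_vec_def by blast
    also have "k \<cdot>\<^sub>v g - (k div int d) \<cdot>\<^sub>v (int d \<cdot>\<^sub>v g) = (k mod int d) \<cdot>\<^sub>v g"
      using g by (intro eq_vecI) (auto simp: minus_div_mult_eq_mod[symmetric] algebra_simps)
    finally have "int (nat (k mod int d)) \<cdot>\<^sub>v g \<in> H" using pos by simp
    moreover have "nat (k mod int d) < d" using d(1) by (simp add: nat_less_iff)
    ultimately show False using least[of "nat (k mod int d)"] pos by simp
  qed
  moreover have "k \<cdot>\<^sub>v g \<in> H" if "int d dvd k" for k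
  proof -
    obtain l where "k = int d * l" using \<open>int d dvd k\<close> by (rule dvdE)
    then have "k = l * int d" by simp
    then show ?thesis using subgroup_vec_smult[OF H d(2), of l] by (simp add: smult_smult_assoc)
  qed
  ultimately show ?thesis using that(2) d(1) by blast
qed

lemma complex_root_exists:
  fixes z :: complex
  assumes "0 < d" "z \<noteq> 0" shows "\<exists>\<zeta>. \<zeta> \<noteq> 0 \<and> \<zeta> ^ d = z"
proof -
  define \<zeta> where "\<zeta> = rcis (root d (cmod z)) (Arg z / real d)"
  have "\<zeta> ^ d = rcis (cmod z) (Arg z)"
    using assms by (simp add: \<zeta>_def DeMoivre2)
  then have "\<zeta> ^ d = z" by (simp add: rcis_cmod_Arg)
  moreover from this have "\<zeta> \<noteq> 0" using assms by auto
  ultimately show ?thesis by blast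
qed

text \<open>
  Divisibility of \<open>\<complex>\<^sup>*\<close>: if \<open>d \<cdot> g\<close> is the first multiple of \<open>g\<close> in \<open>H\<close>, any \<open>d\<close>-th root of its
  value will do.
\<close>

lemma extend_character:
  assumes H: "subgroup_vec m H" and \<chi>: "character_on H \<chi>" and g: "g \<in> carrier_vec m"
  shows "\<exists>H' \<chi>'. subgroup_vec m H' \<and> character_on H' \<chi>' \<and> H \<subseteq> H' \<and> g \<in> H' \<and> (\<forall>a\<in>H. \<chi>' a = \<chi> a)"
proof -
  have "\<exists>\<zeta>. \<zeta> \<noteq> 0 \<and> (\<forall>k. k \<cdot>\<^sub>v g \<in> H \<longrightarrow> \<zeta> powi k = \<chi> (k \<cdot>\<^sub>v g))"
  proof (cases rule: stabilizer_multiples[OF H g])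
    case 1
    have "0 \<cdot>\<^sub>v g = 0\<^sub>v m" using g by (intro eq_vecI) auto
    then have "\<chi> (k \<cdot>\<^sub>v g) = 1" if "k \<cdot>\<^sub>v g \<in> H" for k
      using 1[OF that] character_on_zero[OF H \<chi>] by simp
    then show ?thesis by (intro exI[of _ 1]) simp
  next
    case (2 d)
    have dg: "int d \<cdot>\<^sub>v g \<in> H" using 2 by auto
    then have "\<chi> (int d \<cdot>\<^sub>v g) \<noteq> 0" using \<chi> unfolding character_on_def by auto
    then obtain \<zeta> where z: "\<zeta> \<noteq> 0" "\<zeta> ^ d = \<chi> (int d \<cdot>\<^sub>v g)" using complex_root_exists 2(1) by blast
    have "\<zeta> powi k = \<chi> (k \<cdot>\<^sub>v g)" if "k \<cdot>\<^sub>v g \<in> H" for k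
    proof -
      have "int d dvd k" using that 2(2) by blast
      then obtain l where "k = int d * l" by (rule dvdE)
      then have l: "k = l * int d" by simp
      have "\<chi> (k \<cdot>\<^sub>v g) = \<chi> (int d \<cdot>\<^sub>v g) powi l"
        using character_on_smult[OF H \<chi> dg, of l] l by (simp add: smult_smult_assoc)
      also have "\<dots> = \<zeta> powi (int d * l)" unfolding z(2)[symmetric] by (simp add: power_int_mult)
      finally show ?thesis using l by (simp add: mult.commute)
    qed
    then show ?thesis using z(1) by blast
  qed
  then show ?thesis using extend_character_with_value[OF H \<chi> g] by blast
qed

lemma character_is_evaluation:
  assumes H: "subgroup_vec m H" and \<chi>: "character_on H \<chi>" and units: "\<And>j. j < m \<Longrightarrow> unit_vec m j \<in> H"
    and w: "w \<in> carrier_vec m"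
  shows "\<chi> w = monomial (vec m (\<lambda>j. \<chi> (unit_vec m j))) w" "w \<in> H"
proof -
  have *: "vec m (\<lambda>i. if i < k then w $ i else 0) \<in> H \<and>
    \<chi> (vec m (\<lambda>i. if i < k then w $ i else 0)) = (\<Prod>j<k. \<chi> (unit_vec m j) powi (w $ j))"
        if "k \<le> m" for k
    using that
  proof (induction k)
    case 0
    have "vec m (\<lambda>i. if i < 0 then w $ i else 0) = 0\<^sub>v m" by auto
    then show ?case using H character_on_zero[OF H \<chi>] unfolding subgroup_vec_def by simp
  next
    case (Suc k)
    have k: "k < m" using Suc.prems by simp
    have "vec m (\<lambda>i. if i < Suc k then w $ i else 0) =
      vec m (\<lambda>i. if i < k then w $ i else 0) + w $ k \<cdot>\<^sub>v unit_vec m k"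
      using k w by (intro eq_vecI) (auto simp: less_Suc_eq)
    moreover note IH = Suc.IH[OF less_imp_le[OF k]] subgroup_vec_smult[OF H units[OF k], of "w $ k"]
    ultimately show ?case
      using subgroup_vec_add[OF H] character_on_add[OF H \<chi>] IH character_on_smult[OF H \<chi> units[OF
          k]]
      by simp
  qed
  have e: "vec m (\<lambda>i. if i < m then w $ i else 0) = w" using w by (intro eq_vecI) auto
  show "w \<in> H" using *[of m] e by simp
  show "\<chi> w = monomial (vec m (\<lambda>j. \<chi> (unit_vec m j))) w"
    using *[of m] e w unfolding monomial_def by simp
qed

lemma primitive_root_of_unity_exists:
  assumes "0 < d"
  shows "\<exists>\<zeta> :: complex. \<zeta> \<noteq> 0 \<and> (\<forall>k :: int. \<zeta> powi k = 1 \<longleftrightarrow> int d dvd k)"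
proof (intro exI[of _ "cis (2 * pi / real d)"] conjI allI)
  fix k :: int
  have "cis (2 * pi / real d) powi k = 1 \<longleftrightarrow> cos (of_int k * (2 * pi / real d)) = 1"
    unfolding cis_power_int by (auto simp: complex_eq_iff intro: cos_one_sin_zero simp del:
        times_divide_eq_right)
  also have "\<dots> \<longleftrightarrow> (\<exists>x :: int. of_int k * (2 * pi / real d) = of_int x * 2 * pi)"
    by (rule cos_one_2pi_int)
  also have "\<dots> \<longleftrightarrow> (\<exists>x :: int. k = int d * x)"
  proof (intro ex_cong1)
    fix x :: int
    have "of_int k * (2 * pi / real d) = of_int x * 2 * pi \<longleftrightarrow> of_int k = (of_int (int d *
        x) :: real)"
      using assms by (auto simp: field_simps)
    then show "of_int k * (2 * pi / real d) = of_int x * 2 * pi \<longleftrightarrow> k = int d * x"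
      by (simp only: of_int_eq_iff)
  qed
  finally show "cis (2 * pi / real d) powi k = 1 \<longleftrightarrow> int d dvd k" unfolding dvd_def .
qed simp

text \<open>
  The trivial character of \<open>H\<close> extends to \<open>H + \<int> v\<close> with a value other than 1 at \<open>v\<close>, namely a
  root of unity if some multiple of \<open>v\<close> lies in \<open>H\<close>, and anything otherwise. It then extends
  further to the whole lattice by adjoining unit vectors one at a time, and its values at the
  unit vectors are the coordinates of the point.
\<close>

lemma torus_point_separates_lattice:
  assumes H: "subgroup_vec m H" and v: "v \<in> carrier_vec m" "v \<notin> H"
  shows "\<exists>x\<in>big_torus m. (\<forall>w\<in>H. monomial x w = 1) \<and> monomial x v \<noteq> 1"
proof -
  have triv: "character_on H (\<lambda>_. 1)" unfolding character_on_def by auto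
  have "\<exists>\<zeta> :: complex. \<zeta> \<noteq> 0 \<and> \<zeta> \<noteq> 1 \<and> (\<forall>k. k \<cdot>\<^sub>v v \<in> H \<longrightarrow> \<zeta> powi k = 1)"
  proof (cases rule: stabilizer_multiples[OF H v(1)])
    case 1
    then have "(2 :: complex) powi k = 1" if "k \<cdot>\<^sub>v v \<in> H" for k using that by fastforce
    then show ?thesis by (intro exI[of _ 2]) simp
  next
    case (2 d)
    have "d \<noteq> 1" using 2(2)[of 1] v by auto
    then have d: "1 < d" using 2(1) by auto
    obtain \<zeta> :: complex where \<zeta>: "\<zeta> \<noteq> 0" "\<And>k :: int. \<zeta> powi k = 1 \<longleftrightarrow> int d dvd k"
      using primitive_root_of_unity_exists 2(1) by blast
    have "\<zeta> \<noteq> 1" using \<zeta>(2)[of 1] d by auto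
    then show ?thesis using \<zeta> 2(2) by blast
  qed
  then obtain \<zeta> :: complex and H0 \<chi>0 where \<zeta>: "\<zeta> \<noteq> 1"
      and H0: "subgroup_vec m H0" "character_on H0 \<chi>0"
    "H \<subseteq> H0" "v \<in> H0" "\<forall>a\<in>H. \<chi>0 a = 1" "\<chi>0 v = \<zeta>"
    using extend_character_with_value[OF H triv v(1)] by blast
  have "\<exists>H' \<chi>'. subgroup_vec m H' \<and> character_on H' \<chi>' \<and> H0 \<subseteq> H' \<and> (\<forall>j<k. unit_vec m j \<in> H') \<and>
      (\<forall>a\<in>H0. \<chi>' a = \<chi>0 a)" if "k \<le> m" for k
    using that
  proof (induction k)
    case 0
    then show ?case using H0 by auto
  next
    case (Suc k)
    then obtain H1 \<chi>1 where 1: "subgroup_vec m H1" "character_on H1 \<chi>1" "H0 \<subseteq> H1"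
      "\<forall>j<k. unit_vec m j \<in> H1" "\<forall>a\<in>H0. \<chi>1 a = \<chi>0 a" by auto
    obtain H2 \<chi>2 where "subgroup_vec m H2" "character_on H2 \<chi>2" "H1 \<subseteq> H2" "unit_vec m k \<in> H2"
      "\<forall>a\<in>H1. \<chi>2 a = \<chi>1 a"
      using extend_character[OF 1(1,2), of "unit_vec m k"] by auto
    then show ?case using 1 by (intro exI[of _ H2] exI[of _ \<chi>2]) (auto simp: less_Suc_eq subset_iff)
  qed
  then obtain H' \<chi>' where ext: "subgroup_vec m H'" "character_on H' \<chi>'" "H0 \<subseteq> H'"
    "\<forall>j<m. unit_vec m j \<in> H'" "\<forall>a\<in>H0. \<chi>' a = \<chi>0 a" by blast
  define x where "x = vec m (\<lambda>j. \<chi>' (unit_vec m j))"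
  have ev: "\<chi>' w = monomial x w" if "w \<in> carrier_vec m" for w
    unfolding x_def using character_is_evaluation[OF ext(1,2) _ that] ext(4) by blast
  have "x \<in> big_torus m" using ext(2,4) unfolding x_def big_torus_def character_on_def by auto
  moreover have "monomial x w = 1" if "w \<in> H" for w
    using ev[of w] that H H0(3,5) ext(5) unfolding subgroup_vec_def by force
  moreover have "monomial x v \<noteq> 1" using ev[OF v(1)] H0(4,6) ext(5) \<zeta> by auto
  ultimately show ?thesis by blast
qed

section \<open>The quotient map on the big torus\<close>

lemma power_int_sum:
  fixes x :: "'a::field"
  assumes "x \<noteq> 0" "finite A" shows "x powi (\<Sum>i\<in>A. f i) = (\<Prod>i\<in>A. x powi f i)"
  using assms(2) by induction (simp_all add: power_int_add assms(1))

lemma prod_power_int: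
  fixes f :: "'b \<Rightarrow> 'a::field"
  shows "(\<Prod>i\<in>A. f i) powi k = (\<Prod>i\<in>A. f i powi k)"
  by (induction A rule: infinite_finite_induct) (simp_all add: power_int_mult_distrib)

lemma monomial_transpose_mult:
  assumes x: "x \<in> big_torus m" and V: "V \<in> carrier_mat n m" and a: "a \<in> carrier_vec n"
  shows "monomial x (V\<^sup>T *\<^sub>v a) = monomial (vec n (\<lambda>i. monomial x (row V i))) a"
proof -
  have x0: "x $ j \<noteq> 0" if "j < m" for j using x that unfolding big_torus_def by auto
  have "monomial x (V\<^sup>T *\<^sub>v a) = (\<Prod>j<m. x $ j powi (\<Sum>i<n. V $$ (i, j) * a $ i))"
    using V a unfolding monomial_def
    by (auto intro!: prod.cong simp: scalar_prod_def lessThan_atLeast0)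
  also have "\<dots> = (\<Prod>j<m. \<Prod>i<n. x $ j powi (V $$ (i, j) * a $ i))"
    using x0 by (intro prod.cong power_int_sum) auto
  also have "\<dots> = (\<Prod>i<n. \<Prod>j<m. x $ j powi (V $$ (i, j) * a $ i))" by (rule prod.swap)
  also have "\<dots> = (\<Prod>i<n. (\<Prod>j<m. x $ j powi (V $$ (i, j))) powi (a $ i))"
    by (simp add: prod_power_int power_int_mult)
  also have "\<dots> = monomial (vec n (\<lambda>i. monomial x (row V i))) a"
    using V a unfolding monomial_def by (auto intro!: prod.cong)
  finally show ?thesis .
qed

lemma subgroup_vec_row_lattice:
  assumes "V \<in> carrier_mat n m" shows "subgroup_vec m (row_lattice V)"
  unfolding subgroup_vec_def row_lattice_def
proof (intro conjI ballI)
  show "{V\<^sup>T *\<^sub>v a |a. a \<in> carrier_vec (dim_row V)} \<subseteq> carrier_vec m" using assms by auto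
  have "V\<^sup>T *\<^sub>v 0\<^sub>v (dim_row V) = 0\<^sub>v m" using assms by auto
  then show "0\<^sub>v m \<in> {V\<^sup>T *\<^sub>v a |a. a \<in> carrier_vec (dim_row V)}"
    by (intro CollectI exI[of _ "0\<^sub>v (dim_row V)"]) auto
  fix a b assume "a \<in> {V\<^sup>T *\<^sub>v a |a. a \<in> carrier_vec (dim_row V)}"
    "b \<in> {V\<^sup>T *\<^sub>v a |a. a \<in> carrier_vec (dim_row V)}"
  then obtain c d where "a = V\<^sup>T *\<^sub>v c" "b = V\<^sup>T *\<^sub>v d"
    "c \<in> carrier_vec n" "d \<in> carrier_vec n" using assms by auto
  moreover from this have "V\<^sup>T *\<^sub>v (c - d) = a - b"
    using assms by (simp add: mult_minus_distrib_mat_vec[of _ m n])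
  ultimately show "a - b \<in> {V\<^sup>T *\<^sub>v a |a. a \<in> carrier_vec (dim_row V)}"
    using assms by (intro CollectI exI[of _ "c - d"]) auto
qed

lemma one_poly_function: "(\<lambda>_. 1) \<in> poly_functions m" by (rule poly_functions.const)

text \<open>
  The part of a toric quotient presentation that the geometric argument works with: \<open>G\<close> is any
  set of torus elements whose orbits are the fibres of \<open>\<pi>\<close>, and \<open>Z\<close> is any locus that avoids the
  torus.
\<close>

locale torus_quotient =
  fixes n m :: nat and \<Delta> :: "real vec set set" and Z G :: "complex vec set"
    and \<pi> :: "complex vec \<Rightarrow> toric_point"
  assumes fan: "rational_fan n \<Delta>"
    and G: "G \<subseteq> big_torus m"
    and geom: "geometric_quotient
        (subtopology (zariski (carrier_vec m) (poly_functions m)) (carrier_vec m - Z))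
        (regular_on (poly_functions m)) (toric_topology n \<Delta>) (toric_regular n \<Delta>)
        {cw_mult g |g. g \<in> G} \<pi>"
    and torus_Z: "big_torus m \<inter> Z = {}"
    and torus_fst: "\<And>x. x \<in> big_torus m \<Longrightarrow> fst (\<pi> x) = {0\<^sub>v n}"
    and torus_mult: "\<And>x y a. x \<in> big_torus m \<Longrightarrow> y \<in> big_torus m \<Longrightarrow>
        snd (\<pi> (cw_mult x y)) a = snd (\<pi> x) a * snd (\<pi> y) a"
begin

abbreviation "TY \<equiv> subtopology (zariski (carrier_vec m) (poly_functions m)) (carrier_vec m - Z)"

lemma topspace_TY: "topspace TY = carrier_vec m - Z"
  using topspace_zariski[OF one_poly_function[of m], of "carrier_vec m"] by auto

lemma quotient: "quotient_map TY (toric_topology n \<Delta>) \<pi>"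
  using geom unfolding geometric_quotient_def by blast

lemma same_fibre:
  assumes "y \<in> carrier_vec m - Z" "y' \<in> carrier_vec m - Z" "\<pi> y' = \<pi> y"
  shows "\<exists>g\<in>G. y' = cw_mult g y"
proof -
  have "{y' \<in> topspace TY. \<pi> y' = \<pi> y} = {h y |h. h \<in> {cw_mult g |g. g \<in> G}}"
    using geom assms(1) topspace_TY unfolding geometric_quotient_def by blast
  then have "y' \<in> {h y |h. h \<in> {cw_mult g |g. g \<in> G}}" using assms topspace_TY by blast
  then show ?thesis by blast
qed

lemma orbit_fibre:
  assumes "y \<in> carrier_vec m - Z" "g \<in> G"
  shows "\<pi> (cw_mult g y) = \<pi> y"
proof -
  have "{y' \<in> topspace TY. \<pi> y' = \<pi> y} = {h y |h. h \<in> {cw_mult g |g. g \<in> G}}"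
    using geom assms(1) topspace_TY unfolding geometric_quotient_def by blast
  moreover have "cw_mult g y \<in> {h y |h. h \<in> {cw_mult g |g. g \<in> G}}" using assms(2) by blast
  ultimately show ?thesis by blast
qed

lemma point_in_chart:
  assumes "y \<in> carrier_vec m - Z"
  shows "fst (\<pi> y) \<in> \<Delta>" "\<pi> y \<in> chart n (fst (\<pi> y))" "snd (\<pi> y) \<in> orbit n (fst (\<pi> y))"
proof -
  have "\<pi> y \<in> topspace (toric_topology n \<Delta>)"
    using quotient assms topspace_TY unfolding quotient_map_def by blast
  moreover have "topspace (toric_topology n \<Delta>) \<subseteq> (\<Union>\<sigma>\<in>\<Delta>. chart n \<sigma>)"
    using openin_toric_topology[of n \<Delta> "topspace (toric_topology n \<Delta>)"] by auto
  ultimately obtain \<sigma> where \<sigma>: "\<sigma> \<in> \<Delta>" "\<pi> y \<in> chart n \<sigma>" by blast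
  obtain \<rho> \<phi> where p: "\<pi> y = (\<rho>, \<phi>)" by force
  have f: "face n \<rho> \<sigma>" "\<phi> \<in> orbit n \<rho>" using \<sigma>(2) p unfolding chart_def by auto
  then have \<rho>: "\<rho> \<in> \<Delta>" using fan \<sigma>(1) unfolding rational_fan_def by blast
  show "fst (\<pi> y) \<in> \<Delta>" "snd (\<pi> y) \<in> orbit n (fst (\<pi> y))" using \<rho> f p by auto
  show "\<pi> y \<in> chart n (fst (\<pi> y))" using fan_self_face[OF fan \<rho>] f p unfolding chart_def by auto
qed

lemma torus_domain: "x \<in> big_torus m \<Longrightarrow> x \<in> carrier_vec m - Z"
  using torus_Z unfolding big_torus_def by blast

abbreviation one_vec :: "complex vec" where "one_vec \<equiv> vec m (\<lambda>_. 1)"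

lemma one_vec: "one_vec \<in> big_torus m" unfolding big_torus_def by auto

text \<open>
  The torus maps to the orbit of the zero cone, so this cone must occur in the fan.
\<close>

lemma zero_cone: "{0\<^sub>v n} \<in> \<Delta>"
  using point_in_chart(1)[OF torus_domain[OF one_vec]] torus_fst[OF one_vec] by simp

lemma torus_in_chart:
  assumes "\<sigma> \<in> \<Delta>" "x \<in> big_torus m" shows "\<pi> x \<in> chart n \<sigma>"
proof -
  have "\<pi> x = ({0\<^sub>v n}, snd (\<pi> x))" using torus_fst[OF assms(2)] by (metis prod.collapse)
  moreover have "snd (\<pi> x) \<in> orbit n {0\<^sub>v n}"
    using point_in_chart(3)[OF torus_domain[OF assms(2)]] torus_fst[OF assms(2)] by simp
  moreover have "face n {0\<^sub>v n} \<sigma>"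
  proof -
    have "0\<^sub>v n \<in> \<sigma>"
    proof -
      obtain A :: "int mat" where A: "dim_row A = n" "\<sigma> = pos_cone (map_mat real_of_int A)"
        using fan assms(1) unfolding rational_fan_def rational_cone_def by blast
      have "map_mat real_of_int A *\<^sub>v 0\<^sub>v (dim_col A) = 0\<^sub>v n" using A(1) by (intro eq_vecI) auto
      then show ?thesis unfolding A(2) pos_cone_def
        by (intro CollectI exI[of _ "0\<^sub>v (dim_col A)"]) auto
    qed
    then have "\<sigma> \<inter> {0\<^sub>v n} = {0\<^sub>v n}" by blast
    then show ?thesis using fan assms(1) zero_cone unfolding rational_fan_def by metis
  qed
  ultimately show ?thesis unfolding chart_def by auto
qed

definition preimage :: "real vec set \<Rightarrow> complex vec set" where
  "preimage \<sigma> = {y \<in> carrier_vec m - Z. \<pi> y \<in> chart n \<sigma>}"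

lemma torus_preimage: "\<sigma> \<in> \<Delta> \<Longrightarrow> big_torus m \<subseteq> preimage \<sigma>"
  using torus_in_chart torus_domain unfolding preimage_def by blast

text \<open>
  In a geometric quotient the composite of \<open>\<pi>\<close> with a regular function is regular.
\<close>

lemma pullback_regular:
  assumes "\<sigma> \<in> \<Delta>" "a \<in> dual_monoid n \<sigma>"
  shows "(\<lambda>y. snd (\<pi> y) a) \<in> regular_on (poly_functions m) (preimage \<sigma>)"
proof -
  have "openin (toric_topology n \<Delta>) (chart n \<sigma>)" using openin_chart[OF fan assms(1)] .
  then have "\<forall>g. (g \<in> regular_on (poly_functions m) {y \<in> topspace TY. \<pi> y \<in> chart n \<sigma>} \<and>
      (\<forall>h\<in>{cw_mult g |g. g \<in> G}. \<forall>y\<in>{y \<in> topspace TY. \<pi> y \<in> chart n \<sigma>}. g (h y) = g y)) \<longleftrightarrow>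
      (\<exists>f\<in>toric_regular n \<Delta> (chart n \<sigma>). \<forall>y\<in>{y \<in> topspace TY. \<pi> y \<in> chart n \<sigma>}. g y = f (\<pi> y))"
    using geom unfolding geometric_quotient_def Let_def by (elim conjE allE[of _ "chart n \<sigma>"]) blast
  moreover have "\<exists>f\<in>toric_regular n \<Delta> (chart n \<sigma>).
      \<forall>y\<in>{y \<in> topspace TY. \<pi> y \<in> chart n \<sigma>}. snd (\<pi> y) a = f (\<pi> y)"
    using character_toric_regular[OF fan assms] by (intro bexI[of _ "\<lambda>p. snd p a"]) auto
  ultimately have "(\<lambda>y. snd (\<pi> y) a) \<in> regular_on (poly_functions m) {y \<in> topspace TY. \<pi> y \<in>
      chart n \<sigma>}"
    by (elim allE[of _ "\<lambda>y. snd (\<pi> y) a"]) blast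
  then show ?thesis unfolding preimage_def topspace_TY .
qed

lemma preimage_neighbourhood:
  assumes "\<sigma> \<in> \<Delta>" "y \<in> preimage \<sigma>"
  shows "\<exists>f\<in>poly_functions m. f y \<noteq> 0 \<and> (\<forall>z\<in>carrier_vec m - Z. f z \<noteq> 0 \<longrightarrow> z \<in> preimage \<sigma>)"
proof -
  have "openin TY {y \<in> topspace TY. \<pi> y \<in> chart n \<sigma>}"
    using quotient openin_chart[OF fan assms(1)] openin_subset[OF openin_chart[OF fan assms(1)]]
    unfolding quotient_map_def by blast
  then have "openin TY (preimage \<sigma>)" unfolding preimage_def topspace_TY .
  then obtain T where T: "openin (zariski (carrier_vec m) (poly_functions m)) T"
    "preimage \<sigma> = T \<inter> (carrier_vec m - Z)" unfolding openin_subtopology by blast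
  have "y \<in> T" using assms(2) T(2) by blast
  from zariski_basis[OF T(1) this one_poly_function poly_functions.mult] obtain f where
    "f \<in> poly_functions m" "f y \<noteq> 0" "{p \<in> carrier_vec m. f p \<noteq> 0} \<subseteq> T" by blast
  then show ?thesis using T(2) by blast
qed

lemma torus_orbit:
  assumes "x \<in> big_torus m"
  shows "snd (\<pi> x) a \<noteq> 0 \<longleftrightarrow> a \<in> carrier_vec n"
    and "a \<in> carrier_vec n \<Longrightarrow> b \<in> carrier_vec n \<Longrightarrow> snd (\<pi> x) (a + b) = snd (\<pi> x) a * snd (\<pi> x) b"
proof -
  have "perp_lattice n {0\<^sub>v n} = carrier_vec n" unfolding perp_lattice_def by auto
  then show "snd (\<pi> x) a \<noteq> 0 \<longleftrightarrow> a \<in> carrier_vec n"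
    "a \<in> carrier_vec n \<Longrightarrow> b \<in> carrier_vec n \<Longrightarrow> snd (\<pi> x) (a + b) = snd (\<pi> x) a * snd (\<pi> x) b"
    using point_in_chart(3)[OF torus_domain[OF assms]] torus_fst[OF assms]
        unfolding orbit_def by auto
qed

text \<open>
  On the chart of the zero cone all \<open>\<chi>\<^sup>a\<close> are regular, so their pullbacks are regular
  characters. The rows of \<open>V\<close> are the exponents for the unit vectors \<open>a\<close>; other \<open>a\<close> follow as
  \<open>\<chi>\<^sup>a\<close> is multiplicative in \<open>a\<close>.
\<close>

lemma torus_map_is_monomial:
  shows "\<exists>V\<in>carrier_mat n m. \<forall>x\<in>big_torus m. \<forall>a\<in>carrier_vec n.
    snd (\<pi> x) a = monomial x (V\<^sup>T *\<^sub>v a)"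
proof -
  have "\<exists>v\<in>carrier_vec m. \<forall>x\<in>big_torus m. snd (\<pi> x) a = monomial x v"
      if a: "a \<in> carrier_vec n" for a
  proof (rule regular_torus_character_is_monomial)
    show "(\<lambda>y. snd (\<pi> y) a) \<in> regular_on (poly_functions m) (preimage {0\<^sub>v n})"
      using a by (intro pullback_regular zero_cone) (auto simp: dual_monoid_def)
    show "big_torus m \<subseteq> preimage {0\<^sub>v n}" using torus_preimage[OF zero_cone] .
  qed (use torus_mult torus_orbit(1) a in auto)
  then obtain v where v: "\<And>a. a \<in> carrier_vec n \<Longrightarrow> v a \<in> carrier_vec m"
    "\<And>a x. a \<in> carrier_vec n \<Longrightarrow> x \<in> big_torus m \<Longrightarrow> snd (\<pi> x) a = monomial x (v a)" by metis
  define V where "V = mat n m (\<lambda>(i, j). v (unit_vec n i) $ j)"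
  have V: "V \<in> carrier_mat n m" unfolding V_def by auto
  have "snd (\<pi> x) a = monomial x (V\<^sup>T *\<^sub>v a)"
      if x: "x \<in> big_torus m" and a: "a \<in> carrier_vec n" for x a
  proof -
    have sub: "subgroup_vec n (carrier_vec n)" unfolding subgroup_vec_def by auto
    have "character_on (carrier_vec n) (snd (\<pi> x))"
      unfolding character_on_def
    proof (intro conjI ballI)
      fix a b :: "int vec" assume ab: "a \<in> carrier_vec n" "b \<in> carrier_vec n"
      then have "snd (\<pi> x) a = snd (\<pi> x) ((a - b) + b)" by (simp add: minus_add_uminus_vec)
      also have "\<dots> = snd (\<pi> x) (a - b) * snd (\<pi> x) b" using torus_orbit(2)[OF x] ab by simp
      finally show "snd (\<pi> x) (a - b) = snd (\<pi> x) a / snd (\<pi> x) b"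
        using torus_orbit(1)[OF x, of b] ab by (simp add: field_simps)
    qed (use torus_orbit(1)[OF x] in auto)
    then have "snd (\<pi> x) a = monomial (vec n (\<lambda>i. snd (\<pi> x) (unit_vec n i))) a"
      using character_is_evaluation(1)[OF sub _ _ a] by simp
    also have "vec n (\<lambda>i. snd (\<pi> x) (unit_vec n i)) = vec n (\<lambda>i. monomial x (row V i))"
    proof (rule eq_vecI)
      fix i assume i: "i < dim_vec (vec n (\<lambda>i. monomial x (row V i)))"
      have "row V i = v (unit_vec n i)" using i v(1)[of "unit_vec n i"]
          unfolding V_def by (intro eq_vecI) auto
      then show "vec n (\<lambda>i. snd (\<pi> x) (unit_vec n i)) $ i = vec n (\<lambda>i. monomial x (row V i)) $ i"
        using i v(2)[OF _ x, of "unit_vec n i"] by simp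
    qed simp
    also have "monomial (vec n (\<lambda>i. monomial x (row V i))) a = monomial x (V\<^sup>T *\<^sub>v a)"
      using monomial_transpose_mult[OF x V a] by simp
    finally show ?thesis .
  qed
  then show ?thesis using V by blast
qed

end

locale torus_quotient_exponents = torus_quotient +
  fixes V :: "int mat"
  assumes V: "V \<in> carrier_mat n m"
    and V_exponents: "\<And>x a. x \<in> big_torus m \<Longrightarrow> a \<in> carrier_vec n \<Longrightarrow>
      snd (\<pi> x) a = monomial x (V\<^sup>T *\<^sub>v a)"
begin

lemma cw_mult_one: "x \<in> carrier_vec m \<Longrightarrow> cw_mult x one_vec = x"
  unfolding cw_mult_def by auto

lemma kernel:
  assumes x: "x \<in> big_torus m"
  shows "x \<in> G \<longleftrightarrow> (\<forall>a\<in>carrier_vec n. monomial x (V\<^sup>T *\<^sub>v a) = 1)"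
proof -
  have one: "monomial one_vec (V\<^sup>T *\<^sub>v a) = 1" if "a \<in> carrier_vec n" for a
    using V that by (intro monomial_one) auto
  have xc: "x \<in> carrier_vec m" using x unfolding big_torus_def by auto
  have "x \<in> G \<longleftrightarrow> \<pi> x = \<pi> one_vec"
  proof
    assume "x \<in> G"
    then show "\<pi> x = \<pi> one_vec"
      using orbit_fibre[OF torus_domain[OF one_vec], of x] cw_mult_one[OF xc] by simp
  next
    assume "\<pi> x = \<pi> one_vec"
    then obtain g where "g \<in> G" "x = cw_mult g one_vec"
      using same_fibre[OF torus_domain[OF one_vec] torus_domain[OF x]] by blast
    moreover from this have "g \<in> carrier_vec m" using G unfolding big_torus_def by auto
    ultimately show "x \<in> G" using cw_mult_one by simp
  qed
  also have "\<dots> \<longleftrightarrow> snd (\<pi> x) = snd (\<pi> one_vec)"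
    using torus_fst[OF x] torus_fst[OF one_vec] by (metis prod.collapse)
  also have "\<dots> \<longleftrightarrow> (\<forall>a\<in>carrier_vec n. snd (\<pi> x) a = snd (\<pi> one_vec) a)"
  proof
    assume *: "\<forall>a\<in>carrier_vec n. snd (\<pi> x) a = snd (\<pi> one_vec) a"
    show "snd (\<pi> x) = snd (\<pi> one_vec)"
    proof
      fix a show "snd (\<pi> x) a = snd (\<pi> one_vec) a"
        using * torus_orbit(1)[OF x, of a] torus_orbit(1)[OF one_vec, of a]
            by (cases "a \<in> carrier_vec n") auto
    qed
  qed simp
  also have "\<dots> \<longleftrightarrow> (\<forall>a\<in>carrier_vec n. monomial x (V\<^sup>T *\<^sub>v a) = 1)"
    using V_exponents[OF x] V_exponents[OF one_vec] one by auto
  finally show ?thesis .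
qed

text \<open>
  A character outside the row lattice takes a value different from 1 at a torus point on which
  all characters of the row lattice are 1. That point is in the kernel of \<open>\<pi>\<close>, hence in \<open>G\<close>.
\<close>

lemma row_lattice_eq_annihilator:
  "row_lattice V = {v \<in> carrier_vec m. \<forall>x\<in>G. monomial x v = 1}"
proof (intro equalityI subsetI)
  fix v assume "v \<in> row_lattice V"
  then obtain a where a: "a \<in> carrier_vec n" "v = V\<^sup>T *\<^sub>v a"
    using V unfolding row_lattice_def by auto
  then show "v \<in> {v \<in> carrier_vec m. \<forall>x\<in>G. monomial x v = 1}"
    using kernel G V by auto
next
  fix v assume v: "v \<in> {v \<in> carrier_vec m. \<forall>x\<in>G. monomial x v = 1}"
  show "v \<in> row_lattice V"
  proof (rule ccontr)
    assume "v \<notin> row_lattice V"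
    then obtain x where x: "x \<in> big_torus m" "\<forall>w\<in>row_lattice V. monomial x w = 1" "monomial x v \<noteq> 1"
      using torus_point_separates_lattice[OF subgroup_vec_row_lattice[OF V]] v by blast
    have "x \<in> G" unfolding kernel[OF x(1)]
    proof
      fix a :: "int vec" assume "a \<in> carrier_vec n"
      then have "V\<^sup>T *\<^sub>v a \<in> row_lattice V" using V unfolding row_lattice_def by auto
      then show "monomial x (V\<^sup>T *\<^sub>v a) = 1" using x(2) by blast
    qed
    then show False using v x(3) by blast
  qed
qed

end

section \<open>Cones over the coordinate hyperplanes\<close>

lemma power_of_two_powi_eq_one:
  assumes "0 < k" "((2 :: complex) ^ k) powi z = 1" shows "z = 0"
proof (rule ccontr)
  assume z: "z \<noteq> 0"
  have "1 < (2 :: real) ^ k" using assms(1) by (intro one_less_power) auto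
  then have pos: "1 < ((2 :: real) ^ k) powi l"
      if "0 < l" for l using that by (rule one_less_power_int)
  have "norm (((2 :: complex) ^ k) powi z) = 1" using assms(2) by simp
  then have "((2 :: real) ^ k) powi z = 1" by (simp add: norm_power_int norm_power)
  then show False using pos[of z] pos[of "- z"] z by (cases "0 < z") (auto simp: power_int_minus)
qed

lemma collinear_if_orthogonal:
  fixes v c :: "int vec"
  assumes v: "v \<in> carrier_vec n" "v \<noteq> 0\<^sub>v n" and c: "c \<in> carrier_vec n"
    and orth: "\<And>a. a \<in> carrier_vec n \<Longrightarrow> v \<bullet> a = 0 \<Longrightarrow> c \<bullet> a = 0"
  shows "\<exists>r :: real. rvec c = r \<cdot>\<^sub>v rvec v"
proof -
  obtain p where p: "p < n" "v $ p \<noteq> 0" using v by (metis eq_vecI carrier_vecD index_zero_vec)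
  have "v $ p * c $ q = v $ q * c $ p" if q: "q < n" for q
  proof -
    \<comment> \<open>The vectors of this form span the orthogonal complement of \<open>v\<close>.\<close>
    define a where "a = v $ p \<cdot>\<^sub>v unit_vec n q - v $ q \<cdot>\<^sub>v unit_vec n p"
    have dot: "w \<bullet> a = v $ p * w $ q - v $ q * w $ p" if "w \<in> carrier_vec n" for w
      unfolding a_def using that p q by (subst scalar_prod_minus_distrib[of _ n]) auto
    have "v \<bullet> a = 0" using dot[OF v(1)] by simp
    then have "c \<bullet> a = 0" using orth[of a] unfolding a_def by auto
    then show ?thesis using dot[OF c] by simp
  qed
  then have "real_of_int (v $ p) * real_of_int (c $ q) = real_of_int (v $ q) *
      real_of_int (c $ p)" if "q < n" for q
    using that by (metis of_int_mult)
  then have "real_of_int (c $ q) = real_of_int (c $ p) / real_of_int (v $ p) *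
      real_of_int (v $ q)" if "q < n" for q
    using p(2) that by (simp add: field_simps)
  then show ?thesis using v c
    by (intro exI[of _ "real_of_int (c $ p) / real_of_int (v $ p)"] eq_vecI) auto
qed

text \<open>
  A cone on a line is the origin, a ray or the whole line; the last case is excluded by strong
  convexity and the positive multiple of \<open>w\<close> decides between the others.
\<close>

lemma strongly_convex_cone_on_line:
  assumes cone: "rational_cone n \<rho>" "strongly_convex n \<rho>"
    and w: "w \<in> carrier_vec n" "w \<noteq> 0\<^sub>v n"
    and line: "\<And>x. x \<in> \<rho> \<Longrightarrow> \<exists>\<mu>. x = \<mu> \<cdot>\<^sub>v w"
    and \<mu>: "0 < \<mu>" "\<mu> \<cdot>\<^sub>v w \<in> \<rho>"
  shows "\<rho> = ray_of w"
proof -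
  obtain A :: "int mat" where A: "dim_row A = n" "\<rho> = pos_cone (map_mat real_of_int A)"
    using cone(1) unfolding rational_cone_def by blast
  have scale: "c \<cdot>\<^sub>v x \<in> \<rho>" if x: "x \<in> \<rho>" and c: "0 \<le> c" for x c
  proof -
    obtain z where z: "x = map_mat real_of_int A *\<^sub>v z" "z \<in> carrier_vec (dim_col A)"
      "\<forall>l<dim_col A. 0 \<le> z $ l" using x unfolding A(2) pos_cone_def by auto
    have "c \<cdot>\<^sub>v x = map_mat real_of_int A *\<^sub>v (c \<cdot>\<^sub>v z)"
      unfolding z(1) using z(2) by (subst mult_mat_vec[of _ "dim_row A" "dim_col A"]) auto
    then show ?thesis unfolding A(2) pos_cone_def using z c
      by (intro CollectI exI[of _ "c \<cdot>\<^sub>v z"]) auto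
  qed
  have win: "c \<cdot>\<^sub>v w \<in> \<rho>" if "0 \<le> c" for c
    using scale[OF \<mu>(2), of "c / \<mu>"] \<mu>(1) that by (simp add: smult_smult_assoc)
  show ?thesis unfolding ray_of_def
  proof (intro equalityI subsetI)
    fix x assume x: "x \<in> \<rho>"
    then obtain c where c: "x = c \<cdot>\<^sub>v w" using line by blast
    have "0 \<le> c"
    proof (rule ccontr)
      assume neg: "\<not> 0 \<le> c"
      have "- x = (- c) \<cdot>\<^sub>v w" unfolding c by (intro eq_vecI) auto
      then have "- x \<in> \<rho>" using win[of "- c"] neg by simp
      then have "x = 0\<^sub>v n" using cone(2) x unfolding strongly_convex_def by blast
      then have "(1 / c) \<cdot>\<^sub>v x = 0\<^sub>v n" by (intro eq_vecI) auto
      then show False using w neg unfolding c by (simp add: smult_smult_assoc)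
    qed
    then show "x \<in> {c \<cdot>\<^sub>v w |c. 0 \<le> c}" using c by blast
  qed (use win in auto)
qed

context torus_quotient_exponents
begin

definition boundary :: "nat \<Rightarrow> complex vec set" where
  "boundary j = {y \<in> carrier_vec m. y $ j = 0 \<and> (\<forall>i<m. i \<noteq> j \<longrightarrow> y $ i \<noteq> 0)}"

text \<open>
  Approach \<open>y\<close> along \<open>y + t e\<^sub>j\<close> with \<open>t \<rightarrow> 0\<close>. For \<open>t \<noteq> 0\<close> this is a torus point, where
  \<open>\<chi>\<^sup>a \<circ> \<pi>\<close> is a nonzero constant times \<open>t\<close> to the power \<open>v $ j\<close>. As the pullback of a regular
  function it is also a rational function of \<open>t\<close> whose denominator does not vanish at 0. So the
  exponent is nonnegative, and the value at \<open>y\<close> is the value at \<open>t = 0\<close>.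
\<close>

lemma boundary_character:
  assumes j: "j < m" and y: "y \<in> boundary j" "y \<notin> Z" and a: "a \<in> dual_monoid n (fst (\<pi> y))"
  defines "v \<equiv> V\<^sup>T *\<^sub>v a"
  shows "0 \<le> v $ j"
    and "snd (\<pi> y) a = (if v $ j = 0 then \<Prod>i\<in>{..<m} - {j}. y $ i powi v $ i else 0)"
proof -
  define \<sigma> where "\<sigma> = fst (\<pi> y)"
  have yc: "y \<in> carrier_vec m - Z" using y unfolding boundary_def by auto
  have \<sigma>: "\<sigma> \<in> \<Delta>" and yp: "y \<in> preimage \<sigma>"
    using point_in_chart[OF yc] yc unfolding \<sigma>_def preimage_def by auto
  have ac: "a \<in> carrier_vec n" using a unfolding dual_monoid_def by auto
  have vc: "v \<in> carrier_vec m" unfolding v_def using V ac by auto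
  obtain g h where gh: "g \<in> poly_functions m" "h \<in> poly_functions m" "h y \<noteq> 0"
    "\<And>z. z \<in> preimage \<sigma> \<Longrightarrow> h z \<noteq> 0 \<Longrightarrow> snd (\<pi> z) a = g z / h z"
    using pullback_regular[OF \<sigma>, of a] a yp unfolding \<sigma>_def[symmetric] regular_on_def by blast
  \<comment> \<open>The curve \<open>y + t e\<^sub>j\<close>, coordinate by coordinate.\<close>
  define c where "c i = (if i = j then [:0, 1:] else [:y $ i:])" for i
  define z where "z t = vec m (\<lambda>i. poly (c i) t)" for t
  obtain p q where p: "\<And>t. g (z t) = poly p t" and q: "\<And>t. h (z t) = poly q t"
    using poly_function_polynomial_curve[OF gh(1), of c] poly_function_polynomial_curve[OF gh(2),
        of c]
    unfolding z_def by blast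
  have z0: "z 0 = y" using y unfolding z_def c_def boundary_def by (intro eq_vecI) auto
  have zt: "z t \<in> big_torus m" if "t \<noteq> 0" for t
    using y that unfolding z_def c_def boundary_def big_torus_def by auto
  define P where "P = (\<Prod>i\<in>{..<m} - {j}. y $ i powi v $ i)"
  have P0: "P \<noteq> 0" unfolding P_def using y unfolding boundary_def by auto
  have mon: "monomial (z t) v = t powi (v $ j) * P" for t
  proof -
    have "monomial (z t) v = (\<Prod>i<m. z t $ i powi v $ i)" unfolding monomial_def using vc by auto
    also have "\<dots> = z t $ j powi v $ j * (\<Prod>i\<in>{..<m} - {j}. z t $ i powi v $ i)"
      using j by (intro prod.remove) auto
    also have "z t $ j = t" using j unfolding z_def c_def by auto
    also have "(\<Prod>i\<in>{..<m} - {j}. z t $ i powi v $ i) = P"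
      unfolding P_def z_def c_def by (intro prod.cong) auto
    finally show ?thesis .
  qed
  have q0: "poly q 0 \<noteq> 0" using q[of 0] z0 gh(3) by simp
  then have "q \<noteq> 0" by auto
  then have fin: "finite (insert 0 {t. poly q t = 0})" using poly_roots_finite by simp
  have rel: "t powi (v $ j) * P * poly q t = poly p t" if "t \<notin> insert 0 {t. poly q t = 0}" for t
  proof -
    have t: "t \<noteq> 0" "poly q t \<noteq> 0" using that by auto
    have "z t \<in> preimage \<sigma>" using torus_preimage[OF \<sigma>] zt[OF t(1)] by blast
    then have "snd (\<pi> (z t)) a = poly p t / poly q t" using gh(4) t(2) p q by simp
    moreover have "snd (\<pi> (z t)) a = t powi (v $ j) * P"
      using V_exponents[OF zt[OF t(1)] ac] mon unfolding v_def by simp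
    ultimately show ?thesis using t(2) by simp
  qed
  show nonneg: "0 \<le> v $ j"
  proof (rule ccontr)
    assume neg: "\<not> 0 \<le> v $ j"
    define l where "l = nat (- v $ j)"
    have l: "v $ j = - int l" "0 < l" using neg unfolding l_def by auto
    have "smult P q = monom 1 l * p"
    proof (rule poly_eq_if_cofinite[OF fin])
      fix t assume t: "t \<notin> insert 0 {t. poly q t = 0}"
      then have "t \<noteq> 0" by auto
      then show "poly (smult P q) t = poly (monom 1 l * p) t"
        using rel[OF t, symmetric] l(1) by (simp add: poly_monom power_int_minus)
    qed
    then have "poly (smult P q) 0 = poly (monom 1 l * p) 0" by simp
    then show False using P0 q0 l(2) by (simp add: poly_monom power_0_left)
  qed
  define l where "l = nat (v $ j)"
  have l: "v $ j = int l" using nonneg unfolding l_def by simp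
  have "monom P l * q = p"
  proof (rule poly_eq_if_cofinite[OF fin])
    fix t assume t: "t \<notin> insert 0 {t. poly q t = 0}"
    show "poly (monom P l * q) t = poly p t" using rel[OF t] l by (simp add: poly_monom mult_ac)
  qed
  then have "poly p 0 = poly (monom P l) 0 * poly q 0" by auto
  moreover have "snd (\<pi> y) a = poly p 0 / poly q 0"
      using gh(4)[OF yp gh(3)] p[of 0] q[of 0] z0 by simp
  ultimately have "snd (\<pi> y) a = poly (monom P l) 0" using q0 by simp
  then show "snd (\<pi> y) a = (if v $ j = 0 then \<Prod>i\<in>{..<m} - {j}. y $ i powi v $ i else 0)"
    unfolding P_def[symmetric] using l by (simp add: poly_monom power_0_left)
qed

text \<open>
  The chart of a cone is open and only contains orbits of faces of the cone. Choosing the cone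
  minimal therefore ensures that it stays the same under small motions of the boundary point.
\<close>

lemma generic_boundary_cone:
  assumes j: "j < m" and bZ: "boundary j \<inter> Z = {}"
  shows "\<exists>y\<in>boundary j. \<forall>y'\<in>boundary j. fst (\<pi> y') \<subseteq> fst (\<pi> y) \<longrightarrow> fst (\<pi> y') = fst (\<pi> y)"
proof -
  let ?S = "(\<lambda>y. fst (\<pi> y)) ` boundary j"
  have "?S \<subseteq> \<Delta>" using point_in_chart(1) bZ unfolding boundary_def by blast
  then have "finite ?S" using fan unfolding rational_fan_def by (meson finite_subset)
  moreover have "vec m (\<lambda>i. if i = j then 0 else 1) \<in> boundary j"
      using j unfolding boundary_def by auto
  then have "?S \<noteq> {}" by blast
  ultimately obtain \<rho> where \<rho>: "\<rho> \<in> ?S" "\<forall>b\<in>?S. b \<subseteq> \<rho> \<longrightarrow> \<rho> = b"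
    using finite_has_minimal[of ?S] by auto
  obtain y where y: "y \<in> boundary j" "\<rho> = fst (\<pi> y)" using \<rho>(1) by (rule imageE)
  show ?thesis
  proof (intro bexI[OF _ y(1)] ballI impI)
    fix y' assume "y' \<in> boundary j" "fst (\<pi> y') \<subseteq> fst (\<pi> y)"
    then show "fst (\<pi> y') = fst (\<pi> y)" using \<rho>(2) y(2) by blast
  qed
qed

text \<open>
  Move \<open>y\<close> to \<open>t\<^sup>u y\<close>. By minimality the cone stays the same for all but finitely many \<open>t\<close>, and
  the hypothesis on \<open>u\<close> says that the remaining coordinates of the image do not change either.
  So \<open>t\<^sup>u y\<close> is a translate of \<open>y\<close> by some \<open>g \<in> G\<close>, which has entries \<open>t\<close> to the power \<open>u\<^sub>i\<close>
  except at \<open>j\<close>. A character of the row lattice that does not involve coordinate \<open>j\<close> is 1 at \<open>g\<close>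
  and thus orthogonal to \<open>u\<close>, if \<open>t\<close> is not a root of unity.
\<close>

lemma one_parameter_in_stabilizer:
  assumes j: "j < m" and bZ: "boundary j \<inter> Z = {}" and y: "y \<in> boundary j"
    and minimal: "\<And>y'. y' \<in> boundary j \<Longrightarrow> fst (\<pi> y') \<subseteq> fst (\<pi> y) \<Longrightarrow> fst (\<pi> y') = fst (\<pi> y)"
    and u: "u \<in> carrier_vec m"
    and perp: "\<And>a. a \<in> perp_lattice n (fst (\<pi> y)) \<Longrightarrow> (V\<^sup>T *\<^sub>v a) \<bullet> u = 0"
    and a: "a \<in> carrier_vec n" "(V\<^sup>T *\<^sub>v a) $ j = 0"
  shows "(V\<^sup>T *\<^sub>v a) \<bullet> u = 0"
proof -
  define \<rho> where "\<rho> = fst (\<pi> y)"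
  have yc: "y \<in> carrier_vec m - Z" using y bZ unfolding boundary_def by auto
  have \<rho>: "\<rho> \<in> \<Delta>" and yp: "y \<in> preimage \<rho>"
    using point_in_chart[OF yc] yc unfolding \<rho>_def preimage_def by auto
  define x where "x t = vec m (\<lambda>i. t powi (u $ i) * y $ i)" for t
  have xb: "x t \<in> boundary j" if "t \<noteq> 0" for t
    using y j that unfolding x_def boundary_def by auto
  have x1: "x 1 = y" using y unfolding x_def boundary_def by (intro eq_vecI) auto
  have sum_eq: "(\<Sum>i\<in>{..<m} - {j}. u $ i * v $ i) = v \<bullet> u"
      if "v \<in> carrier_vec m" "v $ j = 0" for v :: "int vec"
  proof -
    have "v \<bullet> u = (\<Sum>i<m. u $ i * v $ i)" using u that
        by (simp add: scalar_prod_def lessThan_atLeast0 mult.commute)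
    also have "\<dots> = u $ j * v $ j + (\<Sum>i\<in>{..<m} - {j}. u $ i * v $ i)"
        using j by (intro sum.remove) auto
    finally show ?thesis using that by simp
  qed
  have prod_eq: "(\<Prod>i\<in>{..<m} - {j}. (t powi (u $ i)) powi v $ i) = t powi (v \<bullet> u)"
    if "v \<in> carrier_vec m" "v $ j = 0" "t \<noteq> 0" for v and t :: complex
    unfolding sum_eq[OF that(1,2), symmetric]
        using that(3) by (subst power_int_sum) (auto simp: power_int_mult)
  \<comment> \<open>Powers of 2 are infinitely many and no roots of unity.\<close>
  obtain k where k: "0 < k" "x (2 ^ k) \<in> preimage \<rho>"
  proof -
    obtain f where f: "f \<in> poly_functions m" "f y \<noteq> 0"
      "\<forall>z\<in>carrier_vec m - Z. f z \<noteq> 0 \<longrightarrow> z \<in> preimage \<rho>"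
      using preimage_neighbourhood[OF \<rho> yp] by blast
    obtain N p where p: "\<And>t. t \<noteq> 0 \<Longrightarrow> f (x t) * t ^ N = poly p t"
      using poly_function_monomial_curve[OF f(1), of "\<lambda>i. u $ i" "\<lambda>i. y $ i"]
          unfolding x_def by blast
    have "p \<noteq> 0" using p[of 1] x1 f(2) by auto
    then have "finite {t. poly p t = 0}" by (rule poly_roots_finite)
    moreover have "infinite ((\<lambda>k. (2 :: complex) ^ k) ` {0<..})"
    proof -
      have "inj (\<lambda>k. (2 :: complex) ^ k)"
      proof (rule injI)
        fix a b assume "(2 :: complex) ^ a = 2 ^ b"
        then have "norm ((2 :: complex) ^ a) = norm ((2 :: complex) ^ b)" by simp
        then show "a = b" by (simp add: norm_power)
      qed
      then show ?thesis by (metis finite_imageD infinite_Ioi inj_on_subset subset_UNIV)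
    qed
    ultimately obtain t where t: "t \<in> (\<lambda>k. (2 :: complex) ^ k) ` {0<..}" "poly p t \<noteq> 0"
      by (metis (mono_tags, lifting) finite_subset mem_Collect_eq subsetI)
    then obtain k where k: "0 < k" "t = 2 ^ k" by auto
    then have "f (x t) \<noteq> 0" using p[of t] t(2) by auto
    then have "x t \<in> preimage \<rho>" using f(3) xb[of t] bZ k(2) unfolding boundary_def by auto
    then show ?thesis using that k by blast
  qed
  define t :: complex where "t = 2 ^ k"
  have t0: "t \<noteq> 0" unfolding t_def by simp
  have xc: "x t \<in> carrier_vec m - Z" using xb[OF t0] bZ unfolding boundary_def by auto
  have cone: "fst (\<pi> (x t)) = \<rho>"
  proof -
    have "face n (fst (\<pi> (x t))) \<rho>" using k(2) unfolding t_def preimage_def chart_def by auto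
    then show ?thesis using minimal[OF xb[OF t0]] face_subset unfolding \<rho>_def by blast
  qed
  have "snd (\<pi> (x t)) b = snd (\<pi> y) b" for b
  proof (cases "b \<in> perp_lattice n \<rho>")
    case False
    then show ?thesis using point_in_chart(3)[OF xc] point_in_chart(3)[OF yc] cone
      unfolding \<rho>_def orbit_def by auto
  next
    case True
    define v where "v = V\<^sup>T *\<^sub>v b"
    have b: "b \<in> dual_monoid n \<rho>" "b \<in> carrier_vec n"
      using True unfolding perp_lattice_def dual_monoid_def by auto
    have vc: "v \<in> carrier_vec m" unfolding v_def using V b by auto
    have "snd (\<pi> y) b \<noteq> 0" using point_in_chart(3)[OF yc] True unfolding \<rho>_def orbit_def by auto
    then have v0: "v $ j = 0"
      using boundary_character(2)[OF j y _ b(1)[unfolded \<rho>_def]] yc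
          unfolding v_def by (auto split: if_splits)
    have "snd (\<pi> (x t)) b = (\<Prod>i\<in>{..<m} - {j}. x t $ i powi v $ i)"
      using boundary_character(2)[OF j xb[OF t0], of b] xc cone b(1) v0 unfolding v_def by auto
    also have "\<dots> = (\<Prod>i\<in>{..<m} - {j}. (t powi (u $ i)) powi v $ i) *
        (\<Prod>i\<in>{..<m} - {j}. y $ i powi v $ i)"
      unfolding prod.distrib[symmetric] x_def
          by (intro prod.cong) (auto simp: power_int_mult_distrib)
    also have "\<dots> = t powi (v \<bullet> u) * snd (\<pi> y) b"
      using prod_eq[OF vc v0 t0] boundary_character(2)[OF j y _ b(1)[unfolded \<rho>_def]] yc v0
      unfolding v_def by auto
    also have "v \<bullet> u = 0" using perp True unfolding \<rho>_def v_def by blast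
    finally show ?thesis by simp
  qed
  then have "snd (\<pi> (x t)) = snd (\<pi> y)" by blast
  then have "\<pi> (x t) = \<pi> y" using cone unfolding \<rho>_def by (metis prod.collapse)
  then obtain g where g: "g \<in> G" "x t = cw_mult g y" using same_fibre[OF yc xc] by blast
  have gt: "g \<in> big_torus m" using g(1) G by blast
  have gi: "g $ i = t powi (u $ i)" if "i < m" "i \<noteq> j" for i
  proof -
    have "x t $ i = g $ i * y $ i" using g(2) gt that(1) unfolding cw_mult_def big_torus_def by auto
    moreover have "x t $ i = t powi (u $ i) * y $ i" using that unfolding x_def by auto
    moreover have "y $ i \<noteq> 0" using y that unfolding boundary_def by auto
    ultimately show ?thesis by simp
  qed
  define v where "v = V\<^sup>T *\<^sub>v a"
  have vc: "v \<in> carrier_vec m" "v $ j = 0" using V a unfolding v_def by auto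
  have "1 = monomial g v" using kernel[OF gt] g(1) a(1) unfolding v_def by auto
  also have "\<dots> = g $ j powi v $ j * (\<Prod>i\<in>{..<m} - {j}. g $ i powi v $ i)"
  proof -
    have "dim_vec v = m" using vc by simp
    then show ?thesis unfolding monomial_def using j by (simp add: prod.remove[of "{..<m}" j])
  qed
  also have "\<dots> = (\<Prod>i\<in>{..<m} - {j}. (t powi (u $ i)) powi v $ i)"
    using vc(2) gi by (auto intro!: prod.cong)
  also have "\<dots> = t powi (v \<bullet> u)" using prod_eq[OF vc t0] .
  finally show ?thesis using power_of_two_powi_eq_one[OF k(1)] unfolding t_def v_def by simp
qed

text \<open>
  Every integral generator of the cone \<open>\<rho>\<close> of a generic boundary point is, up to a factor, the
  image of a one-parameter subgroup, hence collinear with \<open>v\<^sub>j\<close>. So \<open>\<rho>\<close> lies on the line through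
  \<open>v\<^sub>j\<close>. It contains a positive multiple of \<open>v\<^sub>j\<close>, since otherwise \<open>- v\<^sub>j\<close> would be in the dual
  monoid of \<open>\<rho>\<close>, and the exponent of the corresponding monomial along \<open>x\<^sub>j = 0\<close>, which is minus
  the square of the length of \<open>v\<^sub>j\<close>, would be negative.
\<close>

lemma ray_of_column_in_fan:
  assumes j: "j < m" and bZ: "boundary j \<inter> Z = {}" and nz: "col V j \<noteq> 0\<^sub>v n"
    and R: "R \<in> carrier_mat m n" "V * R = d \<cdot>\<^sub>m 1\<^sub>m n" "d \<noteq> 0"
  shows "ray_of (rvec (col V j)) \<in> \<Delta>"
proof -
  obtain y where y: "y \<in> boundary j"
    and minimal: "\<And>y'. y' \<in> boundary j \<Longrightarrow> fst (\<pi> y') \<subseteq> fst (\<pi> y) \<Longrightarrow> fst (\<pi> y') = fst (\<pi> y)"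
    using generic_boundary_cone[OF j bZ] by blast
  define \<rho> where "\<rho> = fst (\<pi> y)"
  define v where "v = col V j"
  have v: "v \<in> carrier_vec n" "v \<noteq> 0\<^sub>v n" unfolding v_def using V nz by auto
  have yc: "y \<in> carrier_vec m - Z" using y bZ unfolding boundary_def by auto
  have \<rho>: "\<rho> \<in> \<Delta>" using point_in_chart(1)[OF yc] unfolding \<rho>_def .
  have vj: "(V\<^sup>T *\<^sub>v a) $ j = v \<bullet> a" for a using V j unfolding v_def by auto
  obtain A :: "int mat" where A: "dim_row A = n" "\<rho> = pos_cone (map_mat real_of_int A)"
    using fan \<rho> unfolding rational_fan_def rational_cone_def by blast
  have "\<exists>r. rvec (col A l) = r \<cdot>\<^sub>v rvec v" if l: "l < dim_col A" for l
  proof (rule collinear_if_orthogonal[OF v])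
    let ?c = "col A l"
    show c: "?c \<in> carrier_vec n" using A(1) by auto
    define u where "u = R *\<^sub>v ?c"
    have u: "u \<in> carrier_vec m" unfolding u_def using R(1) c by auto
    have Vu: "V *\<^sub>v u = d \<cdot>\<^sub>v ?c"
    proof -
      have "V *\<^sub>v u = (V * R) *\<^sub>v ?c" unfolding u_def
          using V R(1) c by (intro assoc_mult_mat_vec[symmetric]) auto
      then show ?thesis unfolding R(2) using A(1) by (intro eq_vecI) auto
    qed
    have dot: "(V\<^sup>T *\<^sub>v a) \<bullet> u = d * (?c \<bullet> a)" if "a \<in> carrier_vec n" for a
    proof -
      have "(V\<^sup>T *\<^sub>v a) \<bullet> u = a \<bullet> (V *\<^sub>v u)"
        using transpose_vec_mult_scalar[OF V u that] by simp
      also have "\<dots> = d * (?c \<bullet> a)" unfolding Vu using that c by (simp add: comm_scalar_prod[of a n])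
      finally show ?thesis .
    qed
    fix a :: "int vec" assume a: "a \<in> carrier_vec n" "v \<bullet> a = 0"
    have "(V\<^sup>T *\<^sub>v a) \<bullet> u = 0"
    proof (rule one_parameter_in_stabilizer[OF j bZ y minimal u])
      fix b assume "b \<in> perp_lattice n (fst (\<pi> y))"
      then have b: "b \<in> carrier_vec n" "\<forall>x\<in>\<rho>. rvec b \<bullet> x = 0"
          unfolding \<rho>_def perp_lattice_def by auto
      have "col (map_mat real_of_int A) l \<in> \<rho>"
          unfolding A(2) using l by (intro col_in_pos_cone) auto
      then have "rvec b \<bullet> rvec ?c = 0" using b(2) l by simp
      moreover have "dim_vec b = dim_vec ?c" using carrier_vecD[OF b(1)] carrier_vecD[OF c] by simp
      ultimately have "b \<bullet> ?c = 0" by (simp only: rvec_scalar_prod of_int_eq_0_iff)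
      then show "(V\<^sup>T *\<^sub>v b) \<bullet> u = 0"
        using dot[OF b(1)] comm_scalar_prod[OF b(1) c] by simp
    qed (use a vj in auto)
    then show "?c \<bullet> a = 0" using dot[OF a(1)] R(3) by simp
  qed
  then obtain r where r: "\<And>l. l < dim_col A \<Longrightarrow> rvec (col A l) = r l \<cdot>\<^sub>v rvec v" by metis
  have line: "\<exists>\<mu>. x = \<mu> \<cdot>\<^sub>v rvec v" if xin: "x \<in> \<rho>" for x
  proof -
    obtain w where w: "x = map_mat real_of_int A *\<^sub>v w" "w \<in> carrier_vec (dim_col A)"
      using xin unfolding A(2) pos_cone_def by auto
    have "x = (\<Sum>l<dim_col A. r l * w $ l) \<cdot>\<^sub>v rvec v"
    proof (rule eq_vecI)
      fix i assume "i < dim_vec ((\<Sum>l<dim_col A. r l * w $ l) \<cdot>\<^sub>v rvec v)"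
      then have i: "i < n" using v by auto
      have e: "real_of_int (A $$ (i, l)) = r l * v $ i" if "l < dim_col A" for l
        using arg_cong[OF r[OF that], of "\<lambda>z. z $ i"] i that A(1) v by simp
      have "x $ i = (\<Sum>l<dim_col A. real_of_int (A $$ (i, l)) * w $ l)"
        using w i A(1) by (simp add: scalar_prod_def lessThan_atLeast0)
      also have "\<dots> = (\<Sum>l<dim_col A. r l * w $ l) * v $ i"
        unfolding sum_distrib_right by (intro sum.cong) (auto simp: e mult_ac)
      finally show "x $ i = ((\<Sum>l<dim_col A. r l * w $ l) \<cdot>\<^sub>v rvec v) $ i" using i v by simp
    qed (use w A(1) v in auto)
    then show ?thesis by blast
  qed
  have rv0: "rvec v \<noteq> 0\<^sub>v n"
  proof
    assume *: "rvec v = 0\<^sub>v n"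
    have "v = 0\<^sub>v n"
    proof (rule eq_vecI)
      fix i assume "i < dim_vec (0\<^sub>v n :: int vec)"
      then show "v $ i = 0\<^sub>v n $ i" using arg_cong[OF *, of "\<lambda>z. z $ i"] v(1) by simp
    qed (use v in auto)
    then show False using v by simp
  qed
  have "\<exists>\<mu>>0. \<mu> \<cdot>\<^sub>v rvec v \<in> \<rho>"
  proof (rule ccontr)
    assume no: "\<not> (\<exists>\<mu>>0. \<mu> \<cdot>\<^sub>v rvec v \<in> \<rho>)"
    have vv: "0 < v \<bullet> v"
    proof -
      obtain i where i: "i < n" "v $ i \<noteq> 0" using v by (metis eq_vecI carrier_vecD index_zero_vec)
      have "0 < v $ i * v $ i" using i(2) by (metis not_square_less_zero linorder_neqE
          mult_eq_0_iff)
      also have "\<dots> \<le> (\<Sum>i<n. v $ i * v $ i)" using i by (intro member_le_sum) auto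
      finally show ?thesis using v by (simp add: scalar_prod_def lessThan_atLeast0)
    qed
    have "- v \<in> dual_monoid n \<rho>" unfolding dual_monoid_def
    proof (intro CollectI conjI ballI)
      fix x assume x: "x \<in> \<rho>"
      then obtain \<mu> where \<mu>: "x = \<mu> \<cdot>\<^sub>v rvec v" using line by blast
      then have "\<mu> \<le> 0" using no x by (metis not_le)
      have "rvec (- v) \<bullet> x = - \<mu> * real_of_int (v \<bullet> v)"
      proof -
        have "rvec (- v) = - rvec v" by (intro eq_vecI) auto
        then show ?thesis unfolding \<mu> using v by (simp add: rvec_scalar_prod)
      qed
      then show "0 \<le> rvec (- v) \<bullet> x" using vv \<open>\<mu> \<le> 0\<close> by (simp add: mult_nonpos_nonneg)
    qed (use v in auto)
    then have "0 \<le> v \<bullet> (- v)"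
      using boundary_character(1)[OF j y, of "- v"] yc vj unfolding \<rho>_def by auto
    then show False using vv v by simp
  qed
  then obtain \<mu> where \<mu>: "0 < \<mu>" "\<mu> \<cdot>\<^sub>v rvec v \<in> \<rho>" by blast
  have "rational_cone n \<rho>" "strongly_convex n \<rho>"
    using fan \<rho> unfolding rational_fan_def by blast+
  then have "\<rho> = ray_of (rvec v)"
    using strongly_convex_cone_on_line[OF _ _ _ rv0 line \<mu>] v(1) by simp
  then show ?thesis using \<rho> unfolding v_def by simp
qed

end

section \<open>Characters trivial on the acting group\<close>

lemma ZFact_congruent:
  assumes "X \<in> carrier (ZFact n)" "a \<in> X" "b \<in> X"
  shows "n dvd a - b"
proof -
  obtain c where X: "X = {h + c |h. h \<in> Idl\<^bsub>\<Z>\<^esub> {n}}"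
    using assms(1) unfolding ZFact_defs A_RCOSETS_defs r_coset_def by auto
  have "h \<in> Idl\<^bsub>\<Z>\<^esub> {n} \<Longrightarrow> n dvd h" for h using int_Idl[of n] by auto
  then have "n dvd a - c" "n dvd b - c" using assms(2,3) unfolding X by auto
  then have "n dvd (a - c) - (b - c)" by (rule dvd_diff)
  then show ?thesis by simp
qed

text \<open>
  The integral representatives of the torsion weights that occur in \<^const>\<open>weight_vec\<close>.
\<close>

definition chosen_weights :: "int set mat \<Rightarrow> int mat" where
  "chosen_weights \<Gamma> = mat (dim_row \<Gamma>) (dim_col \<Gamma>) (\<lambda>(k, j). SOME c. c \<in> \<Gamma> $$ (k, j))"

lemma chosen_weights_congruent:
  assumes \<Gamma>: "torsion_matrix s m \<tau> \<Gamma>" and C: "represents C \<Gamma>"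
      and v: "v \<in> carrier_vec m" and k: "k < s"
  shows "int (\<tau> k) dvd (chosen_weights \<Gamma> *\<^sub>v v) $ k \<longleftrightarrow> int (\<tau> k) dvd (C *\<^sub>v v) $ k"
proof -
  have \<Gamma>c: "\<Gamma> \<in> carrier_mat s m" "\<And>j. j < m \<Longrightarrow> \<Gamma> $$ (k, j) \<in> carrier (ZFact (int (\<tau> k)))"
    using \<Gamma> k unfolding torsion_matrix_def by auto
  have Cc: "C \<in> carrier_mat s m" "\<And>j. j < m \<Longrightarrow> C $$ (k, j) \<in> \<Gamma> $$ (k, j)"
    using C \<Gamma>c(1) k unfolding represents_def by auto
  have W: "chosen_weights \<Gamma> \<in> carrier_mat s m" unfolding chosen_weights_def using \<Gamma>c(1) by auto
  have "int (\<tau> k) dvd chosen_weights \<Gamma> $$ (k, j) - C $$ (k, j)" if j: "j < m" for j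
  proof (rule ZFact_congruent[OF \<Gamma>c(2)[OF j] _ Cc(2)[OF j]])
    have "(SOME c. c \<in> \<Gamma> $$ (k, j)) \<in> \<Gamma> $$ (k, j)" using Cc(2)[OF j] by (rule someI)
    then show "chosen_weights \<Gamma> $$ (k, j) \<in> \<Gamma> $$ (k, j)"
      unfolding chosen_weights_def using \<Gamma>c(1) k j by simp
  qed
  then have "int (\<tau> k) dvd (\<Sum>j<m. (chosen_weights \<Gamma> $$ (k, j) - C $$ (k, j)) * v $ j)"
    by (intro dvd_sum dvd_mult2) auto
  moreover have "(\<Sum>j<m. (chosen_weights \<Gamma> $$ (k, j) - C $$ (k, j)) * v $ j)
      = (chosen_weights \<Gamma> *\<^sub>v v) $ k - (C *\<^sub>v v) $ k"
    using W Cc(1) v k by (simp add: scalar_prod_def lessThan_atLeast0 left_diff_distrib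
        sum_subtractf)
  ultimately have "int (\<tau> k) dvd (chosen_weights \<Gamma> *\<^sub>v v) $ k - (C *\<^sub>v v) $ k" by simp
  then show ?thesis by (metis dvd_diff_right_iff dvd_diff_left_iff diff_add_cancel
      dvd_add_right_iff)
qed

lemma weight_vec_monomials:
  assumes Q: "Q \<in> carrier_mat r m" and \<Gamma>: "\<Gamma> \<in> carrier_mat s m"
  shows "weight_vec Q \<Gamma> (t, \<epsilon>) = cw_mult (vec m (\<lambda>j. monomial t (col Q j)))
    (vec m (\<lambda>j. monomial \<epsilon> (col (chosen_weights \<Gamma>) j)))"
  using Q \<Gamma> unfolding weight_vec_def cw_mult_def monomial_def chosen_weights_def
  by (intro eq_vecI) auto

lemma monomial_weight_vec:
  assumes Q: "Q \<in> carrier_mat r m" and \<Gamma>: "\<Gamma> \<in> carrier_mat s m" and v: "v \<in> carrier_vec m"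
    and t: "t \<in> big_torus r" and \<epsilon>: "\<epsilon> \<in> big_torus s"
  shows "monomial (weight_vec Q \<Gamma> (t, \<epsilon>)) v = monomial t (Q *\<^sub>v v) *
      monomial \<epsilon> (chosen_weights \<Gamma> *\<^sub>v v)"
proof -
  have W: "chosen_weights \<Gamma> \<in> carrier_mat s m" unfolding chosen_weights_def using \<Gamma> by auto
  have *: "monomial (vec m (\<lambda>j. monomial x (col A j))) v = monomial x (A *\<^sub>v v)"
    if "A \<in> carrier_mat l m" "x \<in> big_torus l" for A l x
  proof -
    have "vec m (\<lambda>j. monomial x (row (A\<^sup>T) j)) = vec m (\<lambda>j. monomial x (col A j))"
      using that(1) by (intro eq_vecI) auto
    then show ?thesis using monomial_transpose_mult[OF that(2), of "A\<^sup>T" m v] that(1) v by simp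
  qed
  show ?thesis unfolding weight_vec_monomials[OF Q \<Gamma>] using *[OF Q t] *[OF W \<epsilon>] v
    by (subst monomial_cw_mult[of _ m]) auto
qed

lemma quot_group_torus:
  assumes "(t, \<epsilon>) \<in> quot_group r s \<tau>" "\<forall>k<s. 1 < \<tau> k"
  shows "t \<in> big_torus r" "\<epsilon> \<in> big_torus s"
proof -
  show "t \<in> big_torus r" using assms(1) unfolding quot_group_def big_torus_def by auto
  have "\<epsilon> $ k \<noteq> 0" if "k < s" for k
  proof
    assume "\<epsilon> $ k = 0"
    moreover have "(\<epsilon> $ k) ^ \<tau> k = 1" "0 < \<tau> k" using assms that unfolding quot_group_def by auto
    ultimately show False by (simp add: power_0_left)
  qed
  then show "\<epsilon> \<in> big_torus s" using assms(1) unfolding quot_group_def big_torus_def by auto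
qed

lemma weight_vec_torus:
  assumes Q: "Q \<in> carrier_mat r m" and \<Gamma>: "\<Gamma> \<in> carrier_mat s m"
    and "t \<in> big_torus r" "\<epsilon> \<in> big_torus s"
  shows "weight_vec Q \<Gamma> (t, \<epsilon>) \<in> big_torus m"
proof -
  have W: "chosen_weights \<Gamma> \<in> carrier_mat s m" unfolding chosen_weights_def using \<Gamma> by auto
  have "monomial t (col Q j) \<noteq> 0" "monomial \<epsilon> (col (chosen_weights \<Gamma>) j) \<noteq> 0" if "j < m" for j
    using monomial_nonzero[OF assms(3), of "col Q j"] monomial_nonzero[OF assms(4), of "col
        (chosen_weights \<Gamma>) j"]
      Q W by auto
  then show ?thesis unfolding weight_vec_monomials[OF Q \<Gamma>]
    by (intro cw_mult_big_torus) (auto simp: big_torus_def)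
qed

lemma monomial_axis:
  assumes "v \<in> carrier_vec l" "i < l"
  shows "monomial (vec l (\<lambda>i'. if i' = i then z else 1)) v = z powi v $ i"
proof -
  have "monomial (vec l (\<lambda>i'. if i' = i then z else 1)) v = (\<Prod>i'<l.
      if i' = i then z powi v $ i' else 1)"
    unfolding monomial_def using assms(1) by (intro prod.cong) auto
  then show ?thesis using assms(2) by simp
qed

lemma monomial_eq_one_if_torsion:
  assumes v: "v \<in> carrier_vec s" "\<forall>k<s. int (\<tau> k) dvd v $ k" and \<epsilon>: "\<forall>k<s. (\<epsilon> $ k) ^ \<tau> k = 1"
  shows "monomial \<epsilon> v = 1"
  unfolding monomial_def
proof (rule prod.neutral, intro ballI)
  fix k assume "k \<in> {..<dim_vec v}"
  then have k: "k < s" using v(1) by simp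
  then have "int (\<tau> k) dvd v $ k" using v(2) by blast
  then obtain l where "v $ k = int (\<tau> k) * l" by (rule dvdE)
  then show "(\<epsilon> $ k) powi v $ k = 1" using \<epsilon> k by (simp add: power_int_mult)
qed

text \<open>
  At \<open>(t, \<epsilon>)\<close> the character \<open>v\<close> is the product of the \<open>t\<^sub>i\<close> with exponents \<open>(Q v)\<^sub>i\<close> and of the
  \<open>\<epsilon>\<^sub>k\<close> with exponents \<open>(C v)\<^sub>k\<close>. Testing with a single coordinate equal to 2, respectively to a
  primitive root of unity, and all others equal to 1, shows that it is trivial only under the
  stated conditions.
\<close>

lemma weight_annihilator:
  assumes Q: "Q \<in> carrier_mat r m" and \<Gamma>: "torsion_matrix s m \<tau> \<Gamma>" and C: "represents C \<Gamma>"
    and \<tau>: "\<forall>k<s. 1 < \<tau> k"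
  shows "{v \<in> carrier_vec m. \<forall>x\<in>weight_vec Q \<Gamma> ` quot_group r s \<tau>. monomial x v = 1} =
    {v \<in> carrier_vec m. Q *\<^sub>v v = 0\<^sub>v r \<and> (\<forall>k<s. int (\<tau> k) dvd (C *\<^sub>v v) $ k)}"
proof (intro Collect_cong conj_cong refl)
  fix v :: "int vec" assume v: "v \<in> carrier_vec m"
  have \<Gamma>c: "\<Gamma> \<in> carrier_mat s m" using \<Gamma> unfolding torsion_matrix_def by auto
  define W where "W = chosen_weights \<Gamma>"
  have W: "W \<in> carrier_mat s m" unfolding W_def chosen_weights_def using \<Gamma>c by auto
  have Qv: "Q *\<^sub>v v \<in> carrier_vec r" and Wv: "W *\<^sub>v v \<in> carrier_vec s" using Q W v by auto
  have WC: "int (\<tau> k) dvd (W *\<^sub>v v) $ k \<longleftrightarrow> int (\<tau> k) dvd (C *\<^sub>v v) $ k" if "k < s" for k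
    unfolding W_def by (rule chosen_weights_congruent[OF \<Gamma> C v that])
  have val: "monomial (weight_vec Q \<Gamma> (t, \<epsilon>)) v = monomial t (Q *\<^sub>v v) * monomial \<epsilon> (W *\<^sub>v v)"
    if "(t, \<epsilon>) \<in> quot_group r s \<tau>" for t \<epsilon>
    unfolding W_def using monomial_weight_vec[OF Q \<Gamma>c v] quot_group_torus[OF that \<tau>] by blast
  show "(\<forall>x\<in>weight_vec Q \<Gamma> ` quot_group r s \<tau>. monomial x v = 1) \<longleftrightarrow>
    Q *\<^sub>v v = 0\<^sub>v r \<and> (\<forall>k<s. int (\<tau> k) dvd (C *\<^sub>v v) $ k)"
  proof
    assume "Q *\<^sub>v v = 0\<^sub>v r \<and> (\<forall>k<s. int (\<tau> k) dvd (C *\<^sub>v v) $ k)"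
    then have 0: "Q *\<^sub>v v = 0\<^sub>v r" and dvd: "\<forall>k<s. int (\<tau> k) dvd (W *\<^sub>v v) $ k" using WC by auto
    show "\<forall>x\<in>weight_vec Q \<Gamma> ` quot_group r s \<tau>. monomial x v = 1"
    proof
      fix x assume "x \<in> weight_vec Q \<Gamma> ` quot_group r s \<tau>"
      then obtain t \<epsilon> where x: "x = weight_vec Q \<Gamma> (t, \<epsilon>)" "(t, \<epsilon>) \<in> quot_group r s \<tau>" by force
      have "\<forall>k<s. (\<epsilon> $ k) ^ \<tau> k = 1" using x(2) unfolding quot_group_def by auto
      then have "monomial \<epsilon> (W *\<^sub>v v) = 1" by (rule monomial_eq_one_if_torsion[OF Wv dvd])
      moreover have "monomial t (Q *\<^sub>v v) = 1" unfolding 0 monomial_def by simp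
      ultimately show "monomial x v = 1" unfolding x(1) val[OF x(2)] by simp
    qed
  next
    assume one: "\<forall>x\<in>weight_vec Q \<Gamma> ` quot_group r s \<tau>. monomial x v = 1"
    have one': "monomial t (Q *\<^sub>v v) * monomial \<epsilon> (W *\<^sub>v v) = 1"
        if "(t, \<epsilon>) \<in> quot_group r s \<tau>" for t \<epsilon>
      using one that val[OF that] by force
    have Q0: "(Q *\<^sub>v v) $ i = 0" if i: "i < r" for i
    proof -
      have "(vec r (\<lambda>i'. if i' = i then 2 else 1), vec s (\<lambda>_. 1)) \<in> quot_group r s \<tau>"
        unfolding quot_group_def by auto
      from one'[OF this] have "(2 ^ 1 :: complex) powi (Q *\<^sub>v v) $ i = 1"
        unfolding monomial_axis[OF Qv i] monomial_one[OF Wv] by simp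
      then show ?thesis using power_of_two_powi_eq_one[of 1 "(Q *\<^sub>v v) $ i"] by simp
    qed
    have "Q *\<^sub>v v = 0\<^sub>v r"
    proof (rule eq_vecI)
      fix i assume "i < dim_vec (0\<^sub>v r :: int vec)"
      then have "i < r" by simp
      then show "(Q *\<^sub>v v) $ i = 0\<^sub>v r $ i" using Q0[OF \<open>i < r\<close>] by (simp only: index_zero_vec)
    qed (use Q in auto)
    moreover have "int (\<tau> k) dvd (C *\<^sub>v v) $ k" if k: "k < s" for k
    proof -
      have "0 < \<tau> k" using \<tau> k by auto
      then obtain \<zeta> :: complex where \<zeta>: "\<zeta> \<noteq> 0" "\<And>l :: int. \<zeta> powi l = 1 \<longleftrightarrow> int (\<tau> k) dvd l"
        using primitive_root_of_unity_exists by blast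
      have "\<zeta> ^ \<tau> k = 1" using \<zeta>(2)[of "int (\<tau> k)"] by simp
      then have "(vec r (\<lambda>_. 1), vec s (\<lambda>k'. if k' = k then \<zeta> else 1)) \<in> quot_group r s \<tau>"
        unfolding quot_group_def by auto
      from one'[OF this] have "\<zeta> powi (W *\<^sub>v v) $ k = 1"
        unfolding monomial_axis[OF Wv k] monomial_one[OF Qv] by simp
      then show ?thesis using \<zeta>(2) WC[OF k] by blast
    qed
    ultimately show "Q *\<^sub>v v = 0\<^sub>v r \<and> (\<forall>k<s. int (\<tau> k) dvd (C *\<^sub>v v) $ k)" by blast
  qed
qed

section \<open>The irrelevant locus\<close>

lemma irrelevant_zeros_torus:
  assumes V: "V \<in> carrier_mat n m" and \<Delta>: "\<Delta> \<noteq> {}"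
  shows "big_torus m \<inter> irrelevant_zeros V \<Delta> = {}"
proof (rule ccontr)
  assume "big_torus m \<inter> irrelevant_zeros V \<Delta> \<noteq> {}"
  then obtain x where x: "x \<in> big_torus m" "x \<in> irrelevant_zeros V \<Delta>" by blast
  obtain \<sigma> where "\<sigma> \<in> \<Delta>" using \<Delta> by blast
  then have "(\<Prod>j\<in>{j. j < dim_col V \<and> \<not> ray_of (rvec (col V j)) \<subseteq> \<sigma>}. x $ j) = 0"
    using x(2) unfolding irrelevant_zeros_def by blast
  then obtain j where "j < m" "x $ j = 0" using V by (auto simp: prod_zero_iff)
  then show False using x(1) unfolding big_torus_def by auto
qed

text \<open>
  The cone that witnesses this is the \<open>j\<close>-th ray: the corresponding monomial does not involve
  \<open>x\<^sub>j\<close>.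
\<close>

lemma irrelevant_zeros_boundary:
  assumes V: "V \<in> carrier_mat n m" and j: "j < m" "ray_of (rvec (col V j)) \<in> \<Delta>"
    and y: "\<And>i. i < m \<Longrightarrow> i \<noteq> j \<Longrightarrow> y $ i \<noteq> 0"
  shows "y \<notin> irrelevant_zeros V \<Delta>"
proof
  assume "y \<in> irrelevant_zeros V \<Delta>"
  then have "(\<Prod>i\<in>{i. i < dim_col V \<and> \<not> ray_of (rvec (col V i)) \<subseteq> ray_of (rvec (col V j))}. y $ i) =
      0"
    using j(2) unfolding irrelevant_zeros_def by blast
  then obtain i where "i < m" "y $ i = 0" "\<not> ray_of (rvec (col V i)) \<subseteq> ray_of (rvec (col V j))"
    using V by (auto simp: prod_zero_iff)
  then show False using y[of i] by auto
qed

section \<open>The fan matrix\<close>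

text \<open>
  The transpose of \<open>V\<close> maps integral vectors \<open>a\<close> bijectively to the solutions of \<open>Q v = 0\<close>, and
  the condition on \<open>a\<close> is the pullback of the torsion condition on \<open>v\<close>.
\<close>

lemma rows_form_basis_mult_gale_dual:
  assumes Q: "Q \<in> carrier_mat r m" and V: "V \<in> carrier_mat n m" and gale: "gale_dual Q V"
    and C: "C \<in> carrier_mat s m" and \<beta>: "\<beta> \<in> carrier_mat n n"
    and basis: "rows_form_basis \<beta> {a \<in> carrier_vec n. \<forall>k<s. int (\<tau> k) dvd ((V * C\<^sup>T)\<^sup>T *\<^sub>v a) $ k}"
  shows "rows_form_basis (\<beta> * V) {v \<in> carrier_vec m. Q *\<^sub>v v = 0\<^sub>v r \<and>
      (\<forall>k<s. int (\<tau> k) dvd (C *\<^sub>v v) $ k)}"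
proof -
  have VC: "(V * C\<^sup>T)\<^sup>T *\<^sub>v a = C *\<^sub>v (V\<^sup>T *\<^sub>v a)" if "a \<in> carrier_vec n" for a
    using transpose_mult_vec[of V n m "C\<^sup>T" s a] V C that by simp
  have V1: "row_lattice V = {q \<in> carrier_vec m. Q *\<^sub>v q = 0\<^sub>v r}" and V2: "rows_independent V"
    using gale Q unfolding gale_dual_def rows_form_basis_iff by auto
  have \<beta>1: "row_lattice \<beta> = {a \<in> carrier_vec n. \<forall>k<s. int (\<tau> k) dvd (C *\<^sub>v (V\<^sup>T *\<^sub>v a)) $ k}"
    and \<beta>2: "rows_independent \<beta>"
    using basis VC unfolding rows_form_basis_iff by auto
  have comp: "transpose_mat (\<beta> * V) *\<^sub>v z = V\<^sup>T *\<^sub>v (\<beta>\<^sup>T *\<^sub>v z)" if "z \<in> carrier_vec n" for z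
    using transpose_mult_vec[OF \<beta> V that] .
  show ?thesis unfolding rows_form_basis_iff
  proof
    show "row_lattice (\<beta> * V) = {v \<in> carrier_vec m. Q *\<^sub>v v = 0\<^sub>v r \<and>
        (\<forall>k<s. int (\<tau> k) dvd (C *\<^sub>v v) $ k)}"
    proof (intro equalityI subsetI)
      fix v assume "v \<in> row_lattice (\<beta> * V)"
      then obtain z where z: "z \<in> carrier_vec n" "v = V\<^sup>T *\<^sub>v (\<beta>\<^sup>T *\<^sub>v z)"
        using \<beta> comp unfolding row_lattice_def by auto
      have "\<beta>\<^sup>T *\<^sub>v z \<in> row_lattice \<beta>" using z(1) \<beta> unfolding row_lattice_def by auto
      moreover from this have "v \<in> row_lattice V"
          unfolding z(2) row_lattice_def[of V] \<beta>1 using V by auto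
      ultimately show "v \<in> {v \<in> carrier_vec m. Q *\<^sub>v v = 0\<^sub>v r \<and>
          (\<forall>k<s. int (\<tau> k) dvd (C *\<^sub>v v) $ k)}"
        unfolding \<beta>1 V1 z(2) by auto
    next
      fix v assume "v \<in> {v \<in> carrier_vec m. Q *\<^sub>v v = 0\<^sub>v r \<and> (\<forall>k<s. int (\<tau> k) dvd (C *\<^sub>v v) $ k)}"
      then have v: "v \<in> row_lattice V" "\<forall>k<s. int (\<tau> k) dvd (C *\<^sub>v v) $ k" unfolding V1 by auto
      then obtain a where a: "a \<in> carrier_vec n" "v = V\<^sup>T *\<^sub>v a"
          using V unfolding row_lattice_def by auto
      then have "a \<in> row_lattice \<beta>" using v(2) unfolding \<beta>1 by auto
      then obtain z where z: "z \<in> carrier_vec n" "a = \<beta>\<^sup>T *\<^sub>v z"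
          using \<beta> unfolding row_lattice_def by auto
      then have "v = transpose_mat (\<beta> * V) *\<^sub>v z" using comp[OF z(1)] a(2) by simp
      then show "v \<in> row_lattice (\<beta> * V)"
        using z(1) \<beta> unfolding row_lattice_def by (intro CollectI exI[of _ z]) auto
    qed
    show "rows_independent (\<beta> * V)" unfolding rows_independent_def
    proof (intro ballI impI)
      fix z assume z: "z \<in> carrier_vec (dim_row (\<beta> * V))" "transpose_mat (\<beta> * V) *\<^sub>v z =
          0\<^sub>v (dim_col (\<beta> * V))"
      then have zn: "z \<in> carrier_vec n" using \<beta> by simp
      have bz: "\<beta>\<^sup>T *\<^sub>v z \<in> carrier_vec n" using \<beta> zn by auto
      then have "\<beta>\<^sup>T *\<^sub>v z = 0\<^sub>v n"
        using V2 z(2) comp[OF zn] V unfolding rows_independent_def by auto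
      then show "z = 0\<^sub>v (dim_row (\<beta> * V))" using \<beta>2 zn \<beta> unfolding rows_independent_def by auto
    qed
  qed
qed

lemma invertible_rat_mat_if_det:
  fixes \<beta> :: "int mat"
  assumes "\<beta> \<in> carrier_mat n n" "det \<beta> \<noteq> 0"
  shows "invertible_mat (map_mat rat_of_int \<beta>)"
proof -
  have "det (map_mat rat_of_int \<beta>) = rat_of_int (det \<beta>)" by (simp add: of_int_hom.hom_det)
  then have "det (map_mat rat_of_int \<beta>) * (1 / rat_of_int (det \<beta>)) = 1" using assms(2) by simp
  moreover have "map_mat rat_of_int \<beta> \<in> carrier_mat n n" using assms(1) by simp
  ultimately show ?thesis by (intro invertible_mat_if_det_unit)
qed

text \<open>
  Transports proportionality of columns from \<open>M Vhat\<close> back to \<open>Vhat\<close>. The factor is real, so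
  injectivity of \<open>M\<close> is needed over the reals.
\<close>

lemma positive_multiple_cancel:
  fixes M :: "int mat"
  assumes M: "M \<in> carrier_mat n n" "det M \<noteq> 0" and v: "v \<in> carrier_vec n" and w: "w \<in> carrier_vec n"
    and eq: "rvec (M *\<^sub>v v) = c \<cdot>\<^sub>v rvec (M *\<^sub>v w)"
  shows "rvec v = c \<cdot>\<^sub>v rvec w"
proof -
  let ?R = "map_mat real_of_int M"
  have R: "?R \<in> carrier_mat n n" using M by auto
  have "det ?R = real_of_int (det M)" by (simp add: of_int_hom.hom_det)
  then have d: "det ?R \<noteq> 0" using M(2) by simp
  have RM: "rvec (M *\<^sub>v x) = ?R *\<^sub>v rvec x" if "x \<in> carrier_vec n" for x
    using of_int_hom.mult_mat_vec_hom[OF M(1) that] by simp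
  define x where "x = rvec v - c \<cdot>\<^sub>v rvec w"
  have x: "x \<in> carrier_vec n" unfolding x_def using v w by auto
  have "?R *\<^sub>v x = ?R *\<^sub>v rvec v - ?R *\<^sub>v (c \<cdot>\<^sub>v rvec w)"
    unfolding x_def using R v w by (intro mult_minus_distrib_mat_vec) auto
  also have "?R *\<^sub>v (c \<cdot>\<^sub>v rvec w) = c \<cdot>\<^sub>v (?R *\<^sub>v rvec w)" using R w by (intro mult_mat_vec) auto
  also have "?R *\<^sub>v rvec v - c \<cdot>\<^sub>v (?R *\<^sub>v rvec w) = 0\<^sub>v n" using eq RM v w R by auto
  finally have "x = 0\<^sub>v n" using det_0_iff_vec_prod_zero[OF R] d x by auto
  show ?thesis
  proof (rule eq_vecI)
    fix i assume "i < dim_vec (c \<cdot>\<^sub>v rvec w)"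
    then have i: "i < n" using w by simp
    have "x $ i = 0" using \<open>x = 0\<^sub>v n\<close> i by simp
    then show "rvec v $ i = (c \<cdot>\<^sub>v rvec w) $ i" unfolding x_def using i v w by simp
  qed (use v w in auto)
qed

text \<open>
  Different columns generate different rays, so the \<open>m\<close> columns give \<open>m\<close> of the \<open>m\<close> rays, that
  is all of them.
\<close>

lemma fan_matrix_from_exponents:
  assumes fan: "rational_fan n \<Delta>" and card: "card (rays n \<Delta>) = m"
    and V: "V \<in> carrier_mat n m" and W: "W \<in> carrier_mat n m"
    and P: "P \<in> carrier_mat n n" "invertible_mat P" "V = P * W"
    and rays: "\<And>j. j < m \<Longrightarrow> ray_of (rvec (col V j)) \<in> \<Delta>"
    and nz: "\<And>j. j < m \<Longrightarrow> col V j \<noteq> 0\<^sub>v n"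
    and distinct: "\<And>i j c. i < m \<Longrightarrow> j < m \<Longrightarrow> i \<noteq> j \<Longrightarrow> 0 < c \<Longrightarrow> rvec (col V i) \<noteq> c \<cdot>\<^sub>v rvec (col V j)"
  shows "fan_matrix n \<Delta> W"
proof -
  let ?f = "\<lambda>j. ray_of (rvec (col V j))"
  have rnz: "rvec (col V j) \<noteq> 0\<^sub>v n" if "j < m" for j
  proof
    assume *: "rvec (col V j) = 0\<^sub>v n"
    have "col V j = 0\<^sub>v n"
    proof (rule eq_vecI)
      fix i assume "i < dim_vec (0\<^sub>v n :: int vec)"
      then show "col V j $ i = 0\<^sub>v n $ i"
        using arg_cong[OF *, of "\<lambda>z. z $ i"] V by simp
    qed (use V in auto)
    then show False using nz[OF that] by simp
  qed
  have "inj_on ?f {..<m}"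
  proof (rule inj_onI, rule ccontr)
    fix i j assume ij: "i \<in> {..<m}" "j \<in> {..<m}" "?f i = ?f j" "i \<noteq> j"
    have "rvec (col V i) = 1 \<cdot>\<^sub>v rvec (col V i)" by simp
    then have "rvec (col V i) \<in> ?f i" unfolding ray_of_def
        by (metis (mono_tags, lifting) mem_Collect_eq zero_le_one)
    then obtain c where c: "0 \<le> c" "rvec (col V i) = c \<cdot>\<^sub>v rvec (col V j)"
        using ij(3) unfolding ray_of_def by auto
    have "c \<noteq> 0"
    proof
      assume "c = 0"
      then have "rvec (col V i) = 0\<^sub>v n" using c(2) V by (intro eq_vecI) auto
      then show False using rnz ij(1) by auto
    qed
    then show False using distinct[of i j c] ij c by auto
  qed
  moreover have sub: "?f ` {..<m} \<subseteq> rays n \<Delta>"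
  proof
    fix \<rho> assume "\<rho> \<in> ?f ` {..<m}"
    then obtain j where j: "j < m" "\<rho> = ?f j" by auto
    have "rvec (col V j) \<in> carrier_vec n" using V by auto
    then show "\<rho> \<in> rays n \<Delta>" unfolding rays_def using rays[OF j(1)] rnz[OF j(1)] j(2) by blast
  qed
  moreover have "finite (rays n \<Delta>)" using fan unfolding rational_fan_def rays_def by auto
  ultimately have "?f ` {..<m} = rays n \<Delta>" using card
      by (intro card_subset_eq) (auto simp: card_image)
  then have "bij_betw ?f {..<m} (rays n \<Delta>)" using \<open>inj_on ?f {..<m}\<close> unfolding bij_betw_def by blast
  then show ?thesis unfolding fan_matrix_def using W P card by (intro conjI bexI[of _ P]) auto
qed

theorem theorem4p2:
  fixes n r s :: nat and \<tau> :: "nat \<Rightarrow> nat"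
    and \<Delta> \<Delta>hat :: "real vec set set"
    and Q Vhat C K :: "int mat" and \<Gamma> :: "int set mat"
    and Z :: "complex vec set" and \<pi> :: "complex vec \<Rightarrow> toric_point"
  assumes "rational_fan n \<Delta>" "simplicial_fan n \<Delta>" "complete_fan n \<Delta>"
    and "card (rays n \<Delta>) = n + r"
    and "\<forall>k<s. 1 < \<tau> k" "\<forall>k. Suc k < s \<longrightarrow> \<tau> k dvd \<tau> (Suc k)"
    and "reduced_W_matrix n r Q"
    and "torsion_matrix s (n + r) \<tau> \<Gamma>"
    and "gale_dual Q Vhat"
    and "rational_fan n \<Delta>hat" "simplicial_fan n \<Delta>hat" "complete_fan n \<Delta>hat"
    and "rays n \<Delta>hat = {ray_of (rvec (col Vhat j)) |j. j < n + r}"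
    and "Z = irrelevant_zeros Vhat \<Delta>hat"
    and "toric_quotient_presentation n \<Delta> Z \<tau> Q \<Gamma> \<pi>"
    and "represents C \<Gamma>"
    and "K = (Vhat * transpose_mat C) @\<^sub>r mat_diag s (\<lambda>k. int (\<tau> k))"
  shows "(\<exists>U\<in>carrier_mat (n + s) (n + s). invertible_mat U \<and> HNF K = U * K) \<and>
    (\<forall>U\<in>carrier_mat (n + s) (n + s). invertible_mat U \<and> HNF K = U * K \<longrightarrow>
       (let \<beta> = mat n n (\<lambda>(i, j). U $$ (s + i, j)) in
          invertible_mat (map_mat rat_of_int \<beta>) \<and> fan_matrix n \<Delta> (\<beta> * Vhat)))"
proof -
  let ?m = "n + r"
  have Q: "Q \<in> carrier_mat r ?m" using assms(7) unfolding reduced_W_matrix_def W_matrix_def by blast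
  have F: "F_matrix n r Vhat"
    using assms(7,9) unfolding reduced_W_matrix_def reduced_F_matrix_def by blast
  then have Vhat: "Vhat \<in> carrier_mat n ?m" unfolding F_matrix_def by blast
  have \<Gamma>: "\<Gamma> \<in> carrier_mat s ?m" using assms(8) unfolding torsion_matrix_def by blast
  have C: "C \<in> carrier_mat s ?m" using assms(16) \<Gamma> unfolding represents_def by auto
  have A: "Vhat * transpose_mat C \<in> carrier_mat n s" using Vhat C by auto
  have \<tau>: "\<forall>k<s. 0 < \<tau> k" using assms(5) by auto
  note Kfacts = torsion_left_kernel[OF A \<tau>, folded assms(17)]
  have HNF: "hermite_form (HNF K)" "row_equivalent K (HNF K)"
    using HNF_full_column_rank[OF Kfacts(2)] Kfacts(1) by auto
  define G where "G = weight_vec Q \<Gamma> ` quot_group r s \<tau>"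
  have G: "G \<subseteq> big_torus ?m"
    unfolding G_def using weight_vec_torus[OF Q \<Gamma>] quot_group_torus[OF _ assms(5)] by fast
  have "\<Delta>hat \<noteq> {}" using assms(10) unfolding rational_fan_def by blast
  then have TZ: "big_torus ?m \<inter> Z = {}" unfolding assms(14)
      by (rule irrelevant_zeros_torus[OF Vhat])
  interpret T: torus_quotient n ?m \<Delta> Z G \<pi>
  proof
    have "{cw_mult g |g. g \<in> G} =
        {cw_mult (weight_vec Q \<Gamma> g) |g. g \<in> quot_group (dim_row Q) (dim_row \<Gamma>) \<tau>}"
      unfolding G_def using Q \<Gamma> by auto
    then show "geometric_quotient
        (subtopology (zariski (carrier_vec ?m) (poly_functions ?m)) (carrier_vec ?m - Z))
        (regular_on (poly_functions ?m)) (toric_topology n \<Delta>) (toric_regular n \<Delta>)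
        {cw_mult g |g. g \<in> G} \<pi>"
      using assms(15) Q unfolding toric_quotient_presentation_def Let_def by auto
  qed (use assms(1,15) G TZ Q in \<open>auto simp: toric_quotient_presentation_def Let_def\<close>)
  obtain V where V: "V \<in> carrier_mat n ?m"
    "\<forall>x\<in>big_torus ?m. \<forall>a\<in>carrier_vec n. snd (\<pi> x) a = monomial x (transpose_mat V *\<^sub>v a)"
    using T.torus_map_is_monomial by blast
  interpret E: torus_quotient_exponents n ?m \<Delta> Z G \<pi> V
    using V by unfold_locales auto
  define L where "L = {v \<in> carrier_vec ?m. Q *\<^sub>v v = 0\<^sub>v r \<and> (\<forall>k<s. int (\<tau> k) dvd (C *\<^sub>v v) $ k)}"
  have VL: "row_lattice V = L"
    using E.row_lattice_eq_annihilator weight_annihilator[OF Q assms(8,16,5)]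
        unfolding L_def G_def by simp
  show ?thesis
  proof (intro conjI ballI impI)
    show "\<exists>U\<in>carrier_mat (n + s) (n + s). invertible_mat U \<and> HNF K = U * K"
      using HNF(2) Kfacts(1) unfolding row_equivalent_def by auto
    fix U assume U: "U \<in> carrier_mat (n + s) (n + s)" "invertible_mat U \<and> HNF K = U * K"
    define \<beta> where "\<beta> = mat n n (\<lambda>(i, j). U $$ (s + i, j))"
    have \<beta>: "\<beta> \<in> carrier_mat n n" unfolding \<beta>_def by auto
    have "hermite_form (U * K)" using HNF(1) U(2) by simp
    from hermite_transform_block_basis[OF A \<tau> assms(17) U(1) _ this]
    have basis: "rows_form_basis \<beta> {a \<in> carrier_vec n. \<forall>k<s. int (\<tau> k) dvd (transpose_mat (Vhat *
        transpose_mat C) *\<^sub>v a) $ k}"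
      using U(2) unfolding \<beta>_def by blast
    have det\<beta>: "det \<beta> \<noteq> 0"
      using det_nonzero_if_rows_independent[OF \<beta>] basis unfolding rows_form_basis_iff by blast
    define W where "W = \<beta> * Vhat"
    have W: "W \<in> carrier_mat n ?m" unfolding W_def using \<beta> Vhat by auto
    have WL: "row_lattice W = L" "rows_independent W"
      using rows_form_basis_mult_gale_dual[OF Q Vhat assms(9) C \<beta> basis]
      unfolding W_def L_def rows_form_basis_iff by auto
    obtain P where P: "P \<in> carrier_mat n n" "invertible_mat P" "V = P * W"
      using same_row_lattice_unimodular[OF V(1) W _ WL(2)] VL WL(1) by auto
    obtain P' where P': "P' \<in> carrier_mat n n" "P * P' = 1\<^sub>m n" "P' * P = 1\<^sub>m n"
      using invertible_mat_inverseE[OF P(2,1)] by blast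
    define M where "M = P * \<beta>"
    have M: "M \<in> carrier_mat n n" unfolding M_def using P \<beta> by auto
    have "det P * det P' = 1" using det_mult[OF P(1) P'(1)] P'(2) by simp
    then have detM: "det M \<noteq> 0" using det_mult[OF P(1) \<beta>] det\<beta> unfolding M_def by auto
    have VM: "V = M * Vhat" unfolding P(3) W_def M_def
        using P(1) \<beta> Vhat by (simp add: assoc_mult_mat[of _ n n _ n _ ?m])
    have col: "col V j = M *\<^sub>v col Vhat j" if "j < ?m" for j
      unfolding VM using M Vhat that by (intro col_mult2) auto
    have nz: "col V j \<noteq> 0\<^sub>v n" if j: "j < ?m" for j
    proof
      assume "col V j = 0\<^sub>v n"
      then have "M *\<^sub>v col Vhat j = 0\<^sub>v n" using col[OF j] by simp
      moreover have "col Vhat j \<in> carrier_vec n" using Vhat by (auto intro: carrier_vecI)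
      ultimately have "col Vhat j = 0\<^sub>v n" using det_0_iff_vec_prod_zero[OF M] detM by blast
      then show False using F j unfolding F_matrix_def by auto
    qed
    have "rows_independent V"
      unfolding rows_independent_def
    proof (intro ballI impI)
      fix a assume a: "a \<in> carrier_vec (dim_row V)" "transpose_mat V *\<^sub>v a = 0\<^sub>v (dim_col V)"
      then have an: "a \<in> carrier_vec n" using V(1) by simp
      have "transpose_mat W *\<^sub>v (transpose_mat P *\<^sub>v a) = 0\<^sub>v ?m"
        using a(2) transpose_mult_vec[OF P(1) W an] W unfolding P(3) by simp
      moreover have "transpose_mat P *\<^sub>v a \<in> carrier_vec n" using P(1) an by auto
      ultimately have "transpose_mat P *\<^sub>v a = 0\<^sub>v n"
          using WL(2) W unfolding rows_independent_def by auto
      then have "transpose_mat P' *\<^sub>v (transpose_mat P *\<^sub>v a) = 0\<^sub>v n" using P'(1) by auto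
      then show "a = 0\<^sub>v (dim_row V)" using transpose_mult_vec[OF P(1) P'(1) an] P'(2) an V(1)
          by simp
    qed
    then obtain R d where R: "R \<in> carrier_mat ?m n" "V * R = d \<cdot>\<^sub>m 1\<^sub>m n" "d \<noteq> 0"
      using rational_right_inverse[OF V(1)] by blast
    have rays: "ray_of (rvec (col V j)) \<in> \<Delta>" if j: "j < ?m" for j
    proof (rule E.ray_of_column_in_fan[OF j _ nz[OF j] R])
      have "ray_of (rvec (col Vhat j)) \<in> rays n \<Delta>hat" unfolding assms(13) using j by blast
      then have "ray_of (rvec (col Vhat j)) \<in> \<Delta>hat" unfolding rays_def by blast
      then show "E.boundary j \<inter> Z = {}"
        using irrelevant_zeros_boundary[OF Vhat j] unfolding assms(14) E.boundary_def by blast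
    qed
    have distinct: "rvec (col V i) \<noteq> c \<cdot>\<^sub>v rvec (col V j)"
      if ij: "i < ?m" "j < ?m" "i \<noteq> j" "0 < c" for i j c
    proof
      assume "rvec (col V i) = c \<cdot>\<^sub>v rvec (col V j)"
      then have "rvec (col Vhat i) = c \<cdot>\<^sub>v rvec (col Vhat j)"
        using positive_multiple_cancel[OF M detM, of "col Vhat i" "col Vhat j" c] col ij Vhat
            by auto
      then show False using F ij unfolding F_matrix_def by blast
    qed
    have "fan_matrix n \<Delta> W"
      using fan_matrix_from_exponents[OF assms(1,4) V(1) W P rays nz distinct] by blast
    then show "let \<beta> = mat n n (\<lambda>(i, j). U $$ (s + i, j)) in
          invertible_mat (map_mat rat_of_int \<beta>) \<and> fan_matrix n \<Delta> (\<beta> * Vhat)"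
      using invertible_rat_mat_if_det[OF \<beta> det\<beta>] unfolding Let_def W_def \<beta>_def by blast
  qed
qed

end
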